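(* Let $F$ be an algebraically closed field of characteristic zero, let $\lambda=(\lambda_1,\dots,\lambda_n)$ be a composition of $N$ (positive parts) such that either $\lambda_1\ge\cdots\ge\lambda_n$ or $\lambda_1\le\cdots\le\lambda_n$, let $e\in\mathfrak{g}=\mathfrak{gl}_N(F)$ be the nilpotent matrix with Jordan blocks of sizes $\lambda_1,\dots,\lambda_n$ in order down the diagonal, and let $Z(\mathfrak{g}_e)$ be the center of the universal enveloping algebra $U(\mathfrak{g}_e)$ of the centralizer $\mathfrak{g}_e$ of $e$ in $\mathfrak{g}$. Then the elements $z_1,\dots,z_N\in U(\mathfrak{g}_e)$ defined below are algebraically independent generators of $Z(\mathfrak{g}_e)$.
   Context: Let $e_{h,k}$ denote the matrix units of $\mathfrak{gl}_N(F)$. Draw a diagram with rows $1,\dots,n$ (top to bottom) having $\lambda_i$ boxes in row $i$ in columns $1,\dots,\lambda_i$; write $1,\dots,N$ into the boxes along rows (left to right, top row first), and let $\mathrm{row}(h),\mathrm{col}(h)$ be the row and column of the box containing $h$. For $1\le i,j\le n$ and $\lambda_j-\min(\lambda_i,\lambda_j)\le r<\lambda_j$ set $e_{i,j;r}:=\sum e_{h,k}$, the sum over all $1\le h,k\le N$ with $\mathrm{row}(h)=i$, $\mathrm{row}(k)=j$, $\mathrm{col}(k)-\mathrm{col}(h)=r$; these form a basis of $\mathfrak{g}_e$. Set $\tilde e_{i,j;r}:=e_{i,j;r}-\delta_{r,0}\delta_{i,j}(i-1)\lambda_i$. The invariant degrees $(d_1,\dots,d_N)$ are: $d$ consists of $\lambda_1$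 copies of $1$, then $\lambda_2$ copies of $2$, ..., then $\lambda_n$ copies of $n$ if $\lambda_1\ge\cdots\ge\lambda_n$; and of $\lambda_n$ copies of $1$, then $\lambda_{n-1}$ copies of $2$, ..., then $\lambda_1$ copies of $n$ if $\lambda_1\le\cdots\le\lambda_n$. Write $\mu\subseteq\lambda$ if $\mu=(\mu_1,\dots,\mu_n)$ with $0\le\mu_i\le\lambda_i$ for all $i$; $|\mu|=\sum\mu_i$ and $\ell(\mu)$ is the number of nonzero parts. For $0\ne\mu\subseteq\lambda$ with $\ell(\mu)=d_{|\mu|}=:d$, with nonzero parts in positions $i_1<\cdots<i_d$, define $\mathrm{cdet}(\mu):=\sum_{w\in S_d}\mathrm{sgn}(w)\,\tilde e_{i_{w1},i_1;\mu_{i_1}-1}\tilde e_{i_{w2},i_2;\mu_{i_2}-1}\cdots\tilde e_{i_{wd},i_d;\mu_{i_d}-1}$ (all $e_{i,j;r}$ occurring here satisfy $\lambda_j-\min(\lambda_i,\lambda_j)\le r<\lambda_j$). For $r=1,\dots,N$ define $z_r:=\sum_{\mu\subseteq\lambda,\ |\mu|=r,\ \ell(\mu)=d_r}\mathrm{cdet}(\mu)$. *)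

theory Defs
  imports Main "HOL-Library.Poly_Mapping" "HOL-Combinatorics.Permutations"
          "HOL-Computational_Algebra.Polynomial"
begin

definition alg_closed :: "'a::field itself \<Rightarrow> bool" where
  "alg_closed _ \<longleftrightarrow> (\<forall>p :: 'a poly. degree p > 0 \<longrightarrow> (\<exists>x. poly p x = 0))"

section \<open>Free associative algebra on a set of letters, as finitely supported
  functions on words (lists of letters)\<close>

definition fa_mult :: "('x list \<Rightarrow>\<^sub>0 'a::comm_ring_1) \<Rightarrow> ('x list \<Rightarrow>\<^sub>0 'a) \<Rightarrow> ('x list \<Rightarrow>\<^sub>0 'a)" where
  "fa_mult p q = (\<Sum>u\<in>Poly_Mapping.keys p. \<Sum>v\<in>Poly_Mapping.keys q. Poly_Mapping.single (u @ v) (Poly_Mapping.lookup p u * Poly_Mapping.lookup q v))"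

definition fa_scal :: "'a::comm_ring_1 \<Rightarrow> ('x list \<Rightarrow>\<^sub>0 'a)" where
  "fa_scal c = Poly_Mapping.single [] c"

definition fa_gen :: "'x \<Rightarrow> ('x list \<Rightarrow>\<^sub>0 'a::comm_ring_1)" where
  "fa_gen x = Poly_Mapping.single [x] 1"

fun fa_pow :: "('x list \<Rightarrow>\<^sub>0 'a::comm_ring_1) \<Rightarrow> nat \<Rightarrow> ('x list \<Rightarrow>\<^sub>0 'a)" where
  "fa_pow p 0 = fa_scal 1"
| "fa_pow p (Suc k) = fa_mult p (fa_pow p k)"

definition fa_prod_list :: "('x list \<Rightarrow>\<^sub>0 'a::comm_ring_1) list \<Rightarrow> ('x list \<Rightarrow>\<^sub>0 'a)" where
  "fa_prod_list ps = foldr fa_mult ps (fa_scal 1)"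

definition FA :: "'x set \<Rightarrow> ('x list \<Rightarrow>\<^sub>0 'a::comm_ring_1) set" where
  "FA L = {p. \<forall>w\<in>Poly_Mapping.keys p. set w \<subseteq> L}"

inductive_set fa_ideal :: "'x set \<Rightarrow> ('x list \<Rightarrow>\<^sub>0 'a::comm_ring_1) set \<Rightarrow> ('x list \<Rightarrow>\<^sub>0 'a) set"
  for L R where
  base: "r \<in> R \<Longrightarrow> r \<in> fa_ideal L R"
| zero: "0 \<in> fa_ideal L R"
| add: "p \<in> fa_ideal L R \<Longrightarrow> q \<in> fa_ideal L R \<Longrightarrow> p + q \<in> fa_ideal L R"
| mult: "p \<in> fa_ideal L R \<Longrightarrow> a \<in> FA L \<Longrightarrow> b \<in> FA L \<Longrightarrow> fa_mult a (fa_mult p b) \<in> fa_ideal L R"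

type_synonym 'a mat = "nat \<Rightarrow> nat \<Rightarrow> 'a"

definition glN :: "nat \<Rightarrow> 'a::zero mat set" where
  "glN N = {A. \<forall>h k. \<not> (h \<in> {1..N} \<and> k \<in> {1..N}) \<longrightarrow> A h k = 0}"

definition madd :: "'a::plus mat \<Rightarrow> 'a mat \<Rightarrow> 'a mat" where
  "madd A B = (\<lambda>h k. A h k + B h k)"

definition msmult :: "'a::times \<Rightarrow> 'a mat \<Rightarrow> 'a mat" where
  "msmult c A = (\<lambda>h k. c * A h k)"

definition mmul :: "nat \<Rightarrow> 'a::comm_ring_1 mat \<Rightarrow> 'a mat \<Rightarrow> 'a mat" where
  "mmul N A B = (\<lambda>h k. \<Sum>l\<in>{1..N}. A h l * B l k)"

definition mbracket :: "nat \<Rightarrow> 'a::comm_ring_1 mat \<Rightarrow> 'a mat \<Rightarrow> 'a mat" where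
  "mbracket N A B = (\<lambda>h k. mmul N A B h k - mmul N B A h k)"

section \<open>Universal enveloping algebra of a Lie subalgebra L of gl_N:
  free algebra on the set L modulo the ideal generated by linearity relations and
  x y - y x - [x,y]\<close>

definition uea_rels :: "nat \<Rightarrow> 'a::comm_ring_1 mat set \<Rightarrow> ('a mat list \<Rightarrow>\<^sub>0 'a) set" where
  "uea_rels N L =
     {fa_gen (madd x y) - fa_gen x - fa_gen y | x y. x \<in> L \<and> y \<in> L}
   \<union> {fa_gen (msmult c x) - fa_mult (fa_scal c) (fa_gen x) | c x. x \<in> L}
   \<union> {fa_mult (fa_gen x) (fa_gen y) - fa_mult (fa_gen y) (fa_gen x) - fa_gen (mbracket N x y)
       | x y. x \<in> L \<and> y \<in> L}"

definition uea_ideal :: "nat \<Rightarrow> 'a::comm_ring_1 mat set \<Rightarrow> ('a mat list \<Rightarrow>\<^sub>0 'a) set" where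
  "uea_ideal N L = fa_ideal L (uea_rels N L)"

text \<open>Center of U(L), as a set of representatives in the free algebra.\<close>
definition uea_center :: "nat \<Rightarrow> 'a::comm_ring_1 mat set \<Rightarrow> ('a mat list \<Rightarrow>\<^sub>0 'a) set" where
  "uea_center N L = {u \<in> FA L. \<forall>v \<in> FA L. fa_mult v u - fa_mult u v \<in> uea_ideal N L}"

definition lam_at :: "nat list \<Rightarrow> nat \<Rightarrow> nat" where
  "lam_at lam i = lam ! (i - 1)"

definition Nsz :: "nat list \<Rightarrow> nat" where
  "Nsz lam = sum_list lam"

definition pre :: "nat list \<Rightarrow> nat \<Rightarrow> nat" where
  "pre lam i = sum_list (take (i - 1) lam)"

definition row :: "nat list \<Rightarrow> nat \<Rightarrow> nat" where
  "row lam h = (THE i. 1 \<le> i \<and> i \<le> length lam \<and> pre lam i < h \<and> h \<le> pre lam i + lam_at lam i)"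

definition col :: "nat list \<Rightarrow> nat \<Rightarrow> nat" where
  "col lam h = h - pre lam (row lam h)"

definition nil_e :: "nat list \<Rightarrow> 'a::comm_ring_1 mat" where
  "nil_e lam = (\<lambda>h k. if h \<in> {1..Nsz lam} \<and> k \<in> {1..Nsz lam} \<and> row lam h = row lam k
                          \<and> col lam k = col lam h + 1 then 1 else 0)"

definition centralizer :: "nat list \<Rightarrow> 'a::comm_ring_1 mat set" where
  "centralizer lam = {A \<in> glN (Nsz lam). mmul (Nsz lam) A (nil_e lam) = mmul (Nsz lam) (nil_e lam) A}"

definition Emat :: "nat list \<Rightarrow> nat \<Rightarrow> nat \<Rightarrow> nat \<Rightarrow> 'a::comm_ring_1 mat" where
  "Emat lam i j r = (\<lambda>h k. if h \<in> {1..Nsz lam} \<and> k \<in> {1..Nsz lam} \<and> row lam h = i \<and> row lam k = j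
                          \<and> col lam k = col lam h + r then 1 else 0)"

definition etil :: "nat list \<Rightarrow> nat \<Rightarrow> nat \<Rightarrow> nat \<Rightarrow> ('a::comm_ring_1 mat list \<Rightarrow>\<^sub>0 'a)" where
  "etil lam i j r = fa_gen (Emat lam i j r)
     - (if r = 0 \<and> i = j then fa_scal (of_nat ((i - 1) * lam_at lam i)) else 0)"

text \<open>Invariant degrees d_1,...,d_N.\<close>
definition dseq :: "nat list \<Rightarrow> nat \<Rightarrow> nat" where
  "dseq lam r = (if sorted (rev lam) then row lam r else row (rev lam) r)"

definition subcomps :: "nat list \<Rightarrow> nat list set" where
  "subcomps lam = {mu. length mu = length lam \<and> (\<forall>i < length lam. mu ! i \<le> lam ! i)}"

definition nz_len :: "nat list \<Rightarrow> nat" where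
  "nz_len mu = length (filter (\<lambda>x. x \<noteq> 0) mu)"

definition nz_pos :: "nat list \<Rightarrow> nat list" where
  "nz_pos mu = filter (\<lambda>i. mu ! (i - 1) \<noteq> 0) [1..<length mu + 1]"

definition cdet :: "nat list \<Rightarrow> nat list \<Rightarrow> ('a::comm_ring_1 mat list \<Rightarrow>\<^sub>0 'a)" where
  "cdet lam mu = (let ix = nz_pos mu; d = length ix in
     \<Sum>w \<in> {w. w permutes {..<d}}.
        fa_mult (fa_scal (of_int (sign w)))
          (fa_prod_list (map (\<lambda>t. etil lam (ix ! (w t)) (ix ! t) (mu ! (ix ! t - 1) - 1)) [0..<d])))"

definition zgen :: "nat list \<Rightarrow> nat \<Rightarrow> ('a::comm_ring_1 mat list \<Rightarrow>\<^sub>0 'a)" where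
  "zgen lam r = (\<Sum>mu \<in> {mu \<in> subcomps lam. sum_list mu = r \<and> nz_len mu = dseq lam r}. cdet lam mu)"

definition poly_vars_in :: "((nat \<Rightarrow>\<^sub>0 nat) \<Rightarrow>\<^sub>0 'a::zero) \<Rightarrow> nat set \<Rightarrow> bool" where
  "poly_vars_in P V \<longleftrightarrow> (\<forall>m \<in> Poly_Mapping.keys P. Poly_Mapping.keys m \<subseteq> V)"

definition eval_poly :: "((nat \<Rightarrow>\<^sub>0 nat) \<Rightarrow>\<^sub>0 'a::comm_ring_1) \<Rightarrow> nat \<Rightarrow> (nat \<Rightarrow> ('x list \<Rightarrow>\<^sub>0 'a))
                          \<Rightarrow> ('x list \<Rightarrow>\<^sub>0 'a)" where
  "eval_poly P N z = (\<Sum>m \<in> Poly_Mapping.keys P. fa_mult (fa_scal (Poly_Mapping.lookup P m))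
       (fa_prod_list (map (\<lambda>r. fa_pow (z r) (Poly_Mapping.lookup m r)) [1..<N + 1])))"

end

theory Submission
  imports Defs
begin

text \<open>Centrality is checked by commuting \<open>z\<^sub>r\<close> with the elements \<open>e\<^sub>a\<^sub>,\<^sub>b\<^sub>;\<^sub>s\<close> for \<open>b \<in> {a - 1, a, a + 1}\<close>,
  which generate the centralizer. The commutators of the columns cancel in pairs, because
  \<open>z\<^sub>r\<close> is extremal: no \<open>d - 1\<close> columns can carry a total degree exceeding \<open>r - d\<close>.
  One correction survives, and the shift by \<open>(i - 1) \<lambda>\<^sub>i\<close> compensates it.

  For generation and independence, matrix coefficients of \<open>gl\<^sub>N\<close> give functionals on
  the enveloping algebra whose products (shuffle products on words) detect the top-degree symbol
  of an element, so that the injective half of the Poincare-Birkhoff-Witt theorem is not needed.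
  Symbols of central elements are invariant under the coadjoint action. On an affine slice of
  companion matrices the symbol of \<open>z\<^sub>r\<close> is plus or minus the \<open>r\<close>-th coordinate, and a torus
  grades the slice so that only monomials of the expected degree occur. The stabilizer of each point of
  the slice meets the annihilator of the slice directions trivially; hence an invariant that vanishes on the slice
  vanishes, and the degree of a central element can be lowered by subtracting a polynomial
  in the \<open>z\<^sub>r\<close>.\<close>

section \<open>The free associative algebra as a ring\<close>

text \<open>A linear form on \<open>L\<close>, extended by zero to longer words, in general violates
  the relation for x y - y x and [x,y], so it gives no functional on the enveloping algebra. The
  embedding in matrices repairs this: a matrix coefficient respects all relations and can be any
  prescribed form on single letters. The shuffle product is dual to the coproduct with primitive
  letters, so products of such functionals again respect the relations, and they separate monomials
  with different multisets of factors. The shift by (i - 1) \<lambda>_i comes from two neighbouring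
  columns a and b that the bracket has made equal. Their entries do not commute, and the commutators
  depend only on the sum m of the two degrees, which arises in m + 1 ways. Extremality leaves only m
  = \<lambda>_b - 1 with \<lambda>_a = \<lambda>_b, so the defect is \<lambda>_b times a fixed term,
  and the shifts of neighbouring equal parts differ by just this amount. For unequal parts no
  correction arises, so one formula serves increasing and decreasing \<lambda>; only the invariant
  degrees are read in the order of decreasing parts.\<close>

instantiation list :: (type) monoid_add
begin
definition zero_list :: "'a list" where "zero_list = []"
definition plus_list :: "'a list \<Rightarrow> 'a list \<Rightarrow> 'a list" where "plus_list = (@)"
instance by standard (simp_all add: zero_list_def plus_list_def)
end

lemma poly_mapping_sum_single:
  "p = (\<Sum>k\<in>Poly_Mapping.keys p. Poly_Mapping.single k (Poly_Mapping.lookup p k))"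
proof (rule poly_mapping_eqI)
  fix k
  show "Poly_Mapping.lookup p k =
    Poly_Mapping.lookup (\<Sum>k\<in>Poly_Mapping.keys p. Poly_Mapping.single k (Poly_Mapping.lookup p k)) k"
    by (auto simp: lookup_sum lookup_single when_def in_keys_iff)
qed

text \<open>Words form a monoid under append, and convolution over this monoid is concatenation
  extended bilinearly. The ring laws and the calculus of sums thus become available for the free
  algebra.\<close>

lemma fa_mult_eq_times: "fa_mult p q = p * q"
proof -
  have "p * q = (\<Sum>u\<in>Poly_Mapping.keys p. Poly_Mapping.single u (Poly_Mapping.lookup p u)) *
    (\<Sum>v\<in>Poly_Mapping.keys q. Poly_Mapping.single v (Poly_Mapping.lookup q v))"
    using poly_mapping_sum_single[of p] poly_mapping_sum_single[of q] by simp
  also have "\<dots> = fa_mult p q"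
    unfolding fa_mult_def by (simp add: sum_product mult_single plus_list_def)
  finally show ?thesis ..
qed

lemma fa_scal_1: "fa_scal 1 = 1"
  by (simp add: fa_scal_def flip: zero_list_def)

lemma fa_scal_0: "fa_scal 0 = 0"
  by (simp add: fa_scal_def)

lemma fa_scal_add: "fa_scal (a + b) = fa_scal a + fa_scal b"
  by (simp add: fa_scal_def single_add)

lemma fa_scal_mult: "fa_scal (a * b) = fa_scal a * fa_scal b"
  by (simp add: fa_scal_def mult_single plus_list_def)

lemma fa_scal_uminus: "fa_scal (- a) = - fa_scal a"
  by (simp add: fa_scal_def single_uminus)

lemma fa_scal_of_int: "fa_scal (of_int k) = of_int k"
  by (simp add: fa_scal_def flip: zero_list_def)

lemma fa_scal_of_nat: "fa_scal (of_nat k) = of_nat k"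
  by (simp add: fa_scal_def flip: zero_list_def)

lemma fa_scal_times_single: "fa_scal c * Poly_Mapping.single w d = Poly_Mapping.single w (c * d)"
  by (simp add: fa_scal_def mult_single plus_list_def)

lemma fa_scal_commute: "fa_scal c * p = p * fa_scal c"
proof -
  have "fa_scal c * (\<Sum>k\<in>Poly_Mapping.keys p. Poly_Mapping.single k (Poly_Mapping.lookup p k)) =
    (\<Sum>k\<in>Poly_Mapping.keys p. Poly_Mapping.single k (Poly_Mapping.lookup p k)) * fa_scal c"
    by (simp add: sum_distrib_left sum_distrib_right fa_scal_def mult_single plus_list_def mult.commute)
  then show ?thesis using poly_mapping_sum_single[of p] by simp
qed

lemma fa_pow_eq_power: "fa_pow p k = p ^ k"
  by (induction k) (simp_all add: fa_scal_1 fa_mult_eq_times)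

lemma fa_prod_list_eq: "fa_prod_list ps = prod_list ps"
  unfolding fa_prod_list_def by (induction ps) (simp_all add: fa_scal_1 fa_mult_eq_times)

lemma single_Cons: "Poly_Mapping.single (x # w) (1::'a::comm_ring_1) = fa_gen x * Poly_Mapping.single w 1"
  by (simp add: fa_gen_def mult_single plus_list_def)

lemma single_eq_prod_list: "Poly_Mapping.single w (1::'a::comm_ring_1) = prod_list (map fa_gen w)"
  by (induction w) (simp_all add: single_Cons flip: fa_scal_1[unfolded fa_scal_def])

lemma zero_in_FA: "0 \<in> FA L"
  by (simp add: FA_def)

lemma single_in_FA: "set w \<subseteq> L \<Longrightarrow> Poly_Mapping.single w c \<in> FA L"
  by (simp add: FA_def)

lemma fa_gen_in_FA: "x \<in> L \<Longrightarrow> fa_gen x \<in> FA L"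
  by (simp add: fa_gen_def single_in_FA)

lemma fa_scal_in_FA: "fa_scal c \<in> FA L"
  by (simp add: fa_scal_def single_in_FA)

lemma one_in_FA: "1 \<in> FA L"
  using fa_scal_in_FA[of 1] by (simp add: fa_scal_1)

lemma of_int_in_FA: "of_int k \<in> FA L"
  using fa_scal_in_FA[of "of_int k"] by (simp add: fa_scal_of_int)

lemma add_in_FA: "p \<in> FA L \<Longrightarrow> q \<in> FA L \<Longrightarrow> p + q \<in> FA L"
  using Poly_Mapping.keys_add[of p q] by (auto simp: FA_def)

lemma uminus_in_FA: "p \<in> FA L \<Longrightarrow> - p \<in> FA L"
  by (simp add: FA_def in_keys_iff)

lemma diff_in_FA: "p \<in> FA L \<Longrightarrow> q \<in> FA L \<Longrightarrow> p - q \<in> FA L"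
  using add_in_FA[of p L "- q"] by (simp add: uminus_in_FA)

lemma mult_in_FA: "p \<in> FA L \<Longrightarrow> q \<in> FA L \<Longrightarrow> p * q \<in> FA L"
  using keys_mult[of p q] unfolding FA_def plus_list_def by fastforce

lemma sum_in_FA: "(\<And>i. i \<in> A \<Longrightarrow> f i \<in> FA L) \<Longrightarrow> sum f A \<in> FA L"
  by (induction A rule: infinite_finite_induct) (simp_all add: zero_in_FA add_in_FA)

lemma prod_list_in_FA: "(\<And>p. p \<in> set ps \<Longrightarrow> p \<in> FA L) \<Longrightarrow> prod_list ps \<in> FA L"
  by (induction ps) (simp_all add: one_in_FA mult_in_FA)

section \<open>The filtration of the free algebra by word length\<close>

definition len_le :: "nat \<Rightarrow> ('x list \<Rightarrow>\<^sub>0 'a::zero) \<Rightarrow> bool" where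
  "len_le d p \<longleftrightarrow> (\<forall>w\<in>Poly_Mapping.keys p. length w \<le> d)"

lemma len_le_mono: "len_le d p \<Longrightarrow> d \<le> e \<Longrightarrow> len_le e p"
  by (auto simp: len_le_def)

lemma len_le_0: "len_le d 0"
  by (simp add: len_le_def)

lemma len_le_add: "len_le d p \<Longrightarrow> len_le d q \<Longrightarrow> len_le d (p + q)"
  using Poly_Mapping.keys_add[of p q] by (auto simp: len_le_def)

lemma len_le_uminus: "len_le d p \<Longrightarrow> len_le d (- p)" for p :: "'x list \<Rightarrow>\<^sub>0 'a::ab_group_add"
  by (simp add: len_le_def in_keys_iff)

lemma len_le_diff: "len_le d p \<Longrightarrow> len_le d q \<Longrightarrow> len_le d (p - q)" for p :: "'x list \<Rightarrow>\<^sub>0 'a::ab_group_add"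
  using len_le_add[of d p "- q"] by (simp add: len_le_uminus)

lemma len_le_mult: "len_le d p \<Longrightarrow> len_le e q \<Longrightarrow> len_le (d + e) (p * q)"
  for p :: "'x list \<Rightarrow>\<^sub>0 'a::comm_ring_1"
  using keys_mult[of p q] unfolding len_le_def plus_list_def by fastforce

lemma len_le_sum: "(\<And>i. i \<in> A \<Longrightarrow> len_le d (f i)) \<Longrightarrow> len_le d (sum f A)"
  for f :: "'i \<Rightarrow> 'x list \<Rightarrow>\<^sub>0 'a::comm_ring_1"
  by (induction A rule: infinite_finite_induct) (simp_all add: len_le_0 len_le_add)

lemma len_le_single: "length w \<le> d \<Longrightarrow> len_le d (Poly_Mapping.single w c)"
  by (simp add: len_le_def)

lemma len_le_scal: "len_le d (fa_scal c)"
  by (simp add: fa_scal_def len_le_single)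

lemma len_le_1: "len_le d (1 :: 'x list \<Rightarrow>\<^sub>0 'a::comm_ring_1)"
  using len_le_scal[of d 1] by (simp add: fa_scal_1)

lemma len_le_power: "len_le d p \<Longrightarrow> len_le (k * d) (p ^ k)" for p :: "'x list \<Rightarrow>\<^sub>0 'a::comm_ring_1"
  by (induction k) (auto simp: len_le_1 intro: len_le_mult)

lemma len_le_prod_list:
  fixes f :: "'i \<Rightarrow> 'x list \<Rightarrow>\<^sub>0 'a::comm_ring_1"
  shows "(\<And>i. i \<in> set is \<Longrightarrow> len_le (g i) (f i)) \<Longrightarrow> len_le (sum_list (map g is)) (prod_list (map f is))"
  by (induction "is") (auto simp: len_le_1 intro!: len_le_mult)

lemma len_le_gen: "len_le 1 (fa_gen x)"
  by (simp add: fa_gen_def len_le_single)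

lemma FA_len_le_ex: "\<exists>d. len_le d p"
  unfolding len_le_def by (rule exI[of _ "Max (insert 0 (length ` Poly_Mapping.keys p))"]) (auto intro!: Max_ge)

text \<open>The linear extension of \<open>f\<close> from words to the free algebra, with
  coefficients transported along \<open>\<iota>\<close>. The identity gives the pairing with
  functionals, the embedding as constant polynomials gives symbols.\<close>

definition ext :: "('a::zero \<Rightarrow> 'r::comm_ring_1) \<Rightarrow> ('w \<Rightarrow> 'r) \<Rightarrow> ('w \<Rightarrow>\<^sub>0 'a) \<Rightarrow> 'r" where
  "ext \<iota> f p = (\<Sum>w\<in>Poly_Mapping.keys p. \<iota> (Poly_Mapping.lookup p w) * f w)"

locale scalar_hom =
  fixes \<iota> :: "'a::comm_ring_1 \<Rightarrow> 'r::comm_ring_1"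
  assumes \<iota>_add: "\<iota> (a + b) = \<iota> a + \<iota> b"
    and \<iota>_mult: "\<iota> (a * b) = \<iota> a * \<iota> b"
    and \<iota>_1: "\<iota> 1 = 1"
begin

lemma \<iota>_0: "\<iota> 0 = 0"
  using \<iota>_add[of 0 0] by simp

lemma ext_superset:
  "finite A \<Longrightarrow> Poly_Mapping.keys p \<subseteq> A \<Longrightarrow> ext \<iota> f p = (\<Sum>w\<in>A. \<iota> (Poly_Mapping.lookup p w) * f w)"
  unfolding ext_def by (rule sum.mono_neutral_left) (auto simp: in_keys_iff \<iota>_0)

lemma ext_add: "ext \<iota> f (p + q) = ext \<iota> f p + ext \<iota> f q"
proof -
  let ?A = "Poly_Mapping.keys p \<union> Poly_Mapping.keys q"
  have "ext \<iota> f (p + q) = (\<Sum>w\<in>?A. \<iota> (Poly_Mapping.lookup (p + q) w) * f w)"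
    by (rule ext_superset) (auto simp: Poly_Mapping.keys_add)
  also have "\<dots> = (\<Sum>w\<in>?A. \<iota> (Poly_Mapping.lookup p w) * f w) + (\<Sum>w\<in>?A. \<iota> (Poly_Mapping.lookup q w) * f w)"
    by (simp add: lookup_add \<iota>_add distrib_right sum.distrib)
  also have "\<dots> = ext \<iota> f p + ext \<iota> f q"
    using ext_superset[of ?A p f] ext_superset[of ?A q f] by simp
  finally show ?thesis .
qed

lemma ext_0: "ext \<iota> f 0 = 0"
  by (simp add: ext_def)

lemma ext_uminus: "ext \<iota> f (- p) = - ext \<iota> f p"
  using ext_add[of f p "- p"] by (simp add: ext_0 add_eq_0_iff)

lemma ext_diff: "ext \<iota> f (p - q) = ext \<iota> f p - ext \<iota> f q"
  using ext_add[of f p "- q"] by (simp add: ext_uminus)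

lemma ext_sum: "ext \<iota> f (sum g A) = (\<Sum>i\<in>A. ext \<iota> f (g i))"
  by (induction A rule: infinite_finite_induct) (simp_all add: ext_0 ext_add)

lemma ext_single: "ext \<iota> f (Poly_Mapping.single w c) = \<iota> c * f w"
  by (cases "c = 0") (simp_all add: ext_def \<iota>_0)

lemma ext_mult:
  fixes p q :: "'w::monoid_add \<Rightarrow>\<^sub>0 'a"
  shows "ext \<iota> f (p * q) = (\<Sum>u\<in>Poly_Mapping.keys p. \<Sum>v\<in>Poly_Mapping.keys q.
    \<iota> (Poly_Mapping.lookup p u) * \<iota> (Poly_Mapping.lookup q v) * f (u + v))"
proof -
  have "p * q = (\<Sum>u\<in>Poly_Mapping.keys p. Poly_Mapping.single u (Poly_Mapping.lookup p u)) *
    (\<Sum>v\<in>Poly_Mapping.keys q. Poly_Mapping.single v (Poly_Mapping.lookup q v))"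
    using poly_mapping_sum_single[of p] poly_mapping_sum_single[of q] by simp
  then show ?thesis
    by (simp add: sum_product mult_single ext_sum ext_single \<iota>_mult)
qed

text \<open>The multiplicativity of symbols rests on this: on words they come from a monoid
  homomorphism.\<close>

lemma ext_hom_mult:
  fixes p q :: "'w::monoid_add \<Rightarrow>\<^sub>0 'a"
  assumes "\<And>u v. f (u + v) = f u * f v"
  shows "ext \<iota> f (p * q) = ext \<iota> f p * ext \<iota> f q"
  unfolding ext_mult assms unfolding ext_def by (simp add: sum_product mult_ac)

end

interpretation id_hom: scalar_hom "\<lambda>x. x"
  by standard simp_all

section \<open>Functionals on words under the shuffle product\<close>

text \<open>A type of its own, so that the ring multiplication can be the shuffle product.\<close>

typedef ('x, 'a) wfun = "UNIV :: ('x list \<Rightarrow> 'a) set"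
  morphisms ap Wfun ..

setup_lifting type_definition_wfun

text \<open>Unfolded, the value at a word is the sum, over all ways of splitting it into two
  complementary subwords, of \<open>f\<close> on one times \<open>g\<close> on the other. The
  product is dual to the coproduct that makes every letter primitive, and the recursion says that
  removing the first letter is a derivation.\<close>

fun shuf :: "('x list \<Rightarrow> 'a::comm_ring_1) \<Rightarrow> ('x list \<Rightarrow> 'a) \<Rightarrow> 'x list \<Rightarrow> 'a" where
  "shuf f g [] = f [] * g []"
| "shuf f g (x # w) = shuf (\<lambda>v. f (x # v)) g w + shuf f (\<lambda>v. g (x # v)) w"

lemma shuf_add_left: "shuf (\<lambda>v. f v + f' v) g w = shuf f g w + shuf f' g w"
  by (induction w arbitrary: f f' g) (simp_all add: distrib_right)

lemma shuf_comm: "shuf f g w = shuf g f w"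
  by (induction w arbitrary: f g) (simp_all add: mult.commute add.commute)

lemma shuf_add_right: "shuf f (\<lambda>v. g v + g' v) w = shuf f g w + shuf f g' w"
  using shuf_add_left[of g g' f w] by (simp add: shuf_comm)

lemma shuf_assoc: "shuf (shuf f g) h w = shuf f (shuf g h) w"
  by (induction w arbitrary: f g h) (simp_all add: mult.assoc shuf_add_left shuf_add_right add.assoc)

lemma shuf_zero_left: "shuf (\<lambda>v. 0) g w = 0"
  by (induction w arbitrary: g) simp_all

lemma shuf_scale: "shuf (\<lambda>w. if w = [] then c else 0) g w = c * g w"
  by (induction w arbitrary: g) (simp_all add: shuf_zero_left)

instantiation wfun :: (type, comm_ring_1) comm_ring_1
begin

lift_definition zero_wfun :: "('a, 'b) wfun" is "\<lambda>w. 0" .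
lift_definition one_wfun :: "('a, 'b) wfun" is "\<lambda>w. if w = [] then 1 else 0" .
lift_definition plus_wfun :: "('a, 'b) wfun \<Rightarrow> ('a, 'b) wfun \<Rightarrow> ('a, 'b) wfun" is "\<lambda>f g w. f w + g w" .
lift_definition minus_wfun :: "('a, 'b) wfun \<Rightarrow> ('a, 'b) wfun \<Rightarrow> ('a, 'b) wfun" is "\<lambda>f g w. f w - g w" .
lift_definition uminus_wfun :: "('a, 'b) wfun \<Rightarrow> ('a, 'b) wfun" is "\<lambda>f w. - f w" .
lift_definition times_wfun :: "('a, 'b) wfun \<Rightarrow> ('a, 'b) wfun \<Rightarrow> ('a, 'b) wfun" is shuf .

instance
proof
  fix a b c :: "('a, 'b) wfun"
  show "a + b + c = a + (b + c)" by transfer (simp add: add.assoc)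
  show "a + b = b + a" by transfer (simp add: add.commute)
  show "0 + a = a" by transfer simp
  show "- a + a = 0" by transfer simp
  show "a - b = a + - b" by transfer simp
  show "a * b * c = a * (b * c)" by transfer (simp add: fun_eq_iff shuf_assoc)
  show "a * b = b * a" by transfer (simp add: fun_eq_iff shuf_comm)
  show "1 * a = a" by transfer (simp add: fun_eq_iff shuf_scale)
  show "(a + b) * c = a * c + b * c" by transfer (simp add: fun_eq_iff shuf_add_left)
  show "(0 :: ('a, 'b) wfun) \<noteq> 1" by transfer (auto simp: fun_eq_iff)
qed

end

section \<open>Removal of letters as derivations, and the order of vanishing\<close>

lift_definition wcst :: "'a::comm_ring_1 \<Rightarrow> ('x, 'a) wfun" is "\<lambda>c w. if w = [] then c else 0" .
lift_definition ldiff :: "'x \<Rightarrow> ('x, 'a::comm_ring_1) wfun \<Rightarrow> ('x, 'a) wfun" is "\<lambda>x f w. f (x # w)" .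
lift_definition rdiff :: "'x \<Rightarrow> ('x, 'a::comm_ring_1) wfun \<Rightarrow> ('x, 'a) wfun" is "\<lambda>x f w. f (w @ [x])" .

lemma wfun_eqI: "(\<And>w. ap f w = ap g w) \<Longrightarrow> f = g"
  by transfer (simp add: fun_eq_iff)

lemma ap_0 [simp]: "ap 0 w = 0"
  by transfer simp

lemma ap_1: "ap 1 w = (if w = [] then 1 else 0)"
  by transfer simp

lemma ap_add [simp]: "ap (f + g) w = ap f w + ap g w"
  by transfer simp

lemma ap_diff [simp]: "ap (f - g) w = ap f w - ap g w"
  by transfer simp

lemma ap_sum: "ap (sum f A) w = (\<Sum>i\<in>A. ap (f i) w)"
  by (induction A rule: infinite_finite_induct) simp_all

lemma ap_wcst: "ap (wcst c) w = (if w = [] then c else 0)"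
  by transfer simp

lemma ap_wcst_mult [simp]: "ap (wcst c * f) w = c * ap f w"
  by transfer (simp add: shuf_scale)

lemma ap_mult_Nil [simp]: "ap (f * g) [] = ap f [] * ap g []"
  by transfer simp

lemma ap_mult_Cons: "ap (f * g) (x # w) = ap (ldiff x f * g) w + ap (f * ldiff x g) w"
  by transfer simp

lemma ap_ldiff [simp]: "ap (ldiff x f) w = ap f (x # w)"
  by transfer simp

lemma ap_rdiff [simp]: "ap (rdiff x f) w = ap f (w @ [x])"
  by transfer simp

lemma ap_of_nat: "ap (of_nat n) w = (if w = [] then of_nat n else 0)"
  by (induction n) (simp_all add: ap_1)

lemma of_nat_eq_wcst: "of_nat n = wcst (of_nat n)"
  by (rule wfun_eqI) (simp add: ap_of_nat ap_wcst)

lemma wcst_add: "wcst (a + b) = wcst a + wcst b"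
  by (rule wfun_eqI) (simp add: ap_wcst)

lemma wcst_mult: "wcst (a * b) = wcst a * wcst b"
  by (rule wfun_eqI) (simp add: ap_wcst)

lemma wcst_1: "wcst 1 = 1"
  by (rule wfun_eqI) (simp add: ap_wcst ap_1)

lemma wcst_0: "wcst 0 = 0"
  by (rule wfun_eqI) (simp add: ap_wcst)

lemma wcst_power: "wcst (a ^ n) = wcst a ^ n"
  by (induction n) (simp_all add: wcst_1 wcst_mult)

lemma ldiff_mult: "ldiff x (f * g) = ldiff x f * g + f * ldiff x g"
  by (rule wfun_eqI) (simp add: ap_mult_Cons)

lemma ldiff_add: "ldiff x (f + g) = ldiff x f + ldiff x g"
  by (rule wfun_eqI) simp

lemma rdiff_add: "rdiff x (f + g) = rdiff x f + rdiff x g"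
  by (rule wfun_eqI) simp

lemma ldiff_rdiff: "ldiff x (rdiff y f) = rdiff y (ldiff x f)"
  by (rule wfun_eqI) simp

text \<open>The recursion of \<open>shuf\<close> singles out the first letter, yet the last letter
  behaves in the same way; the induction works because \<open>ldiff\<close> and \<open>rdiff\<close>
  commute.\<close>

lemma rdiff_mult: "rdiff x (f * g) = rdiff x f * g + f * rdiff x g"
proof (rule wfun_eqI)
  fix w
  show "ap (rdiff x (f * g)) w = ap (rdiff x f * g + f * rdiff x g) w"
  proof (induction w arbitrary: f g)
    case Nil
    show ?case by (simp add: ap_mult_Cons)
  next
    case (Cons y w)
    show ?case
      using Cons[of "ldiff y f" g] Cons[of f "ldiff y g"]
      by (simp add: ap_mult_Cons ldiff_rdiff)
  qed
qed

text \<open>The transpose of the commutator with \<open>x\<close>, as \<open>pair_adiff\<close>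
  shows. Centrality of an element thereby becomes the vanishing of its pairings with
  \<open>adiff x f\<close>.\<close>

definition adiff :: "'x \<Rightarrow> ('x, 'a::comm_ring_1) wfun \<Rightarrow> ('x, 'a) wfun" where
  "adiff x f = ldiff x f - rdiff x f"

lemma adiff_mult: "adiff x (f * g) = adiff x f * g + f * adiff x g"
  by (simp add: adiff_def ldiff_mult rdiff_mult algebra_simps)

lemma adiff_add: "adiff x (f + g) = adiff x f + adiff x g"
  by (simp add: adiff_def ldiff_add rdiff_add)

lemma adiff_1: "adiff x 1 = 0"
  by (rule wfun_eqI) (simp add: adiff_def ap_1)

lemma ap_adiff: "ap (adiff x f) w = ap f (x # w) - ap f (w @ [x])"
  by (simp add: adiff_def)

lemma adiff_power: "adiff x (f ^ Suc n) = of_nat (Suc n) * f ^ n * adiff x f"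
proof (induction n)
  case 0
  show ?case by simp
next
  case (Suc n)
  have "adiff x (f ^ Suc (Suc n)) = adiff x f * f ^ Suc n + f * adiff x (f ^ Suc n)"
    by (metis adiff_mult power_Suc)
  also have "\<dots> = of_nat (Suc (Suc n)) * f ^ Suc n * adiff x f"
    unfolding Suc by (simp add: algebra_simps)
  finally show ?case .
qed

text \<open>A functional of order at least \<open>d + 1\<close> kills everything of word length at
  most \<open>d\<close>, so top-degree symbols can be computed modulo higher order.\<close>

definition ord_ge :: "nat \<Rightarrow> ('x, 'a::comm_ring_1) wfun \<Rightarrow> bool" where
  "ord_ge k f \<longleftrightarrow> (\<forall>w. length w < k \<longrightarrow> ap f w = 0)"

lemma ord_ge_0 [simp]: "ord_ge 0 f"
  by (simp add: ord_ge_def)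

lemma ord_ge_zero [simp]: "ord_ge k 0"
  by (simp add: ord_ge_def)

lemma ord_ge_add: "ord_ge k f \<Longrightarrow> ord_ge k g \<Longrightarrow> ord_ge k (f + g)"
  by (simp add: ord_ge_def)

lemma ord_ge_sum: "(\<And>i. i \<in> A \<Longrightarrow> ord_ge k (f i)) \<Longrightarrow> ord_ge k (sum f A)"
  by (induction A rule: infinite_finite_induct) (simp_all add: ord_ge_add)

lemma ord_ge_wcst: "ord_ge k f \<Longrightarrow> ord_ge k (wcst c * f)"
  by (simp add: ord_ge_def)

lemma ord_ge_ldiff: "ord_ge k f \<Longrightarrow> ord_ge (k - 1) (ldiff x f)"
  by (auto simp: ord_ge_def)

text \<open>Removing a letter lowers the order of one of the two factors by at most one, and it
  shortens the word by one as well.\<close>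

lemma ord_ge_mult: "ord_ge j f \<Longrightarrow> ord_ge k g \<Longrightarrow> ord_ge (j + k) (f * g)"
proof -
  have "ord_ge j f \<Longrightarrow> ord_ge k g \<Longrightarrow> length w < j + k \<Longrightarrow> ap (f * g) w = 0" for w
  proof (induction w arbitrary: f g j k)
    case Nil
    then show ?case by (cases j) (auto simp: ord_ge_def)
  next
    case (Cons x w)
    have "ap (ldiff x f * g) w = 0"
      using Cons.prems by (intro Cons.IH[of "j - 1" _ k] ord_ge_ldiff) auto
    moreover have "ap (f * ldiff x g) w = 0"
      using Cons.prems by (intro Cons.IH[of j _ "k - 1"] ord_ge_ldiff) auto
    ultimately show ?case by (simp add: ap_mult_Cons)
  qed
  then show "ord_ge j f \<Longrightarrow> ord_ge k g \<Longrightarrow> ord_ge (j + k) (f * g)"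
    by (simp add: ord_ge_def[of "j + k"])
qed

lemma ord_ge_power: "ord_ge j f \<Longrightarrow> ord_ge (n * j) (f ^ n)"
  by (induction n) (auto intro: ord_ge_mult)

lemma ord_ge_prod_list: "(\<And>f. f \<in> set fs \<Longrightarrow> ord_ge 1 f) \<Longrightarrow> ord_ge (length fs) (prod_list fs)"
proof (induction fs)
  case (Cons f fs)
  then show ?case using ord_ge_mult[of 1 f "length fs" "prod_list fs"] by simp
qed simp

section \<open>Pairing functionals with elements of the free algebra\<close>

definition pair :: "('x, 'a::comm_ring_1) wfun \<Rightarrow> ('x list \<Rightarrow>\<^sub>0 'a) \<Rightarrow> 'a" where
  "pair f = ext (\<lambda>c. c) (ap f)"

lemmas pair_diff_right = id_hom.ext_diff[where f = "ap f" for f, folded pair_def]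
  and pair_sum_right = id_hom.ext_sum[where f = "ap f" for f, folded pair_def]
  and pair_single = id_hom.ext_single[where f = "ap f" for f, folded pair_def]
  and pair_0_right = id_hom.ext_0[where f = "ap f" for f, folded pair_def]

lemma pair_add: "pair (f + g) p = pair f p + pair g p"
  by (simp add: pair_def ext_def distrib_left sum.distrib)

lemma pair_diff: "pair (f - g) p = pair f p - pair g p"
  by (simp add: pair_def ext_def right_diff_distrib sum_subtractf)

lemma pair_zero: "pair 0 p = 0"
  by (simp add: pair_def ext_def)

lemma pair_sum: "pair (sum f A) p = (\<Sum>i\<in>A. pair (f i) p)"
  by (induction A rule: infinite_finite_induct) (simp_all add: pair_zero pair_add)

lemma pair_wcst: "pair (wcst c * f) p = c * pair f p"
  unfolding pair_def ext_def ap_wcst_mult sum_distrib_left by (simp add: mult_ac)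

lemma pair_of_nat: "pair (of_nat n * f) p = of_nat n * pair f p"
  unfolding of_nat_eq_wcst by (rule pair_wcst)

lemma pair_ldiff: "pair (ldiff x f) p = pair f (fa_gen x * p)"
  unfolding pair_def id_hom.ext_mult fa_gen_def by (simp add: plus_list_def ext_def)

lemma pair_rdiff: "pair (rdiff x f) p = pair f (p * fa_gen x)"
  unfolding pair_def id_hom.ext_mult fa_gen_def by (simp add: plus_list_def ext_def)

lemma pair_adiff: "pair (adiff x f) p = pair f (fa_gen x * p - p * fa_gen x)"
  by (simp add: adiff_def pair_diff pair_ldiff pair_rdiff pair_diff_right)

lemma pair_ord_ge: "ord_ge (Suc d) f \<Longrightarrow> len_le d p \<Longrightarrow> pair f p = 0"
  unfolding pair_def ext_def ord_ge_def len_le_def by (intro sum.neutral) auto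

text \<open>The relations are demanded between arbitrary words \<open>u\<close> and
  \<open>v\<close>, because the ideal is two-sided; such an \<open>f\<close> descends to a
  functional on the enveloping algebra. The letters of \<open>u\<close> and \<open>v\<close> are
  unrestricted, which makes the condition stable under \<open>ldiff\<close> by any letter.\<close>

definition good :: "nat \<Rightarrow> 'a::comm_ring_1 mat set \<Rightarrow> ('a mat, 'a) wfun \<Rightarrow> bool" where
  "good N L f \<longleftrightarrow> (\<forall>u v x y c. x \<in> L \<and> y \<in> L \<longrightarrow>
      ap f (u @ madd x y # v) = ap f (u @ x # v) + ap f (u @ y # v) \<and>
      ap f (u @ msmult c x # v) = c * ap f (u @ x # v) \<and>
      ap f (u @ x # y # v) - ap f (u @ y # x # v) = ap f (u @ mbracket N x y # v))"

lemma goodD: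
  assumes "good N L f" "x \<in> L" "y \<in> L"
  shows "ap f (u @ madd x y # v) = ap f (u @ x # v) + ap f (u @ y # v)"
    "ap f (u @ msmult c x # v) = c * ap f (u @ x # v)"
    "ap f (u @ x # y # v) - ap f (u @ y # x # v) = ap f (u @ mbracket N x y # v)"
  using assms unfolding good_def by blast+

lemma goodI:
  assumes "\<And>u v x y. x \<in> L \<Longrightarrow> y \<in> L \<Longrightarrow> ap f (u @ madd x y # v) = ap f (u @ x # v) + ap f (u @ y # v)"
    "\<And>u v x c. x \<in> L \<Longrightarrow> ap f (u @ msmult c x # v) = c * ap f (u @ x # v)"
    "\<And>u v x y. x \<in> L \<Longrightarrow> y \<in> L \<Longrightarrow>
      ap f (u @ x # y # v) - ap f (u @ y # x # v) = ap f (u @ mbracket N x y # v)"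
  shows "good N L f"
  using assms unfolding good_def by blast

lemma good_ldiff:
  assumes "good N L f"
  shows "good N L (ldiff z f)"
  by (rule goodI; insert goodD[OF assms, where u = "z # u" for u], simp)

lemma good_add:
  assumes "good N L f" "good N L g"
  shows "good N L (f + g)"
proof (rule goodI)
  fix u v x y c
  assume xy: "x \<in> L"
  show "ap (f + g) (u @ msmult c x # v) = c * ap (f + g) (u @ x # v)"
    by (simp add: goodD(2)[OF assms(1) xy xy] goodD(2)[OF assms(2) xy xy] distrib_left)
  assume y: "y \<in> L"
  show "ap (f + g) (u @ madd x y # v) = ap (f + g) (u @ x # v) + ap (f + g) (u @ y # v)"
    by (simp add: goodD(1)[OF assms(1) xy y] goodD(1)[OF assms(2) xy y])
  show "ap (f + g) (u @ x # y # v) - ap (f + g) (u @ y # x # v) = ap (f + g) (u @ mbracket N x y # v)"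
    by (simp flip: goodD(3)[OF assms(1) xy y] goodD(3)[OF assms(2) xy y])
qed

lemma good_1: "good N L 1"
  by (rule goodI) (simp_all add: ap_1)

lemma good_ldiff_rels:
  assumes "good N L f" "x \<in> L" "y \<in> L"
  shows "ldiff (madd x y) f = ldiff x f + ldiff y f"
    and "ldiff (msmult c x) f = wcst c * ldiff x f"
    and "ldiff y (ldiff x f) - ldiff x (ldiff y f) = ldiff (mbracket N x y) f"
  using goodD[OF assms, of "[]"] by (auto intro!: wfun_eqI)

text \<open>The elements of \<open>L\<close> are primitive, so the coproduct descends to the
  enveloping algebra. Concretely, for a bracket at the front of the word the mixed terms
  \<open>ldiff x f * ldiff y g\<close> and \<open>ldiff y f * ldiff x g\<close> occur in both orders
  and cancel, and what remains is the derivation rule for the bracket.\<close>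

lemma good_mult:
  assumes "good N L f" "good N L g"
  shows "good N L (f * g)"
proof -
  have "ap (f * g) (u @ madd x y # v) = ap (f * g) (u @ x # v) + ap (f * g) (u @ y # v) \<and>
      ap (f * g) (u @ msmult c x # v) = c * ap (f * g) (u @ x # v) \<and>
      ap (f * g) (u @ x # y # v) - ap (f * g) (u @ y # x # v) = ap (f * g) (u @ mbracket N x y # v)"
    if "x \<in> L" "y \<in> L" for u v x y c
    using assms
  proof (induction u arbitrary: f g)
    case Nil
    note rf = good_ldiff_rels[OF Nil(1) that] and rg = good_ldiff_rels[OF Nil(2) that]
    have "ap (f * g) (x # y # v) - ap (f * g) (y # x # v) =
      ap ((ldiff y (ldiff x f) - ldiff x (ldiff y f)) * g +
        f * (ldiff y (ldiff x g) - ldiff x (ldiff y g))) v"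
      by (simp add: ap_mult_Cons algebra_simps)
    also have "\<dots> = ap (f * g) (mbracket N x y # v)"
      unfolding rf rg by (simp add: ap_mult_Cons)
    finally have "ap (f * g) (x # y # v) - ap (f * g) (y # x # v) = ap (f * g) (mbracket N x y # v)" .
    moreover have "ap (f * g) (msmult c x # v) = c * ap (f * g) (x # v)"
    proof -
      have "ap (f * g) (msmult c x # v) = ap (wcst c * (ldiff x f * g) + wcst c * (f * ldiff x g)) v"
        by (simp only: ap_mult_Cons rf rg ap_add mult_ac)
      then show ?thesis by (simp add: ap_mult_Cons distrib_left)
    qed
    moreover have "ap (f * g) (madd x y # v) = ap (f * g) (x # v) + ap (f * g) (y # v)"
      by (simp add: ap_mult_Cons rf rg algebra_simps)
    ultimately show ?case by simp
  next
    case (Cons z u)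
    show ?case
      using Cons.IH[OF good_ldiff[OF Cons.prems(1)] Cons.prems(2)]
        Cons.IH[OF Cons.prems(1) good_ldiff[OF Cons.prems(2)]]
      by (simp add: ap_mult_Cons algebra_simps)
  qed
  then show ?thesis unfolding good_def by blast
qed

lemma good_power: "good N L f \<Longrightarrow> good N L (f ^ n)"
  by (induction n) (simp_all add: good_1 good_mult)

lemma good_prod_list: "(\<And>f. f \<in> set fs \<Longrightarrow> good N L f) \<Longrightarrow> good N L (prod_list fs)"
  by (induction fs) (simp_all add: good_1 good_mult)

text \<open>The vanishing is quantified over all surrounding words so that the words of
  \<open>a\<close> and \<open>b\<close> can be absorbed into them.\<close>

lemma ext_zero_mono:
  fixes f :: "'x list \<Rightarrow> 'a::comm_ring_1"
  assumes "\<And>u v. ext (\<lambda>c. c) (\<lambda>w. f (u @ w @ v)) p = 0"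
  shows "ext (\<lambda>c. c) (\<lambda>w. f (u @ w @ v)) (a * (p * b)) = 0"
proof -
  have "ext (\<lambda>c. c) (\<lambda>w. f (u @ w @ v)) (a * (p * b)) =
    ext (\<lambda>c. c) (\<lambda>x. ext (\<lambda>c. c) (\<lambda>z. ext (\<lambda>c. c) (\<lambda>w. f ((u @ x) @ w @ (z @ v))) p) b) a"
  proof -
    have *: "ext (\<lambda>c. c) h (q * r) = ext (\<lambda>c. c) (\<lambda>x. ext (\<lambda>c. c) (\<lambda>y. h (x @ y)) r) q"
      for h :: "'x list \<Rightarrow> 'a" and q r
      unfolding id_hom.ext_mult unfolding ext_def by (simp add: plus_list_def sum_distrib_left mult_ac)
    have sw: "ext (\<lambda>c. c) (\<lambda>x. ext (\<lambda>c. c) (\<lambda>y. h x y) r) q = ext (\<lambda>c. c) (\<lambda>y. ext (\<lambda>c. c) (\<lambda>x. h x y) q) r"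
      for h :: "'x list \<Rightarrow> 'x list \<Rightarrow> 'a" and q r
      unfolding ext_def sum_distrib_left by (subst sum.swap) (simp add: mult_ac)
    show ?thesis unfolding * by (subst sw) simp
  qed
  then show ?thesis unfolding assms by (simp add: ext_def)
qed

lemma good_ext_ideal:
  assumes "good N L f" "p \<in> uea_ideal N L"
  shows "ext (\<lambda>c. c) (\<lambda>w. ap f (u @ w @ v)) p = 0"
  using assms(2) unfolding uea_ideal_def
proof (induction arbitrary: u v rule: fa_ideal.induct)
  case (base r)
  then show ?case
    using assms(1) unfolding uea_rels_def good_def
    by (auto simp: id_hom.ext_diff fa_gen_def id_hom.ext_single fa_mult_eq_times fa_scal_times_single
        mult_single plus_list_def)
next
  case zero
  show ?case by (rule id_hom.ext_0)
next
  case (add p q)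
  then show ?case by (simp add: id_hom.ext_add)
next
  case (mult p a b)
  then show ?case unfolding fa_mult_eq_times by (intro ext_zero_mono) auto
qed

lemma good_ideal: "good N L f \<Longrightarrow> p \<in> uea_ideal N L \<Longrightarrow> pair f p = 0"
  using good_ext_ideal[of N L f p "[]" "[]"] by (simp add: pair_def)

section \<open>Congruence modulo the defining ideal\<close>

lemma uea_ideal_0: "0 \<in> uea_ideal N L"
  unfolding uea_ideal_def by (rule fa_ideal.zero)

lemma uea_ideal_add: "p \<in> uea_ideal N L \<Longrightarrow> q \<in> uea_ideal N L \<Longrightarrow> p + q \<in> uea_ideal N L"
  unfolding uea_ideal_def by (rule fa_ideal.add)

lemma uea_ideal_mult:
  "p \<in> uea_ideal N L \<Longrightarrow> a \<in> FA L \<Longrightarrow> b \<in> FA L \<Longrightarrow> a * p * b \<in> uea_ideal N L"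
  using fa_ideal.mult[of p L "uea_rels N L" a b]
  by (simp add: uea_ideal_def fa_mult_eq_times mult.assoc)

lemma uea_ideal_mult_left: "p \<in> uea_ideal N L \<Longrightarrow> a \<in> FA L \<Longrightarrow> a * p \<in> uea_ideal N L"
  using uea_ideal_mult[of p N L a 1] by (simp add: one_in_FA)

lemma uea_ideal_mult_right: "p \<in> uea_ideal N L \<Longrightarrow> b \<in> FA L \<Longrightarrow> p * b \<in> uea_ideal N L"
  using uea_ideal_mult[of p N L 1 b] by (simp add: one_in_FA)

lemma uea_ideal_uminus: "p \<in> uea_ideal N L \<Longrightarrow> - p \<in> uea_ideal N L"
  using uea_ideal_mult_left[of p N L "- 1"] by (simp add: one_in_FA uminus_in_FA)

lemma uea_ideal_diff: "p \<in> uea_ideal N L \<Longrightarrow> q \<in> uea_ideal N L \<Longrightarrow> p - q \<in> uea_ideal N L"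
  using uea_ideal_add[of p N L "- q"] uea_ideal_uminus[of q] by simp

lemma uea_ideal_sum: "(\<And>i. i \<in> A \<Longrightarrow> f i \<in> uea_ideal N L) \<Longrightarrow> sum f A \<in> uea_ideal N L"
  by (induction A rule: infinite_finite_induct) (simp_all add: uea_ideal_0 uea_ideal_add)

definition ucong :: "nat \<Rightarrow> 'a::comm_ring_1 mat set \<Rightarrow> ('a mat list \<Rightarrow>\<^sub>0 'a) \<Rightarrow> ('a mat list \<Rightarrow>\<^sub>0 'a) \<Rightarrow> bool" where
  "ucong N L p q \<longleftrightarrow> p - q \<in> uea_ideal N L"

lemma ucong_refl [simp]: "ucong N L p p"
  by (simp add: ucong_def uea_ideal_0)

lemma ucong_sym: "ucong N L p q \<Longrightarrow> ucong N L q p"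
  using uea_ideal_uminus[of "p - q"] by (simp add: ucong_def)

lemma ucong_trans [trans]: "ucong N L p q \<Longrightarrow> ucong N L q r \<Longrightarrow> ucong N L p r"
  using uea_ideal_add[of "p - q" N L "q - r"] by (simp add: ucong_def)

lemma ucong_add: "ucong N L p q \<Longrightarrow> ucong N L p' q' \<Longrightarrow> ucong N L (p + p') (q + q')"
  using uea_ideal_add[of "p - q" N L "p' - q'"] by (simp add: ucong_def algebra_simps)

lemma ucong_diff: "ucong N L p q \<Longrightarrow> ucong N L p' q' \<Longrightarrow> ucong N L (p - p') (q - q')"
  using uea_ideal_diff[of "p - q" N L "p' - q'"] by (simp add: ucong_def algebra_simps)

lemma ucong_sum: "(\<And>i. i \<in> A \<Longrightarrow> ucong N L (f i) (g i)) \<Longrightarrow> ucong N L (sum f A) (sum g A)"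
  using uea_ideal_sum[of A "\<lambda>i. f i - g i" N L] by (simp add: ucong_def sum_subtractf)

lemma ucong_mult_left: "ucong N L p q \<Longrightarrow> a \<in> FA L \<Longrightarrow> ucong N L (a * p) (a * q)"
  using uea_ideal_mult_left[of "p - q" N L a] by (simp add: ucong_def right_diff_distrib)

lemma ucong_mult_right: "ucong N L p q \<Longrightarrow> b \<in> FA L \<Longrightarrow> ucong N L (p * b) (q * b)"
  using uea_ideal_mult_right[of "p - q" N L b] by (simp add: ucong_def left_diff_distrib)

lemma ucong_mult:
  "ucong N L p q \<Longrightarrow> ucong N L p' q' \<Longrightarrow> p' \<in> FA L \<Longrightarrow> q \<in> FA L \<Longrightarrow> ucong N L (p * p') (q * q')"
  by (rule ucong_trans[OF ucong_mult_right ucong_mult_left])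

lemma uea_ideal_rel: "p \<in> uea_rels N L \<Longrightarrow> p \<in> uea_ideal N L"
  unfolding uea_ideal_def by (rule fa_ideal.base)

lemma ucong_madd:
  assumes "x \<in> L" "y \<in> L"
  shows "ucong N L (fa_gen (madd x y)) (fa_gen x + fa_gen y)"
proof -
  have "fa_gen (madd x y) - fa_gen x - fa_gen y \<in> uea_ideal N L"
    by (rule uea_ideal_rel) (use assms in \<open>unfold uea_rels_def, blast\<close>)
  then show ?thesis by (simp only: ucong_def diff_diff_eq)
qed

lemma ucong_msmult:
  assumes "x \<in> L"
  shows "ucong N L (fa_gen (msmult c x)) (fa_scal c * fa_gen x)"
proof -
  have "fa_gen (msmult c x) - fa_mult (fa_scal c) (fa_gen x) \<in> uea_ideal N L"
    by (rule uea_ideal_rel) (use assms in \<open>unfold uea_rels_def, blast\<close>)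
  then show ?thesis by (simp only: ucong_def fa_mult_eq_times)
qed

lemma ucong_bracket:
  assumes "x \<in> L" "y \<in> L"
  shows "ucong N L (fa_gen x * fa_gen y - fa_gen y * fa_gen x) (fa_gen (mbracket N x y))"
proof -
  have "fa_mult (fa_gen x) (fa_gen y) - fa_mult (fa_gen y) (fa_gen x) - fa_gen (mbracket N x y) \<in> uea_ideal N L"
    by (rule uea_ideal_rel) (use assms in \<open>unfold uea_rels_def, blast\<close>)
  then show ?thesis by (simp only: ucong_def fa_mult_eq_times)
qed

lemma ucong_gen_zero:
  assumes "(\<lambda>h k. 0) \<in> L"
  shows "ucong N L (fa_gen (\<lambda>h k. 0)) 0"
proof -
  have "msmult 0 (\<lambda>h k. 0) = (\<lambda>h k. 0 :: 'a::comm_ring_1)"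
    by (simp add: msmult_def)
  then show ?thesis
    using ucong_msmult[OF assms, of N 0] by (simp add: fa_scal_0)
qed

lemma ucong_scal_cancel:
  fixes p :: "'a::field mat list \<Rightarrow>\<^sub>0 'a"
  assumes "ucong N L (fa_scal c * p) (fa_scal c * q)" "c \<noteq> 0"
  shows "ucong N L p q"
  using ucong_mult_left[OF assms(1), of "fa_scal (inverse c)"] assms(2)
  by (simp add: fa_scal_in_FA fa_scal_1 flip: mult.assoc fa_scal_mult)

section \<open>The diagram and the basis of the centralizer\<close>

locale diagram =
  fixes lam :: "nat list"
  assumes parts_pos: "\<forall>x \<in> set lam. 0 < x"
begin

abbreviation n :: nat where "n \<equiv> length lam"
abbreviation N :: nat where "N \<equiv> Nsz lam"
abbreviation part :: "nat \<Rightarrow> nat" where "part \<equiv> lam_at lam"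
abbreviation L :: "'a::comm_ring_1 mat set" where "L \<equiv> centralizer lam"
abbreviation box :: "nat \<Rightarrow> nat \<Rightarrow> nat" where "box i c \<equiv> pre lam i + c"

definition idx :: "(nat \<times> nat \<times> nat) set" where
  "idx = {(i, j, r). i \<in> {1..n} \<and> j \<in> {1..n} \<and> part j - min (part i) (part j) \<le> r \<and> r < part j}"

lemma part_pos: "i \<in> {1..n} \<Longrightarrow> 0 < part i"
  using parts_pos by (auto simp: lam_at_def)

lemma pre_1: "pre lam (Suc 0) = 0"
  by (simp add: pre_def)

lemma pre_Suc: "i \<in> {1..n} \<Longrightarrow> pre lam (Suc i) = pre lam i + part i"
  by (cases i) (auto simp: pre_def lam_at_def take_Suc_conv_app_nth)

lemma pre_last: "pre lam (Suc n) = N"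
  by (simp add: pre_def Nsz_def)

lemma pre_mono: "1 \<le> i \<Longrightarrow> i \<le> j \<Longrightarrow> j \<le> Suc n \<Longrightarrow> pre lam i \<le> pre lam j"
proof (induction "j - i" arbitrary: j)
  case (Suc d)
  then obtain k where "j = Suc k" by (cases j) auto
  with Suc.hyps(2) Suc.prems have "pre lam i \<le> pre lam k" "k \<in> {1..n}"
    by (auto intro!: Suc.hyps(1))
  with pre_Suc[of k] \<open>j = Suc k\<close> show ?case by simp
qed simp

lemma pre_step: "i \<in> {1..n} \<Longrightarrow> i < j \<Longrightarrow> j \<le> Suc n \<Longrightarrow> pre lam i + part i \<le> pre lam j"
  using pre_mono[of "Suc i" j] pre_Suc[of i] by auto

lemma box_ex:
  assumes "h \<in> {1..N}"
  obtains i c where "i \<in> {1..n}" "c \<in> {1..part i}" "h = box i c"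
proof -
  have "\<exists>i c. i \<in> {1..n} \<and> c \<in> {1..part i} \<and> h = box i c" if "1 \<le> h" "h \<le> pre lam (Suc m)" "m \<le> n" for m
    using that
  proof (induction m)
    case 0
    then show ?case by (simp add: pre_1)
  next
    case (Suc m)
    show ?case
    proof (cases "h \<le> pre lam (Suc m)")
      case False
      with Suc show ?thesis
        by (intro exI[of _ "Suc m"] exI[of _ "h - pre lam (Suc m)"]) (auto simp: pre_Suc)
    qed (use Suc in auto)
  qed
  from this[of n] assms that show thesis by (auto simp: pre_last)
qed

context
  fixes i c assumes ic: "i \<in> {1..n}" "c \<in> {1..part i}"
begin

lemma row_box: "row lam (box i c) = i"
  unfolding row_def
proof (rule the_equality)
  fix j assume j: "1 \<le> j \<and> j \<le> n \<and> pre lam j < box i c \<and> box i c \<le> pre lam j + part j"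
  show "j = i"
  proof (rule linorder_cases[of i j])
    assume "i < j" then show ?thesis using pre_step[of i j] ic j by auto
  next
    assume "j < i" then show ?thesis using pre_step[of j i] ic j by auto
  qed simp
qed (use ic in auto)

lemma col_box: "col lam (box i c) = c"
  by (simp add: col_def row_box)

lemma box_range: "box i c \<in> {1..N}"
  using pre_step[of i "Suc n"] ic by (auto simp: pre_last)

end

lemma box_iff:
  assumes "i \<in> {1..n}" "h \<in> {1..N}"
  shows "row lam h = i \<and> col lam h = c \<longleftrightarrow> 1 \<le> c \<and> c \<le> part i \<and> h = box i c"
proof -
  from assms(2) obtain i' c' where "i' \<in> {1..n}" "c' \<in> {1..part i'}" "h = box i' c'"
    by (rule box_ex)
  with assms(1) show ?thesis using row_box col_box by fastforce
qed

lemma box_eq_iff: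
  "i \<in> {1..n} \<Longrightarrow> c \<in> {1..part i} \<Longrightarrow> i' \<in> {1..n} \<Longrightarrow> c' \<in> {1..part i'} \<Longrightarrow>
    box i c = box i' c' \<longleftrightarrow> i = i' \<and> c = c'"
  using row_box[of i c] row_box[of i' c'] by auto

lemma glN_eqI:
  assumes "A \<in> glN N" "B \<in> glN N"
    "\<And>i c j d. i \<in> {1..n} \<Longrightarrow> c \<in> {1..part i} \<Longrightarrow> j \<in> {1..n} \<Longrightarrow> d \<in> {1..part j} \<Longrightarrow>
      A (box i c) (box j d) = B (box i c) (box j d)"
  shows "A = B"
proof (intro ext)
  fix h k
  show "A h k = B h k"
  proof (cases "h \<in> {1..N} \<and> k \<in> {1..N}")
    case True
    then obtain i c j d where "i \<in> {1..n}" "c \<in> {1..part i}" "h = box i c"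
      "j \<in> {1..n}" "d \<in> {1..part j}" "k = box j d"
      by (blast elim: box_ex)
    with assms(3) show ?thesis by simp
  qed (use assms(1,2) in \<open>auto simp: glN_def\<close>)
qed

lemma nil_e_left:
  assumes "j \<in> {1..n}" "d \<in> {1..part j}" "l \<in> {1..N}"
  shows "nil_e lam l (box j d) = (if 1 < d \<and> l = box j (d - 1) then 1 else 0 :: 'a::comm_ring_1)"
  using assms box_iff[of j l "d - 1"] box_range[of j d] by (auto simp: nil_e_def row_box col_box)

lemma nil_e_right:
  assumes "i \<in> {1..n}" "c \<in> {1..part i}" "l \<in> {1..N}"
  shows "nil_e lam (box i c) l = (if c < part i \<and> l = box i (c + 1) then 1 else 0 :: 'a::comm_ring_1)"
  using assms box_iff[of i l "c + 1"] box_range[of i c] by (auto simp: nil_e_def row_box col_box)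

lemma mmul_nil_e:
  assumes "i \<in> {1..n}" "c \<in> {1..part i}" "j \<in> {1..n}" "d \<in> {1..part j}"
  shows "mmul N A (nil_e lam) (box i c) (box j d) = (if 1 < d then A (box i c) (box j (d - 1)) else 0)"
    and "mmul N (nil_e lam) A (box i c) (box j d) = (if c < part i then A (box i (c + 1)) (box j d) else 0)"
proof -
  have r: "1 < d \<Longrightarrow> box j (d - 1) \<in> {1..N}" "c < part i \<Longrightarrow> box i (c + 1) \<in> {1..N}"
    by (rule box_range; use assms in auto)+
  have "mmul N A (nil_e lam) (box i c) (box j d) =
    (\<Sum>l\<in>{1..N}. if l = box j (d - 1) then (if 1 < d then A (box i c) l else 0) else 0)"
    unfolding mmul_def using assms by (intro sum.cong) (auto simp: nil_e_left)
  then show "mmul N A (nil_e lam) (box i c) (box j d) = (if 1 < d then A (box i c) (box j (d - 1)) else 0)"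
    using r by auto
  have "mmul N (nil_e lam) A (box i c) (box j d) =
    (\<Sum>l\<in>{1..N}. if l = box i (c + 1) then (if c < part i then A l (box j d) else 0) else 0)"
    unfolding mmul_def using assms by (intro sum.cong) (auto simp: nil_e_right)
  then show "mmul N (nil_e lam) A (box i c) (box j d) = (if c < part i then A (box i (c + 1)) (box j d) else 0)"
    using r by auto
qed

lemma mmul_in_glN: "A \<in> glN N \<Longrightarrow> B \<in> glN N \<Longrightarrow> mmul N A B \<in> glN N"
  by (auto simp: glN_def mmul_def)

lemma nil_e_in_glN: "nil_e lam \<in> glN N"
  by (simp add: glN_def nil_e_def)

lemma centralizer_iff:
  fixes A :: "'a::comm_ring_1 mat"
  shows "A \<in> L \<longleftrightarrow> A \<in> glN N \<and> (\<forall>i\<in>{1..n}. \<forall>c\<in>{1..part i}. \<forall>j\<in>{1..n}. \<forall>d\<in>{1..part j}.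
    (if 1 < d then A (box i c) (box j (d - 1)) else 0) = (if c < part i then A (box i (c + 1)) (box j d) else 0))"
    (is "_ \<longleftrightarrow> ?R")
proof
  assume A: "A \<in> L"
  show ?R
  proof (intro conjI ballI)
    fix i c j d
    assume "i \<in> {1..n}" "c \<in> {1..part i}" "j \<in> {1..n}" "d \<in> {1..part j}"
    from mmul_nil_e[OF this, of A] A
    show "(if 1 < d then A (box i c) (box j (d - 1)) else 0) = (if c < part i then A (box i (c + 1)) (box j d) else 0)"
      by (simp only: centralizer_def mem_Collect_eq)
  qed (use A in \<open>simp add: centralizer_def\<close>)
next
  assume R: ?R
  have "mmul N A (nil_e lam) = mmul N (nil_e lam) A"
    using R by (intro glN_eqI mmul_in_glN nil_e_in_glN) (auto simp only: mmul_nil_e)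
  with R show "A \<in> L" by (simp add: centralizer_def)
qed

lemma centralizerD:
  fixes A :: "'a::comm_ring_1 mat"
  assumes "A \<in> L" "i \<in> {1..n}" "c \<in> {1..part i}" "j \<in> {1..n}" "d \<in> {1..part j}"
  shows "(if 1 < d then A (box i c) (box j (d - 1)) else 0) = (if c < part i then A (box i (c + 1)) (box j d) else 0)"
  using assms unfolding centralizer_iff by blast

lemma Emat_box:
  assumes "i' \<in> {1..n}" "c \<in> {1..part i'}" "j' \<in> {1..n}" "d \<in> {1..part j'}"
  shows "Emat lam i j r (box i' c) (box j' d) = (if i' = i \<and> j' = j \<and> d = c + r then 1 else 0)"
  unfolding Emat_def row_box[OF assms(1,2)] row_box[OF assms(3,4)] col_box[OF assms(1,2)] col_box[OF assms(3,4)]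
  using box_range[OF assms(1,2)] box_range[OF assms(3,4)] by (simp del: atLeastAtMost_iff One_nat_def)

lemma Emat_in_glN: "Emat lam i j r \<in> glN N"
  by (simp add: glN_def Emat_def)

lemma Emat_eq_0:
  assumes "part j \<le> r" "j \<in> {1..n}"
  shows "Emat lam i j r = (\<lambda>h k. 0 :: 'a::comm_ring_1)"
proof (rule glN_eqI[OF Emat_in_glN])
  fix i' c j' d
  assume "i' \<in> {1..n}" "c \<in> {1..part i'}" "j' \<in> {1..n}" "d \<in> {1..part j'}"
  then show "Emat lam i j r (box i' c) (box j' d) = (0 :: 'a)"
    using assms by (auto simp: Emat_box)
qed (simp add: glN_def)

lemma zero_in_L: "(\<lambda>h k. 0) \<in> L"
  by (simp add: centralizer_iff glN_def)

lemma madd_in_L: "A \<in> L \<Longrightarrow> B \<in> L \<Longrightarrow> madd A B \<in> L"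
proof -
  have "mmul N (madd A B) C = madd (mmul N A C) (mmul N B C)" "mmul N C (madd A B) = madd (mmul N C A) (mmul N C B)"
    for C by (simp_all add: mmul_def madd_def distrib_left distrib_right sum.distrib)
  moreover have "A \<in> glN N \<Longrightarrow> B \<in> glN N \<Longrightarrow> madd A B \<in> glN N"
    by (simp add: glN_def madd_def)
  ultimately show "A \<in> L \<Longrightarrow> B \<in> L \<Longrightarrow> madd A B \<in> L"
    by (simp add: centralizer_def)
qed

lemma msmult_in_L: "A \<in> L \<Longrightarrow> msmult c A \<in> L"
proof -
  have "mmul N (msmult c A) C = msmult c (mmul N A C)" "mmul N C (msmult c A) = msmult c (mmul N C A)"
    for C by (simp_all add: mmul_def msmult_def sum_distrib_left mult_ac)
  moreover have "A \<in> glN N \<Longrightarrow> msmult c A \<in> glN N"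
    by (simp add: glN_def msmult_def)
  ultimately show "A \<in> L \<Longrightarrow> msmult c A \<in> L"
    by (simp add: centralizer_def)
qed

lemma Emat_in_L:
  assumes "i \<in> {1..n}" "j \<in> {1..n}" "part j - min (part i) (part j) \<le> r"
  shows "Emat lam i j r \<in> L"
  unfolding centralizer_iff
proof (intro conjI ballI Emat_in_glN)
  fix i' c j' d
  assume *: "i' \<in> {1..n}" "c \<in> {1..part i'}" "j' \<in> {1..n}" "d \<in> {1..part j'}"
  have 1: "1 < d \<Longrightarrow> Emat lam i j r (box i' c) (box j' (d - 1)) = (if i' = i \<and> j' = j \<and> d - 1 = c + r then 1 else 0)"
    using * by (intro Emat_box) auto
  have 2: "c < part i' \<Longrightarrow> Emat lam i j r (box i' (c + 1)) (box j' d) = (if i' = i \<and> j' = j \<and> d = c + 1 + r then 1 else 0)"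
    using * by (intro Emat_box) auto
  show "(if 1 < d then Emat lam i j r (box i' c) (box j' (d - 1)) else 0) =
    (if c < part i' then Emat lam i j r (box i' (c + 1)) (box j' d) else 0)"
    using 1 2 * assms by (auto split: if_splits)
qed

text \<open>The lower bound on \<open>q\<close> makes the intermediate box exist: if column
  \<open>c + s + q\<close> lies in row \<open>j\<close>, then column \<open>c + s\<close> lies in
  row \<open>i\<close>. Otherwise the product could be a truncation of
  \<open>Emat lam a j (s + q)\<close>.\<close>

lemma mmul_Emat:
  assumes "b \<in> {1..n}" "i \<in> {1..n}" "j \<in> {1..n}" "part j - min (part i) (part j) \<le> q"
  shows "mmul N (Emat lam a b s) (Emat lam i j q) =
    (if b = i then Emat lam a j (s + q) else (\<lambda>h k. 0 :: 'a::comm_ring_1))"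
proof (rule glN_eqI)
  fix i' c j' d
  assume *: "i' \<in> {1..n}" "c \<in> {1..part i'}" "j' \<in> {1..n}" "d \<in> {1..part j'}"
  have "mmul N (Emat lam a b s) (Emat lam i j q) (box i' c) (box j' d) =
    (\<Sum>l\<in>{1..N}. if l = box b (c + s) then
      (if i' = a \<and> c + s \<le> part b then Emat lam i j q l (box j' d) else 0) else 0 :: 'a)"
    unfolding mmul_def
  proof (rule sum.cong[OF refl])
    fix l assume l: "l \<in> {1..N}"
    then obtain b' x where "b' \<in> {1..n}" "x \<in> {1..part b'}" "l = box b' x" by (rule box_ex)
    moreover have "Emat lam a b s (box i' c) l = (if i' = a \<and> c + s \<le> part b \<and> l = box b (c + s) then 1 else 0 :: 'a)"
      using calculation * assms(1) box_eq_iff[of b' x b "c + s"] by (auto simp: Emat_box)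
    ultimately show "Emat lam a b s (box i' c) l * Emat lam i j q l (box j' d) =
      (if l = box b (c + s) then (if i' = a \<and> c + s \<le> part b then Emat lam i j q l (box j' d) else 0) else 0 :: 'a)"
      by simp
  qed
  also have "\<dots> = (if i' = a \<and> c + s \<le> part b then Emat lam i j q (box b (c + s)) (box j' d) else 0)"
    using box_range[of b "c + s"] assms(1) * by auto
  also have "\<dots> = (if b = i then Emat lam a j (s + q) else (\<lambda>h k. 0 :: 'a)) (box i' c) (box j' d)"
    using * assms Emat_box[of b "c + s" j' d] by (auto simp: Emat_box)
  finally show "mmul N (Emat lam a b s) (Emat lam i j q) (box i' c) (box j' d) =
    (if b = i then Emat lam a j (s + q) else (\<lambda>h k. 0 :: 'a)) (box i' c) (box j' d)" .
qed (auto simp: mmul_in_glN Emat_in_glN, simp add: glN_def)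

section \<open>Coordinates on the centralizer\<close>

definition coord :: "nat \<times> nat \<times> nat \<Rightarrow> 'a mat \<Rightarrow> 'a" where
  "coord b A = (case b of (i, j, r) \<Rightarrow> A (box i 1) (box j (1 + r)))"

lemma finite_idx: "finite idx"
proof (rule finite_subset)
  show "idx \<subseteq> {1..n} \<times> {1..n} \<times> {..<Suc (sum part {1..n})}"
  proof
    fix b assume "b \<in> idx"
    moreover have "j \<in> {1..n} \<Longrightarrow> part j \<le> sum part {1..n}" for j by (rule member_le_sum) auto
    ultimately show "b \<in> {1..n} \<times> {1..n} \<times> {..<Suc (sum part {1..n})}"
      unfolding idx_def by fastforce
  qed
qed simp

text \<open>Commuting with the nilpotent matrix makes each block constant along its diagonals and
  zero below them. The row of the leftmost box therefore determines the block, which is why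
  \<open>coord\<close> reads only that row.\<close>

lemma L_entry:
  fixes A :: "'a::comm_ring_1 mat"
  assumes "A \<in> L" "i \<in> {1..n}" "c \<in> {1..part i}" "j \<in> {1..n}" "d \<in> {1..part j}"
  shows "A (box i c) (box j d) = (if c \<le> d then A (box i 1) (box j (d - c + 1)) else 0)"
proof -
  have *: "(if 1 < d then A (box i c) (box j (d - 1)) else 0) = (if c < part i then A (box i (c + 1)) (box j d) else 0)"
    if "c \<in> {1..part i}" "d \<in> {1..part j}" for c d
    using assms that by (intro centralizerD)
  show ?thesis using assms(3,5)
  proof (induction c arbitrary: d)
    case (Suc c)
    show ?case
    proof (cases "c = 0")
      case False
      have "A (box i (Suc c)) (box j d) = (if 1 < d then A (box i c) (box j (d - 1)) else 0)"
        using *[of c d] False Suc.prems by auto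
      also have "\<dots> = (if Suc c \<le> d then A (box i 1) (box j (d - Suc c + 1)) else 0)"
      proof (cases "1 < d")
        case True
        then have "A (box i c) (box j (d - 1)) = (if c \<le> d - 1 then A (box i 1) (box j (d - 1 - c + 1)) else 0)"
          using Suc.prems False by (intro Suc.IH) auto
        then show ?thesis using True by auto
      qed (use False in auto)
      finally show ?thesis .
    qed (use Suc.prems in auto)
  qed simp
qed

text \<open>Slide the entry along its diagonal to the last box of row \<open>i\<close>. One further
  step leaves row \<open>i\<close> but not yet row \<open>j\<close>, and there commuting forces
  zero.\<close>

lemma coord_0:
  fixes A :: "'a::comm_ring_1 mat"
  assumes "A \<in> L" "i \<in> {1..n}" "j \<in> {1..n}" "r < part j - min (part i) (part j)"
  shows "coord (i, j, r) A = 0"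
proof -
  have p: "part i < part j" "r + part i < part j" "0 < part i" using assms(2,4) part_pos[of i] by auto
  have "A (box i (part i)) (box j (r + part i)) = 0"
    using centralizerD[OF assms(1,2) _ assms(3), of "part i" "r + part i + 1"] p by (auto split: if_splits)
  moreover have "A (box i (part i)) (box j (r + part i)) = A (box i 1) (box j (r + 1))"
    using L_entry[OF assms(1,2), of "part i" j "r + part i"] assms(3) p by simp
  ultimately show ?thesis using p by (simp add: coord_def add.commute)
qed

definition emat :: "nat \<times> nat \<times> nat \<Rightarrow> 'a::comm_ring_1 mat" where
  "emat b = (case b of (i, j, r) \<Rightarrow> Emat lam i j r)"

lemma emat_in_L: "b \<in> idx \<Longrightarrow> emat b \<in> L"
  by (auto simp: emat_def idx_def intro!: Emat_in_L)

lemma coord_emat: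
  assumes "b \<in> idx" "b' \<in> idx"
  shows "coord b (emat b') = (if b = b' then 1 else 0 :: 'a::comm_ring_1)"
proof -
  obtain i j r i' j' r' where b: "b = (i, j, r)" "b' = (i', j', r')" by (metis prod_cases3)
  have "i \<in> {1..n}" "1 \<in> {1..part i}" "j \<in> {1..n}" "1 + r \<in> {1..part j}"
    using assms(1) part_pos[of i] by (auto simp: b idx_def)
  from Emat_box[OF this, of i' j' r'] show ?thesis
    by (simp add: b coord_def emat_def)
qed

lemma L_expand:
  fixes A :: "'a::comm_ring_1 mat"
  assumes "A \<in> L"
  shows "A = (\<lambda>h k. \<Sum>b\<in>idx. coord b A * emat b h k)"
proof (rule glN_eqI)
  fix i c j d
  assume *: "i \<in> {1..n}" "c \<in> {1..part i}" "j \<in> {1..n}" "d \<in> {1..part j}"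
  have "(\<Sum>b\<in>idx. coord b A * emat b (box i c) (box j d)) =
    (\<Sum>b\<in>idx. if b = (i, j, d - c) then (if c \<le> d then coord b A else 0) else 0)"
    using * by (intro sum.cong) (auto simp: Emat_box emat_def split: prod.splits)
  also have "\<dots> = (if (i, j, d - c) \<in> idx \<and> c \<le> d then coord (i, j, d - c) A else 0)"
    by (simp add: finite_idx)
  also have "\<dots> = (if c \<le> d then coord (i, j, d - c) A else 0)"
    using coord_0[OF assms, of i j "d - c"] * by (auto simp: idx_def)
  also have "\<dots> = A (box i c) (box j d)"
    using L_entry[OF assms *] by (simp add: coord_def)
  finally show "A (box i c) (box j d) =
    (\<Sum>b\<in>idx. coord b A * emat b (box i c) (box j d))" by simp
next
  show "A \<in> glN N" using assms by (simp add: centralizer_iff)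
  show "(\<lambda>h k. \<Sum>b\<in>idx. coord b A * emat b h k) \<in> glN N"
    unfolding glN_def
  proof (intro CollectI allI impI sum.neutral ballI)
    fix h k b assume "\<not> (h \<in> {1..N} \<and> k \<in> {1..N})"
    then have "Emat lam i j r h k = (0 :: 'a)" for i j r
      using Emat_in_glN[of i j r] unfolding glN_def by blast
    then show "coord b A * emat b h k = 0" by (simp add: emat_def split: prod.splits)
  qed
qed

end

lemma sum_list_indices: "(\<Sum>k\<leftarrow>[1..<Suc m]. f k) = (\<Sum>k\<in>{1..m}. f k)" for f :: "nat \<Rightarrow> 'a::comm_monoid_add"
  by (simp add: sum_list_distinct_conv_sum_set atLeastLessThanSuc_atLeastAtMost del: upt_Suc)

lemma prod_list_filter:
  "prod_list (map f (filter P xs)) = prod_list (map (\<lambda>x. if P x then f x else 1) xs)"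
  for f :: "'b \<Rightarrow> 'c::monoid_mult"
  by (induction xs) auto

lemma prod_list_0: "0 \<in> set xs \<Longrightarrow> prod_list xs = (0 :: 'c::semiring_1)"
  by (induction xs) auto

lemma of_nat_in_FA: "of_nat k \<in> FA L"
  using fa_scal_in_FA[of "of_nat k" L] by (simp add: fa_scal_of_nat)

lemma len_le_of_nat: "len_le d (of_nat k :: 'x list \<Rightarrow>\<^sub>0 'a::comm_ring_1)"
  using len_le_scal[of d "of_nat k"] by (simp add: fa_scal_of_nat)

context diagram
begin

section \<open>The basis elements in the enveloping algebra\<close>

text \<open>Zero outside \<open>idx\<close>, so that sums may run over all degrees; for
  \<open>part j \<le> r\<close> this agrees with the matrix itself, which is then zero.\<close>

definition ee :: "nat \<Rightarrow> nat \<Rightarrow> nat \<Rightarrow> ('a::comm_ring_1 mat list \<Rightarrow>\<^sub>0 'a)" where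
  "ee i j r = (if (i, j, r) \<in> idx then fa_gen (Emat lam i j r) else 0)"

definition shift :: "nat \<Rightarrow> nat" where
  "shift i = (i - 1) * part i"

definition et :: "nat \<Rightarrow> nat \<Rightarrow> nat \<Rightarrow> ('a::comm_ring_1 mat list \<Rightarrow>\<^sub>0 'a)" where
  "et i j r = ee i j r - (if r = 0 \<and> i = j then of_nat (shift i) else 0)"

lemma etil_eq_et: "(i, j, r) \<in> idx \<Longrightarrow> etil lam i j r = et i j r"
  by (simp add: etil_def et_def ee_def shift_def fa_scal_of_nat del: of_nat_mult)

lemma ee_in_FA: "ee i j r \<in> FA L"
  by (auto simp: ee_def zero_in_FA idx_def intro!: fa_gen_in_FA Emat_in_L)

lemma et_in_FA: "et i j r \<in> FA L"
  unfolding et_def by (auto intro!: diff_in_FA ee_in_FA of_nat_in_FA)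

lemma ee_0: "part j \<le> r \<Longrightarrow> ee i j r = 0"
  by (auto simp: ee_def idx_def)

lemma et_0: "part j \<le> r \<Longrightarrow> j \<in> {1..n} \<Longrightarrow> et i j r = 0"
  using part_pos[of j] by (simp add: et_def ee_0)

lemma ucong_gen_Emat:
  assumes "i \<in> {1..n}" "j \<in> {1..n}" "part j - min (part i) (part j) \<le> r"
  shows "ucong N (L :: 'a::comm_ring_1 mat set) (fa_gen (Emat lam i j r)) (ee i j r)"
proof (cases "r < part j")
  case False
  then show ?thesis using ucong_gen_zero[OF zero_in_L] assms(2)
    by (simp add: ee_0 Emat_eq_0)
qed (use assms in \<open>simp add: ee_def idx_def\<close>)

lemma mbracket_Emat:
  assumes "(a, b, s) \<in> idx" "(i, j, q) \<in> idx"
  shows "mbracket N (Emat lam a b s) (Emat lam i j q) =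
    madd (if b = i then Emat lam a j (s + q) else (\<lambda>h k. 0))
      (msmult (- 1) (if j = a then Emat lam i b (q + s) else (\<lambda>h k. 0 :: 'a::comm_ring_1)))"
proof -
  have *: "mmul N (Emat lam a b s) (Emat lam i j q) = (if b = i then Emat lam a j (s + q) else (\<lambda>h k. 0 :: 'a))"
    "mmul N (Emat lam i j q) (Emat lam a b s) = (if j = a then Emat lam i b (q + s) else (\<lambda>h k. 0 :: 'a))"
    by (rule mmul_Emat; use assms in \<open>simp add: idx_def\<close>)+
  show ?thesis unfolding mbracket_def * by (simp add: madd_def msmult_def fun_eq_iff)
qed

text \<open>Degrees below the admissible range have to be excluded: there \<open>ee i j q\<close> is
  zero by convention, while the entries of higher degree on the right need not be. Degrees from
  \<open>part j\<close> on are harmless, since both sides vanish.\<close>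

lemma ucong_comm_ee:
  assumes ab: "(a, b, s) \<in> idx" and ij: "i \<in> {1..n}" "j \<in> {1..n}" "(i, j, q) \<in> idx \<or> part j \<le> q"
  shows "ucong N (L :: 'a::comm_ring_1 mat set) (ee a b s * ee i j q - ee i j q * ee a b s)
    ((if b = i then ee a j (q + s) else 0) - (if j = a then ee i b (q + s) else 0))"
proof (cases "(i, j, q) \<in> idx")
  case True
  define X Y :: "'a mat" where "X = (if b = i then Emat lam a j (s + q) else (\<lambda>h k. 0))"
    and "Y = (if j = a then Emat lam i b (q + s) else (\<lambda>h k. 0))"
  have v: "b = i \<Longrightarrow> part j - min (part a) (part j) \<le> s + q" "j = a \<Longrightarrow> part b - min (part i) (part b) \<le> q + s"
    using ab True by (auto simp: idx_def)
  have XY: "X \<in> L" "Y \<in> L"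
    unfolding X_def Y_def using ab ij v by (auto simp: idx_def zero_in_L intro!: Emat_in_L)
  have gX: "ucong N L (fa_gen X) (if b = i then ee a j (q + s) else 0)"
    unfolding X_def using ab ij v ucong_gen_Emat[of a j "s + q"] ucong_gen_zero[OF zero_in_L]
    by (auto simp: idx_def add.commute)
  have gY: "ucong N L (fa_gen Y) (if j = a then ee i b (q + s) else 0)"
    unfolding Y_def using ab ij v ucong_gen_Emat[of i b "q + s"] ucong_gen_zero[OF zero_in_L]
    by (auto simp: idx_def)
  have "ucong N L (ee a b s * ee i j q - ee i j q * ee a b s)
      (fa_gen (mbracket N (Emat lam a b s) (Emat lam i j q)))"
    using ucong_bracket[of "Emat lam a b s" L "Emat lam i j q" N] ab True
    by (auto simp: ee_def idx_def Emat_in_L)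
  also have "mbracket N (Emat lam a b s) (Emat lam i j q) = madd X (msmult (- 1) Y)"
    unfolding X_def Y_def by (rule mbracket_Emat[OF ab True])
  also have "ucong N L (fa_gen (madd X (msmult (- 1) Y))) (fa_gen X + fa_gen (msmult (- 1) Y))"
    using XY by (intro ucong_madd msmult_in_L)
  also have "ucong N L (fa_gen X + fa_gen (msmult (- 1) Y)) (fa_gen X + fa_scal (- 1) * fa_gen Y)"
    using XY by (intro ucong_add ucong_msmult) simp
  also have "fa_gen X + fa_scal (- 1) * fa_gen Y = fa_gen X - fa_gen Y"
    by (simp add: fa_scal_uminus fa_scal_1)
  also have "ucong N L (fa_gen X - fa_gen Y)
      ((if b = i then ee a j (q + s) else 0) - (if j = a then ee i b (q + s) else 0))"
    by (rule ucong_diff[OF gX gY])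
  finally show ?thesis .
next
  case False
  then have "part j \<le> q" using ij by blast
  then have "b = i \<Longrightarrow> ee a j (q + s) = (0 :: 'a mat list \<Rightarrow>\<^sub>0 'a)" "j = a \<Longrightarrow> ee i b (q + s) = (0 :: 'a mat list \<Rightarrow>\<^sub>0 'a)"
    using ab by (auto simp: idx_def intro!: ee_0)
  with \<open>part j \<le> q\<close> show ?thesis by (simp add: ee_0)
qed

section \<open>The elements \<open>z\<^sub>r\<close> as sums over subsets and degree distributions\<close>

text \<open>The degrees are one less than the parts of \<open>mu\<close> on its support
  \<open>I\<close>; the value zero outside \<open>I\<close> makes such a function unique.\<close>

definition degs :: "nat set \<Rightarrow> nat \<Rightarrow> (nat \<Rightarrow> nat) set" where
  "degs I T = {q. (\<forall>k. k \<notin> I \<longrightarrow> q k = 0) \<and> sum q I = T}"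

definition subsets :: "nat \<Rightarrow> nat set set" where
  "subsets d = {I. I \<subseteq> {1..n} \<and> card I = d}"

abbreviation perms :: "nat set \<Rightarrow> (nat \<Rightarrow> nat) set" where
  "perms I \<equiv> {w. w permutes I}"

text \<open>Positions outside \<open>I\<close> carry the factor 1, so all subsets share one list of
  positions and factors can be compared or exchanged without renumbering.\<close>

definition oprod :: "nat set \<Rightarrow> (nat \<Rightarrow> 'c) \<Rightarrow> 'c::monoid_mult" where
  "oprod I f = prod_list (map (\<lambda>k. if k \<in> I then f k else 1) [1..<Suc n])"

text \<open>Here \<open>q\<close> is not bounded by the parts: a degree of \<open>part k\<close> or
  more gives a vanishing factor. This freedom lets degrees be shifted in bulk when commutators are
  computed.\<close>

definition zz :: "nat \<Rightarrow> nat \<Rightarrow> ('a::comm_ring_1 mat list \<Rightarrow>\<^sub>0 'a)" where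
  "zz d T = (\<Sum>I\<in>subsets d. \<Sum>q\<in>degs I T. \<Sum>w\<in>perms I. of_int (sign w) * oprod I (\<lambda>k. et (w k) k (q k)))"

lemma finite_subsets: "finite (subsets d)"
  by (rule finite_subset[of _ "Pow {1..n}"]) (auto simp: subsets_def)

lemma subsetsD: "I \<in> subsets d \<Longrightarrow> finite I \<and> I \<subseteq> {1..n} \<and> card I = d"
  by (auto simp: subsets_def intro: finite_subset)

lemma finite_degs:
  assumes "finite I"
  shows "finite (degs I T)"
proof (rule finite_subset)
  show "degs I T \<subseteq> {q. \<forall>k. (k \<in> I \<longrightarrow> q k \<in> {..T}) \<and> (k \<notin> I \<longrightarrow> q k = 0)}"
    using assms member_le_sum[of _ I] by (fastforce simp: degs_def)
  show "finite {q :: nat \<Rightarrow> nat. \<forall>k. (k \<in> I \<longrightarrow> q k \<in> {..T}) \<and> (k \<notin> I \<longrightarrow> q k = 0)}"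
    using assms by (intro finite_set_of_finite_funs) auto
qed

lemma finite_perms: "finite I \<Longrightarrow> finite (perms I)"
  by (rule finite_permutations)

lemma oprod_cong: "I = I' \<Longrightarrow> (\<And>k. k \<in> I' \<Longrightarrow> k \<in> {1..n} \<Longrightarrow> f k = g k) \<Longrightarrow> oprod I f = oprod I' g"
  unfolding oprod_def by (intro arg_cong[of _ _ prod_list] map_cong) auto

lemma oprod_0: "k \<in> I \<Longrightarrow> I \<subseteq> {1..n} \<Longrightarrow> f k = 0 \<Longrightarrow> oprod I f = (0 :: 'c::semiring_1)"
  unfolding oprod_def by (intro prod_list_0) (force simp: image_iff simp del: upt_Suc)

lemma oprod_in_FA: "(\<And>k. k \<in> I \<Longrightarrow> f k \<in> FA L') \<Longrightarrow> oprod I f \<in> FA L'"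
  unfolding oprod_def by (intro prod_list_in_FA) (auto simp: one_in_FA)

lemma zz_in_FA: "zz d T \<in> FA L"
  unfolding zz_def by (intro sum_in_FA mult_in_FA of_int_in_FA oprod_in_FA et_in_FA)

lemma len_le_et: "len_le 1 (et i j r)"
  unfolding et_def ee_def by (intro len_le_diff) (auto simp: len_le_0 intro: len_le_of_nat len_le_gen[simplified])

lemma sum_ind: "finite I \<Longrightarrow> I \<subseteq> {1..n} \<Longrightarrow> (\<Sum>k\<leftarrow>[1..<Suc n]. if k \<in> I then f k else 0) = sum f I"
  for f :: "nat \<Rightarrow> 'b::comm_monoid_add"
  unfolding sum_list_indices by (simp add: sum.If_cases Int_absorb1)

lemma len_le_zz: "len_le d (zz d T)"
  unfolding zz_def
proof (intro len_le_sum)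
  fix I q w
  assume I: "I \<in> subsets d"
  have "len_le (\<Sum>k\<leftarrow>[1..<Suc n]. if k \<in> I then 1 else 0) (oprod I (\<lambda>k. et (w k) k (q k)))"
    unfolding oprod_def by (intro len_le_prod_list) (auto simp: len_le_et[simplified] len_le_1)
  also have "(\<Sum>k\<leftarrow>[1..<Suc n]. if k \<in> I then 1 else 0) = d"
    using subsetsD[OF I] sum_ind[of I "\<lambda>_. 1::nat"] by simp
  finally have "len_le (0 + d) (fa_scal (of_int (sign w)) * oprod I (\<lambda>k. et (w k) k (q k)))"
    by (intro len_le_mult len_le_scal)
  then show "len_le d (of_int (sign w) * oprod I (\<lambda>k. et (w k) k (q k)))"
    by (simp add: fa_scal_of_int)
qed

text \<open>The hypothesis under which the paper's \<open>z\<^sub>r\<close> is an extremal component: \<open>d - 1\<close> columns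
  can never accommodate total degree more than \<open>T = r - d\<close>.\<close>

definition extremal :: "nat \<Rightarrow> nat \<Rightarrow> bool" where
  "extremal d T \<longleftrightarrow> (\<forall>J\<subseteq>{1..n}. Suc (card J) = d \<longrightarrow> (\<Sum>k\<in>J. part k - 1) \<le> T)"

lemma extremalD:
  assumes "extremal d T" "I \<in> subsets d" "k \<in> I"
  shows "(\<Sum>k\<in>I - {k}. part k - 1) \<le> T"
proof -
  have "Suc (card (I - {k})) = d" "I - {k} \<subseteq> {1..n}"
    using subsetsD[OF assms(2)] card_Suc_Diff1[OF _ assms(3)] by blast+
  then show ?thesis using assms(1) by (auto simp: extremal_def)
qed

text \<open>The degree in column \<open>k\<close> is what the other columns leave of the total,
  hence at least \<open>T\<close> minus the sum of \<open>part j - 1\<close> over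
  \<open>I - {k}\<close>. Extremality bounds \<open>T\<close> from below by the same sum over
  \<open>I - {x}\<close>. The two sums differ by \<open>part k - part x\<close>, which is the lower
  bound of the admissible range.\<close>

lemma idx_of_extremal:
  assumes "extremal d T" "I \<in> subsets d" "q \<in> degs I T'" "T \<le> T'" "x \<in> I" "k \<in> I"
    "\<And>j. j \<in> I \<Longrightarrow> q j < part j"
  shows "(x, k, q k) \<in> idx"
proof -
  note I = subsetsD[OF assms(2)]
  have "sum q (I - {k}) \<le> (\<Sum>k\<in>I - {k}. part k - 1)"
    using assms(7) by (intro sum_mono) fastforce
  moreover have "sum q I = q k + sum q (I - {k})"
    using I assms(6) by (simp add: sum.remove)
  moreover have "sum q I = T'" using assms(3) by (simp add: degs_def)
  moreover have "(\<Sum>j\<in>I. part j - 1) = (part k - 1) + (\<Sum>j\<in>I - {k}. part j - 1)"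
    "(\<Sum>j\<in>I. part j - 1) = (part x - 1) + (\<Sum>j\<in>I - {x}. part j - 1)"
    by (rule sum.remove; use I assms(5,6) in blast)+
  moreover have "part k > 0" "part x > 0" using I assms(5,6) by (auto intro!: part_pos)
  moreover note extremalD[OF assms(1,2,5)] assms(4)
  ultimately have "part k \<le> part x + q k" by linarith
  then show ?thesis using I assms(5-7) by (auto simp: idx_def)
qed

lemma nz_pos_eq: "length mu = n \<Longrightarrow> nz_pos mu = filter (\<lambda>k. k \<in> {k\<in>{1..n}. mu ! (k - 1) \<noteq> 0}) [1..<Suc n]"
  unfolding nz_pos_def by (auto intro: filter_cong)

lemma list_as_map: "length mu = n \<Longrightarrow> mu = map (\<lambda>k. mu ! (k - 1)) [1..<Suc n]"
  by (rule nth_equalityI) (simp_all del: upt_Suc)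

text \<open>Conjugation with the increasing enumeration of \<open>I\<close> turns permutations of
  positions into permutations of \<open>I\<close> of the same sign.\<close>

lemma cdet_eq:
  assumes len: "length mu = n" and I: "I = {k\<in>{1..n}. mu ! (k - 1) \<noteq> 0}"
  shows "cdet lam mu = (\<Sum>w\<in>perms I. of_int (sign w) *
    oprod I (\<lambda>k. etil lam (w k) k (mu ! (k - 1) - 1)) :: 'a::comm_ring_1 mat list \<Rightarrow>\<^sub>0 'a)"
proof -
  define ix where "ix = nz_pos mu"
  define d where "d = length ix"
  have ix: "ix = filter (\<lambda>k. k \<in> I) [1..<Suc n]" unfolding ix_def I by (rule nz_pos_eq[OF len])
  have dist: "distinct ix" "set ix = I" unfolding ix by (auto simp: I)
  have bij: "bij_betw ((!) ix) {..<d} I"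
    using bij_betw_nth[OF dist(1)] dist(2) d_def by auto
  define g where "g = inv_into {..<d} ((!) ix)"
  have bijg: "bij_betw g I {..<d}" unfolding g_def by (rule bij_betw_inv_into[OF bij])
  have g1: "g (ix ! t) = t" if "t < d" for t
    using that bij unfolding g_def by (intro inv_into_f_f) (auto simp: bij_betw_def)
  have g2: "ix ! g x = x" if "x \<in> I" for x
    using that bij unfolding g_def by (intro f_inv_into_f) (auto simp: bij_betw_def)
  let ?F = "\<lambda>w k. etil lam (w k) k (mu ! (k - 1) - 1) :: 'a mat list \<Rightarrow>\<^sub>0 'a"
  have "cdet lam mu = (\<Sum>w\<in>perms {..<d}. of_int (sign w) *
      prod_list (map (\<lambda>t. etil lam (ix ! w t) (ix ! t) (mu ! (ix ! t - 1) - 1)) [0..<d]) :: 'a mat list \<Rightarrow>\<^sub>0 'a)"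
    unfolding cdet_def ix_def[symmetric] Let_def d_def[symmetric] fa_mult_eq_times fa_prod_list_eq fa_scal_of_int ..
  also have "\<dots> = (\<Sum>w\<in>perms I. of_int (sign w) * prod_list (map (?F w) ix))"
  proof (rule sum.reindex_bij_witness[where i = "map_permutation I g" and j = "map_permutation {..<d} ((!) ix)"])
    fix w assume "w \<in> perms {..<d}"
    then have w: "w permutes {..<d}" by simp
    show "map_permutation I g (map_permutation {..<d} ((!) ix) w) = w"
      by (rule map_permutation_compose_inv[OF bij w]) (simp add: g1)
    show "map_permutation {..<d} ((!) ix) w \<in> perms I"
      using map_permutation_permutes[OF bij w] by simp
    have "sign (map_permutation {..<d} ((!) ix) w) = sign w"
      using bij w by (intro sign_map_permutation) (auto simp: bij_betw_def)
    moreover have "map (?F (map_permutation {..<d} ((!) ix) w)) ix =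
        map (\<lambda>t. etil lam (ix ! w t) (ix ! t) (mu ! (ix ! t - 1) - 1)) [0..<d]"
    proof (rule nth_equalityI)
      fix t assume "t < length (map (?F (map_permutation {..<d} ((!) ix) w)) ix)"
      then have "t < d" by (simp add: d_def)
      then have "map_permutation {..<d} ((!) ix) w (ix ! t) = ix ! w t"
        using bij by (intro map_permutation_apply) (auto simp: bij_betw_def)
      with \<open>t < d\<close> show "map (?F (map_permutation {..<d} ((!) ix) w)) ix ! t =
        map (\<lambda>t. etil lam (ix ! w t) (ix ! t) (mu ! (ix ! t - 1) - 1)) [0..<d] ! t"
        by (simp add: d_def)
    qed (simp add: d_def)
    ultimately show "of_int (sign (map_permutation {..<d} ((!) ix) w)) *
        prod_list (map (?F (map_permutation {..<d} ((!) ix) w)) ix) = of_int (sign w) *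
        prod_list (map (\<lambda>t. etil lam (ix ! w t) (ix ! t) (mu ! (ix ! t - 1) - 1)) [0..<d])" by simp
  next
    fix w assume "w \<in> perms I"
    then have w: "w permutes I" by simp
    show "map_permutation {..<d} ((!) ix) (map_permutation I g w) = w"
      by (rule map_permutation_compose_inv[OF bijg w]) (simp add: g2)
    show "map_permutation I g w \<in> perms {..<d}"
      using map_permutation_permutes[OF bijg w] by simp
  qed
  also have "\<dots> = (\<Sum>w\<in>perms I. of_int (sign w) * oprod I (?F w))"
    unfolding ix prod_list_filter oprod_def ..
  finally show ?thesis .
qed

text \<open>A composition \<open>mu\<close> corresponds to its support together with the degrees
  \<open>mu - 1\<close> on it. Extremality enters because it puts all factors in the admissible
  range, where \<open>etil\<close> and \<open>et\<close> agree.\<close>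

lemma zgen_eq_zz:
  assumes d: "d = dseq lam r" and r: "d \<le> r" and ex: "extremal d (r - d)"
  shows "zgen lam r = (zz d (r - d) :: 'a::comm_ring_1 mat list \<Rightarrow>\<^sub>0 'a)"
proof -
  define T where "T = r - d"
  define B where "B I = {q\<in>degs I T. \<forall>k\<in>I. q k < part k}" for I
  define F where "F I q = (\<Sum>w\<in>perms I. of_int (sign w) * oprod I (\<lambda>k. et (w k) k (q k)) :: 'a mat list \<Rightarrow>\<^sub>0 'a)" for I q
  define supp where "supp mu = {k\<in>{1..n}. mu ! (k - 1) \<noteq> 0}" for mu :: "nat list"
  define dg where "dg mu k = (if k \<in> {1..n} then mu ! (k - 1) - 1 else 0)" for mu :: "nat list" and k
  define mk where "mk I q = map (\<lambda>k. if k \<in> I then Suc (q k) else 0) [1..<Suc n]" for I and q :: "nat \<Rightarrow> nat"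
  have mk_nth: "mk I q ! (k - 1) = (if k \<in> I then Suc (q k) else 0)" if "k \<in> {1..n}" for I q k
    using that by (cases k) (auto simp: mk_def simp del: upt_Suc)
  have mk_len: "length (mk I q) = n" for I q by (simp add: mk_def del: upt_Suc)
  have sumB: "sum_list mu = sum (dg mu) (supp mu) + card (supp mu)" if "length mu = n" for mu
  proof -
    have "sum_list mu = (\<Sum>k\<in>{1..n}. mu ! (k - 1))"
      using arg_cong[OF list_as_map[OF that], of sum_list] by (simp only: sum_list_indices)
    also have "\<dots> = (\<Sum>k\<in>supp mu. mu ! (k - 1))"
      by (rule sum.mono_neutral_right) (auto simp: supp_def)
    also have "\<dots> = (\<Sum>k\<in>supp mu. dg mu k + 1)"
      by (rule sum.cong) (auto simp: supp_def dg_def)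
    also have "\<dots> = sum (dg mu) (supp mu) + card (supp mu)"
      by (simp only: sum.distrib) simp
    finally show ?thesis .
  qed
  have nzB: "nz_len mu = card (supp mu)" if "length mu = n" for mu
  proof -
    have "nz_len mu = length (filter (\<lambda>x. x \<noteq> 0) (map (\<lambda>k. mu ! (k - 1)) [1..<Suc n]))"
      unfolding nz_len_def using arg_cong[OF list_as_map[OF that], of "\<lambda>m. length (filter (\<lambda>x. x \<noteq> 0) m)"] .
    also have "\<dots> = length (filter (\<lambda>k. mu ! (k - 1) \<noteq> 0) [1..<Suc n])"
      by (simp add: filter_map o_def del: upt_Suc)
    also have "\<dots> = card (set (filter (\<lambda>k. mu ! (k - 1) \<noteq> 0) [1..<Suc n]))"
      by (rule distinct_card[symmetric]) simp
    also have "set (filter (\<lambda>k. mu ! (k - 1) \<noteq> 0) [1..<Suc n]) = supp mu"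
      by (auto simp: supp_def)
    finally show ?thesis .
  qed
  have cdetB: "cdet lam mu = F (supp mu) (dg mu)"
    if "length mu = n" "supp mu \<in> subsets d" "dg mu \<in> B (supp mu)" for mu
  proof -
    have "cdet lam mu = (\<Sum>w\<in>perms (supp mu). of_int (sign w) *
        oprod (supp mu) (\<lambda>k. etil lam (w k) k (mu ! (k - 1) - 1)) :: 'a mat list \<Rightarrow>\<^sub>0 'a)"
      by (rule cdet_eq) (simp_all add: that supp_def)
    also have "\<dots> = F (supp mu) (dg mu)"
      unfolding F_def
    proof (rule sum.cong[OF refl], rule arg_cong2[where f = "(*)", OF refl], rule oprod_cong[OF refl])
      fix w k assume wk: "w \<in> perms (supp mu)" "k \<in> supp mu"
      then have "w k \<in> supp mu" by (auto simp: permutes_in_image)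
      then have "(w k, k, dg mu k) \<in> idx"
        using ex that wk by (intro idx_of_extremal[of d "r - d" "supp mu" "dg mu" T]) (auto simp: B_def T_def)
      then show "etil lam (w k) k (mu ! (k - 1) - 1) = (et (w k) k (dg mu k) :: 'a mat list \<Rightarrow>\<^sub>0 'a)"
        using wk by (simp add: dg_def supp_def etil_eq_et)
    qed
    finally show ?thesis .
  qed
  have inSig: "supp mu \<in> subsets d \<and> dg mu \<in> B (supp mu)"
    if "length mu = n" and le: "\<forall>i<n. mu ! i \<le> lam ! i" and "sum_list mu = r" "nz_len mu = d" for mu
  proof -
    have "dg mu k = 0" if "k \<notin> supp mu" for k
      using that by (auto simp: dg_def supp_def)
    moreover have "dg mu k < part k" if k: "k \<in> supp mu" for k
    proof -
      have "k \<in> {1..n}" "mu ! (k - 1) \<noteq> 0" using k by (auto simp: supp_def)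
      moreover from this have "mu ! (k - 1) \<le> lam ! (k - 1)" using le by auto
      ultimately show ?thesis by (simp add: dg_def lam_at_def)
    qed
    moreover have "card (supp mu) = d" "sum (dg mu) (supp mu) = T"
      using that sumB[OF that(1)] nzB[OF that(1)] by (simp_all add: T_def)
    moreover have "supp mu \<subseteq> {1..n}" by (auto simp: supp_def)
    ultimately show ?thesis by (auto simp: B_def degs_def subsets_def)
  qed
  have "zgen lam r = (\<Sum>(I, q)\<in>Sigma (subsets d) B. F I q)"
    unfolding zgen_def
  proof (rule sum.reindex_bij_witness[where i = "\<lambda>(I, q). mk I q" and j = "\<lambda>mu. (supp mu, dg mu)"])
    fix mu assume mu: "mu \<in> {mu \<in> subcomps lam. sum_list mu = r \<and> nz_len mu = dseq lam r}"
    then have len: "length mu = n" and le: "\<forall>i<n. mu ! i \<le> lam ! i" by (auto simp: subcomps_def)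
    show "(case (supp mu, dg mu) of (I, q) \<Rightarrow> mk I q) = mu"
      using len mk_nth[of _ "supp mu" "dg mu"]
      by (auto intro!: nth_equalityI simp: mk_len mk_def supp_def dg_def simp del: upt_Suc)
    have *: "supp mu \<in> subsets d \<and> dg mu \<in> B (supp mu)"
      using inSig[OF len le] mu d by simp
    then show "(supp mu, dg mu) \<in> Sigma (subsets d) B" by simp
    show "(case (supp mu, dg mu) of (I, q) \<Rightarrow> F I q) = cdet lam mu"
      using cdetB[OF len] * by simp
  next
    fix x assume "x \<in> Sigma (subsets d) B"
    then obtain I q where x: "x = (I, q)" "I \<in> subsets d" "q \<in> B I" by auto
    have s: "supp (mk I q) = I"
      using subsetsD[OF x(2)] mk_nth by (auto simp: supp_def simp del: One_nat_def split: if_splits)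
    have g: "dg (mk I q) = q"
    proof
      fix k
      have "q k = 0" if "k \<notin> I" using x(3) that by (simp add: B_def degs_def)
      then show "dg (mk I q) k = q k"
        using mk_nth[of k I q] subsetsD[OF x(2)] by (cases "k \<in> I") (auto simp: dg_def)
    qed
    show "(supp (case x of (I, q) \<Rightarrow> mk I q), dg (case x of (I, q) \<Rightarrow> mk I q)) = x"
      by (simp add: x s g)
    have "mk I q ! i \<le> lam ! i" if "i < n" for i
      using that x(3) mk_nth[of "Suc i" I q] by (force simp: B_def lam_at_def)
    then show "(case x of (I, q) \<Rightarrow> mk I q) \<in> {mu \<in> subcomps lam. sum_list mu = r \<and> nz_len mu = dseq lam r}"
      using sumB[OF mk_len, of I q] nzB[OF mk_len, of I q] s g x d r subsetsD[OF x(2)]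
      by (simp add: subcomps_def mk_len B_def degs_def T_def)
  qed
  also have "\<dots> = (\<Sum>I\<in>subsets d. \<Sum>q\<in>B I. F I q)"
  proof (subst sum.Sigma)
    show "\<forall>I\<in>subsets d. finite (B I)"
      using finite_degs subsetsD by (auto simp: B_def)
  qed (simp_all add: finite_subsets)
  \<comment> \<open>Enlarging the range of degrees is harmless: a new term has a column whose degree
    is at least its part, and that factor is zero.\<close>
  also have "\<dots> = (\<Sum>I\<in>subsets d. \<Sum>q\<in>degs I T. F I q)"
  proof (rule sum.cong[OF refl], rule sum.mono_neutral_left)
    fix I assume I: "I \<in> subsets d"
    note I' = subsetsD[OF I]
    show "finite (degs I T)" "B I \<subseteq> degs I T" using I' by (auto simp: B_def finite_degs)
    show "\<forall>q\<in>degs I T - B I. F I q = 0"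
    proof
      fix q assume "q \<in> degs I T - B I"
      then obtain k where "k \<in> I" "part k \<le> q k" by (force simp: B_def)
      with I' have "oprod I (\<lambda>k. et (w k) k (q k)) = (0 :: 'a mat list \<Rightarrow>\<^sub>0 'a)" for w
        by (intro oprod_0[of k]) (auto intro!: et_0)
      then show "F I q = 0" by (simp add: F_def)
    qed
  qed
  finally show ?thesis unfolding zz_def F_def T_def .
qed

end

section \<open>Centrality\<close>

text \<open>The Leibniz rule for the inner derivation by \<open>x\<close>, up to congruence.
  Distinctness of \<open>ks\<close> makes \<open>f(k := g k)\<close> alter exactly one
  factor.\<close>

lemma ucong_commutator_prod_list:
  assumes "distinct ks" "\<And>k. k \<in> set ks \<Longrightarrow> ucong N L (x * f k - f k * x) (g k)"
    "\<And>k. k \<in> set ks \<Longrightarrow> f k \<in> FA L" "\<And>k. k \<in> set ks \<Longrightarrow> g k \<in> FA L"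
  shows "ucong N L (x * prod_list (map f ks) - prod_list (map f ks) * x)
    (\<Sum>k\<in>set ks. prod_list (map (f(k := g k)) ks))"
  using assms
proof (induction ks)
  case (Cons y ks)
  let ?P = "prod_list (map f ks)"
  have P: "?P \<in> FA L" using Cons.prems(3) by (intro prod_list_in_FA) auto
  have IH: "ucong N L (x * ?P - ?P * x) (\<Sum>k\<in>set ks. prod_list (map (f(k := g k)) ks))"
    using Cons.prems by (intro Cons.IH) auto
  have "x * prod_list (map f (y # ks)) - prod_list (map f (y # ks)) * x =
    (x * f y - f y * x) * ?P + f y * (x * ?P - ?P * x)"
    by (simp add: algebra_simps)
  also have "ucong N L \<dots> (g y * ?P + f y * (\<Sum>k\<in>set ks. prod_list (map (f(k := g k)) ks)))"
    using Cons.prems P IH by (intro ucong_add ucong_mult_left ucong_mult_right) auto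
  also have "\<dots> = (\<Sum>k\<in>set (y # ks). prod_list (map (f(k := g k)) (y # ks)))"
  proof -
    have "map (f(y := g y)) ks = map f ks" using Cons.prems(1) by auto
    moreover have "(f(k := g k)) y = f y" if "k \<in> set ks" for k
      using that Cons.prems(1) by auto
    ultimately show ?thesis using Cons.prems(1) by (simp add: sum_distrib_left fun_upd_same del: fun_upd_apply)
  qed
  finally show ?case .
qed simp

lemma double_eq_0: "p + p = 0 \<Longrightarrow> p = 0" for p :: "'x \<Rightarrow>\<^sub>0 'a::field_char_0"
proof (rule poly_mapping_eqI)
  fix k assume "p + p = 0"
  then have "Poly_Mapping.lookup (p + p) k = 0" by simp
  then have "2 * Poly_Mapping.lookup p k = 0" by (simp add: lookup_add)
  then show "Poly_Mapping.lookup p k = Poly_Mapping.lookup 0 k" by simp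
qed

lemma sum_perms_conj:
  assumes "finite I" "bij_betw \<tau> I I'" "\<And>x. \<tau> (\<tau> x) = x" "permutation \<tau>"
  shows "(\<Sum>w\<in>{w. w permutes I}. F w) = (\<Sum>w\<in>{w. w permutes I'}. F (\<tau> \<circ> w \<circ> \<tau>))"
proof -
  have img: "\<tau> ` I = I'" "\<tau> ` I' = I"
    using assms(2,3) by (auto simp: bij_betw_def image_iff)
  have *: "\<tau> \<circ> w \<circ> \<tau> permutes J'" if "w permutes J" "\<tau> ` J = J'" for w J J'
  proof -
    have "bij \<tau>" using assms(3) by (rule involuntory_imp_bij)
    then have "bij (\<tau> \<circ> w \<circ> \<tau>)" using permutes_bij[OF that(1)] by (intro bij_comp)
    moreover have "(\<tau> \<circ> w \<circ> \<tau>) x = x" if "x \<notin> J'" for x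
    proof -
      have "\<tau> x \<notin> J" using that \<open>\<tau> ` J = J'\<close> assms(3) by (metis imageI)
      then show ?thesis using \<open>w permutes J\<close> assms(3) by (simp add: permutes_not_in)
    qed
    ultimately show ?thesis by (auto simp: permutes_def bij_iff)
  qed
  show ?thesis
  proof (rule sum.reindex_bij_witness[where i = "\<lambda>w. \<tau> \<circ> w \<circ> \<tau>" and j = "\<lambda>w. \<tau> \<circ> w \<circ> \<tau>"])
    fix w
    have conj2: "\<tau> \<circ> (\<tau> \<circ> w \<circ> \<tau>) \<circ> \<tau> = w" by (simp add: fun_eq_iff assms(3))
    show "\<tau> \<circ> (\<tau> \<circ> w \<circ> \<tau>) \<circ> \<tau> = w" "\<tau> \<circ> (\<tau> \<circ> w \<circ> \<tau>) \<circ> \<tau> = w"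
      "F (\<tau> \<circ> (\<tau> \<circ> w \<circ> \<tau>) \<circ> \<tau>) = F w"
      by (simp_all only: conj2)
    show "w \<in> {w. w permutes I} \<Longrightarrow> \<tau> \<circ> w \<circ> \<tau> \<in> {w. w permutes I'}"
      using *[OF _ img(1)] by simp
    show "w \<in> {w. w permutes I'} \<Longrightarrow> \<tau> \<circ> w \<circ> \<tau> \<in> {w. w permutes I}"
      using *[OF _ img(2)] by simp
  qed
qed

lemma sign_conj:
  assumes "finite I" "w permutes I"
  shows "sign (transpose a b \<circ> w \<circ> transpose a b) = sign w"
proof -
  have "permutation w" using assms permutation_permutes by blast
  then show ?thesis
    by (simp add: sign_compose permutation_compose permutation_swap_id sign_swap_id)
qed

context diagram
begin

abbreviation cg :: "('a::field_char_0 mat list \<Rightarrow>\<^sub>0 'a) \<Rightarrow> ('a mat list \<Rightarrow>\<^sub>0 'a) \<Rightarrow> bool" where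
  "cg \<equiv> ucong N L"

definition op :: "(nat \<Rightarrow> 'c) \<Rightarrow> 'c::monoid_mult" where
  "op g = prod_list (map g [1..<Suc n])"

lemma oprod_op: "oprod I f = op (\<lambda>k. if k \<in> I then f k else 1)"
  by (simp add: oprod_def op_def)

lemma op_cong: "(\<And>k. k \<in> {1..n} \<Longrightarrow> f k = g k) \<Longrightarrow> op f = op g"
  unfolding op_def by (intro arg_cong[of _ _ prod_list] map_cong) auto

lemma op_upd_diff: "k \<in> {1..n} \<Longrightarrow> op (f(k := u - v)) = op (f(k := u)) - op (f(k := v))"
  for u v :: "'c::ring_1"
proof -
  have *: "k \<in> set ks \<Longrightarrow> distinct ks \<Longrightarrow> prod_list (map (f(k := u - v)) ks) =
    prod_list (map (f(k := u)) ks) - prod_list (map (f(k := v)) ks)" for ks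
  proof (induction ks)
    case (Cons y ks)
    then show ?case
      by (cases "y = k") (auto simp: left_diff_distrib right_diff_distrib map_fun_upd simp del: fun_upd_apply simp add: fun_upd_same fun_upd_other)
  qed simp
  show "k \<in> {1..n} \<Longrightarrow> ?thesis" unfolding op_def by (rule *) auto
qed

lemma op_upd_of_nat: "k \<in> {1..n} \<Longrightarrow> op (f(k := of_nat u)) = of_nat u * op (f(k := 1))"
  for f :: "nat \<Rightarrow> 'c::ring_1"
proof -
  have *: "k \<in> set ks \<Longrightarrow> distinct ks \<Longrightarrow> prod_list (map (f(k := of_nat u)) ks) =
    of_nat u * prod_list (map (f(k := 1)) ks)" for ks
  proof (induction ks)
    case (Cons y ks)
    have "f y * (of_nat u * X) = of_nat u * (f y * X)" for X
      by (metis mult.assoc mult_of_nat_commute)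
    with Cons show ?case
      by (cases "y = k") (auto simp: map_fun_upd simp del: fun_upd_apply simp add: fun_upd_same fun_upd_other)
  qed simp
  show "k \<in> {1..n} \<Longrightarrow> ?thesis" unfolding op_def by (rule *) auto
qed

lemma op_0: "k \<in> {1..n} \<Longrightarrow> f k = 0 \<Longrightarrow> op f = (0 :: 'c::semiring_1)"
  unfolding op_def by (intro prod_list_0) (force simp: image_iff simp del: upt_Suc)

lemma ucong_commutator_oprod:
  assumes "I \<subseteq> {1..n}" "\<And>k. k \<in> I \<Longrightarrow> cg (x * f k - f k * x) (g k)"
    "\<And>k. k \<in> I \<Longrightarrow> f k \<in> FA L" "\<And>k. k \<in> I \<Longrightarrow> g k \<in> FA L"
  shows "cg (x * oprod I f - oprod I f * x) (\<Sum>k\<in>I. oprod I (f(k := g k)))"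
proof -
  let ?f = "\<lambda>k. if k \<in> I then f k else 1" and ?g = "\<lambda>k. if k \<in> I then g k else 0"
  have "cg (x * op ?f - op ?f * x) (\<Sum>k\<in>set [1..<Suc n]. op (?f(k := ?g k)))"
    unfolding op_def using assms
    by (intro ucong_commutator_prod_list) (auto simp: one_in_FA zero_in_FA)
  also have "(\<Sum>k\<in>set [1..<Suc n]. op (?f(k := ?g k))) = (\<Sum>k\<in>I. op (?f(k := ?g k)))"
    using assms(1) by (intro sum.mono_neutral_right) (auto intro!: op_0)
  also have "\<dots> = (\<Sum>k\<in>I. oprod I (f(k := g k)))"
    unfolding oprod_op by (intro sum.cong refl op_cong) auto
  finally show ?thesis unfolding oprod_op .
qed

text \<open>Adding \<open>s\<close> in column \<open>t\<close> reaches every distribution of total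
  \<open>T + s\<close> with \<open>s \<le> m t\<close>. A missing one has \<open>m t < s\<close>, so
  the other columns carry more than \<open>T\<close>, which is more than they can hold; some column
  then reaches its part and \<open>G\<close> vanishes. Afterwards the column that received the extra
  degree is no longer visible.\<close>

lemma sum_degs_shift:
  fixes G :: "(nat \<Rightarrow> nat) \<Rightarrow> 'c::ab_group_add"
  assumes "finite I" "t \<in> I" "(\<Sum>k\<in>I - {t}. part k - 1) \<le> T"
    "\<And>m k. m \<in> degs I (T + s) \<Longrightarrow> k \<in> I - {t} \<Longrightarrow> part k \<le> m k \<Longrightarrow> G m = 0"
  shows "(\<Sum>q\<in>degs I T. G (q(t := q t + s))) = (\<Sum>m\<in>degs I (T + s). G m)"
proof -
  have split: "sum q I = q t + sum q (I - {t})" for q :: "nat \<Rightarrow> nat"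
    using assms(1,2) by (rule sum.remove)
  have upd: "sum (q(t := v)) (I - {t}) = sum q (I - {t})" for q :: "nat \<Rightarrow> nat" and v
    by (rule sum.cong) auto
  have "(\<Sum>q\<in>degs I T. G (q(t := q t + s))) = (\<Sum>m\<in>{m\<in>degs I (T + s). s \<le> m t}. G m)"
    by (rule sum.reindex_bij_witness[where i = "\<lambda>m. m(t := m t - s)" and j = "\<lambda>q. q(t := q t + s)"])
      (use assms(2) in \<open>auto simp: degs_def split upd fun_eq_iff\<close>)
  also have "\<dots> = (\<Sum>m\<in>degs I (T + s). G m)"
  proof (rule sum.mono_neutral_left)
    show "\<forall>m\<in>degs I (T + s) - {m \<in> degs I (T + s). s \<le> m t}. G m = 0"
    proof
      fix m assume m: "m \<in> degs I (T + s) - {m \<in> degs I (T + s). s \<le> m t}"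
      then have "sum m I = T + s" "m t < s" by (auto simp: degs_def)
      then have "(\<Sum>k\<in>I - {t}. part k - 1) < sum m (I - {t})" using split[of m] assms(3) by simp
      then obtain k where "k \<in> I - {t}" "part k - 1 < m k"
        by (meson not_less sum_mono)
      then show "G m = 0" using assms(4)[of m k] m by auto
    qed
  qed (use assms(1) finite_degs in auto)
  finally show ?thesis .
qed

end

section \<open>The commutator of a basis element with the sum of determinants\<close>

locale zz_commutator = diagram lam for lam +
  fixes a b s d T :: nat
  assumes abs: "(a, b, s) \<in> idx" and extr: "extremal d T"
begin

lemma ab: "a \<in> {1..n}" "b \<in> {1..n}" "part b \<le> part a + s"
  using abs by (auto simp: idx_def)

text \<open>Bracketing with \<open>ee a b s\<close> turns row index \<open>b\<close> into
  \<open>a\<close> in one factor (\<open>Rf\<close>), or column index \<open>a\<close> into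
  \<open>b\<close> (\<open>Cf\<close>). The degrees \<open>m\<close> already contain the added
  \<open>s\<close>.\<close>

definition Rf :: "(nat \<Rightarrow> nat) \<Rightarrow> (nat \<Rightarrow> nat) \<Rightarrow> nat \<Rightarrow> ('a::field_char_0 mat list \<Rightarrow>\<^sub>0 'a)" where
  "Rf w m k = (if w k = b then ee a k (m k) else et (w k) k (m k))"

definition Cf :: "(nat \<Rightarrow> nat) \<Rightarrow> (nat \<Rightarrow> nat) \<Rightarrow> nat \<Rightarrow> ('a::field_char_0 mat list \<Rightarrow>\<^sub>0 'a)" where
  "Cf w m k = (if k = a then ee (w a) b (m a) else et (w k) k (m k))"

lemma ucong_comm_et:
  assumes "i \<in> {1..n}" "j \<in> {1..n}" "(i, j, q) \<in> idx \<or> part j \<le> q"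
  shows "cg (ee a b s * et i j q - et i j q * ee a b s)
    ((if i = b then ee a j (q + s) else 0) - (if j = a then ee i b (q + s) else 0))"
proof -
  have "x * (y - of_nat u) - (y - of_nat u) * x = x * y - y * x" for x y :: "'a mat list \<Rightarrow>\<^sub>0 'a" and u
    by (simp add: algebra_simps mult_of_nat_commute)
  moreover have "et i j q = (ee i j q :: 'a mat list \<Rightarrow>\<^sub>0 'a) - of_nat (if q = 0 \<and> i = j then shift i else 0)"
    by (simp add: et_def)
  ultimately have eq: "ee a b s * et i j q - et i j q * ee a b s = (ee a b s * ee i j q - ee i j q * ee a b s :: 'a mat list \<Rightarrow>\<^sub>0 'a)"
    by metis
  show ?thesis
    unfolding eq eq_commute[of i b] by (rule ucong_comm_ee[OF abs assms])
qed

lemma term_commutator: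
  assumes I: "I \<in> subsets d" and q: "q \<in> degs I T" and w: "w permutes I"
  shows "cg (ee a b s * oprod I (\<lambda>k. et (w k) k (q k)) - oprod I (\<lambda>k. et (w k) k (q k)) * ee a b s)
    ((if b \<in> I then oprod I (Rf w (q(inv w b := q (inv w b) + s))) else 0) -
     (if a \<in> I then oprod I (Cf w (q(a := q a + s))) else 0))"
proof -
  note I' = subsetsD[OF I]
  have w_in: "w k \<in> I \<longleftrightarrow> k \<in> I" for k using w by (rule permutes_in_image)
  have w_inv: "w k = b \<longleftrightarrow> k = inv w b" for k using w by (metis permutes_inverses)
  let ?f = "\<lambda>k. et (w k) k (q k) :: 'a mat list \<Rightarrow>\<^sub>0 'a"
  let ?u = "\<lambda>k. if w k = b then ee a k (q k + s) else 0 :: 'a mat list \<Rightarrow>\<^sub>0 'a"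
  let ?v = "\<lambda>k. if k = a then ee (w k) b (q k + s) else 0 :: 'a mat list \<Rightarrow>\<^sub>0 'a"
  have "cg (ee a b s * oprod I ?f - oprod I ?f * ee a b s) (\<Sum>k\<in>I. oprod I (?f(k := ?u k - ?v k)))"
  proof (cases "\<forall>k\<in>I. q k < part k")
    case True
    show ?thesis
    proof (rule ucong_commutator_oprod)
      fix k assume k: "k \<in> I"
      then have "(w k, k, q k) \<in> idx"
        using True w_in by (intro idx_of_extremal[OF extr I q]) auto
      then show "cg (ee a b s * ?f k - ?f k * ee a b s) (?u k - ?v k)"
        using I' k w_in by (intro ucong_comm_et) blast+
      show "?f k \<in> FA L" by (rule et_in_FA)
      show "?u k - ?v k \<in> FA L" by (auto intro!: diff_in_FA uminus_in_FA ee_in_FA zero_in_FA)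
    qed (use I' in blast)
  next
    \<comment> \<open>A column that reaches its part kills the product, and it also kills its own
      replacements: the degree only grows, and when column \<open>a\<close> becomes column
      \<open>b\<close> it reaches \<open>part b\<close> because
      \<open>part b \<le> part a + s\<close>.\<close>
    case False
    then obtain j where j: "j \<in> I" "part j \<le> q j" by (auto simp: not_less)
    have jn: "j \<in> {1..n}" using I' j by blast
    have "?f j = 0" using j jn by (simp add: et_0)
    then have 0: "oprod I ?f = 0" using j I' by (intro oprod_0[of j]) auto
    have "oprod I (?f(k := ?u k - ?v k)) = 0" if "k \<in> I" for k
    proof (rule oprod_0[of j])
      have "?u j = 0" using j by (simp add: ee_0)
      moreover have "?v j = 0" using j ab(3) by (auto simp: intro!: ee_0)
      ultimately show "(?f(k := ?u k - ?v k)) j = 0" using \<open>?f j = 0\<close> by auto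
    qed (use I' j in auto)
    then show ?thesis using 0 by simp
  qed
  also have "(\<Sum>k\<in>I. oprod I (?f(k := ?u k - ?v k))) =
      (\<Sum>k\<in>I. oprod I (?f(k := ?u k))) - (\<Sum>k\<in>I. oprod I (?f(k := ?v k)))"
  proof -
    have "oprod I (?f(k := y - z)) = oprod I (?f(k := y)) - oprod I (?f(k := z))" if "k \<in> I" for k y z
    proof -
      have e: "(\<lambda>j. if j \<in> I then (?f(k := x)) j else 1) = (\<lambda>j. if j \<in> I then ?f j else 1)(k := x)" for x
        using that by auto
      show ?thesis unfolding oprod_op e using that I' by (intro op_upd_diff) auto
    qed
    then show ?thesis by (simp add: sum_subtractf)
  qed
  also have "(\<Sum>k\<in>I. oprod I (?f(k := ?u k))) = (if b \<in> I then oprod I (Rf w (q(inv w b := q (inv w b) + s))) else 0)"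
  proof -
    have "(\<Sum>k\<in>I. oprod I (?f(k := ?u k))) =
      (\<Sum>k\<in>I. if k = inv w b then oprod I (Rf w (q(inv w b := q (inv w b) + s))) else 0)"
    proof (rule sum.cong[OF refl])
      fix k assume k: "k \<in> I"
      show "oprod I (?f(k := ?u k)) = (if k = inv w b then oprod I (Rf w (q(inv w b := q (inv w b) + s))) else 0)"
      proof (cases "k = inv w b")
        case True
        then show ?thesis
          using w_inv by (auto simp: Rf_def intro!: oprod_cong)
      next
        case False
        then show ?thesis using k I' w_inv by (auto intro!: oprod_0[of k])
      qed
    qed
    also have "\<dots> = (if inv w b \<in> I then oprod I (Rf w (q(inv w b := q (inv w b) + s))) else 0)"
      using I' by simp
    also have "inv w b \<in> I \<longleftrightarrow> b \<in> I"
      using permutes_inv[OF w] by (rule permutes_in_image)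
    finally show ?thesis .
  qed
  also have "(\<Sum>k\<in>I. oprod I (?f(k := ?v k))) = (if a \<in> I then oprod I (Cf w (q(a := q a + s))) else 0)"
  proof -
    have "(\<Sum>k\<in>I. oprod I (?f(k := ?v k))) =
      (\<Sum>k\<in>I. if k = a then oprod I (Cf w (q(a := q a + s))) else 0)"
    proof (rule sum.cong[OF refl])
      fix k assume k: "k \<in> I"
      show "oprod I (?f(k := ?v k)) = (if k = a then oprod I (Cf w (q(a := q a + s))) else 0)"
        using k I' by (auto simp: Cf_def intro!: oprod_0[of k] oprod_cong)
    qed
    then show ?thesis using I' by simp
  qed
  finally show ?thesis .
qed

definition Rsum :: "nat set \<Rightarrow> ('a::field_char_0 mat list \<Rightarrow>\<^sub>0 'a)" where
  "Rsum I = (\<Sum>m\<in>degs I (T + s). \<Sum>w\<in>perms I. of_int (sign w) * oprod I (Rf w m))"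

definition Csum :: "nat set \<Rightarrow> ('a::field_char_0 mat list \<Rightarrow>\<^sub>0 'a)" where
  "Csum I = (\<Sum>m\<in>degs I (T + s). \<Sum>w\<in>perms I. of_int (sign w) * oprod I (Cf w m))"

text \<open>The raised degree sits in column \<open>inv w b\<close> for rows and in column
  \<open>a\<close> for columns. \<open>sum_degs_shift\<close> absorbs both, so the two sums run over
  the same degree distributions and become comparable.\<close>

lemma zz_commutator:
  "cg (ee a b s * zz d T - zz d T * ee a b s)
    (sum Rsum {I\<in>subsets d. b \<in> I} - sum Csum {I\<in>subsets d. a \<in> I})"
proof -
  let ?R = "\<lambda>I q w. if b \<in> I then oprod I (Rf w (q(inv w b := q (inv w b) + s))) else 0 :: 'a mat list \<Rightarrow>\<^sub>0 'a"
  let ?C = "\<lambda>I q w. if a \<in> I then oprod I (Cf w (q(a := q a + s))) else 0 :: 'a mat list \<Rightarrow>\<^sub>0 'a"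
  have ic: "ee a b s * (of_int u * y) = of_int u * (ee a b s * y)" for y :: "'a mat list \<Rightarrow>\<^sub>0 'a" and u
    by (metis mult.assoc mult_of_int_commute)
  have e1: "ee a b s * zz d T - zz d T * ee a b s = (\<Sum>I\<in>subsets d. \<Sum>q\<in>degs I T. \<Sum>w\<in>perms I. of_int (sign w) *
      (ee a b s * oprod I (\<lambda>k. et (w k) k (q k)) - oprod I (\<lambda>k. et (w k) k (q k)) * ee a b s) :: 'a mat list \<Rightarrow>\<^sub>0 'a)"
    unfolding zz_def by (simp add: sum_distrib_left sum_distrib_right right_diff_distrib sum_subtractf ic mult.assoc)
  have c: "cg (\<Sum>I\<in>subsets d. \<Sum>q\<in>degs I T. \<Sum>w\<in>perms I. of_int (sign w) *
      (ee a b s * oprod I (\<lambda>k. et (w k) k (q k)) - oprod I (\<lambda>k. et (w k) k (q k)) * ee a b s))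
    (\<Sum>I\<in>subsets d. \<Sum>q\<in>degs I T. \<Sum>w\<in>perms I. of_int (sign w) * (?R I q w - ?C I q w))"
    by (intro ucong_sum ucong_mult_left term_commutator of_int_in_FA) auto
  have "(\<Sum>I\<in>subsets d. \<Sum>q\<in>degs I T. \<Sum>w\<in>perms I. of_int (sign w) * (?R I q w - ?C I q w)) = (\<Sum>I\<in>subsets d. (\<Sum>w\<in>perms I. \<Sum>q\<in>degs I T. of_int (sign w) * ?R I q w)
      - (\<Sum>w\<in>perms I. \<Sum>q\<in>degs I T. of_int (sign w) * ?C I q w))"
    by (subst (1 2) sum.swap) (simp add: right_diff_distrib sum_subtractf)
  also have "\<dots> = (\<Sum>I\<in>subsets d. (if b \<in> I then Rsum I else 0) - (if a \<in> I then Csum I else 0))"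
  proof (rule sum.cong[OF refl], rule arg_cong2[where f = "(-)"])
    fix I assume I: "I \<in> subsets d"
    note I' = subsetsD[OF I]
    have "(\<Sum>q\<in>degs I T. of_int (sign w) * ?R I q w) = (\<Sum>m\<in>degs I (T + s). of_int (sign w) * oprod I (Rf w m))"
      if w: "w permutes I" and b: "b \<in> I" for w
    proof -
      have t: "inv w b \<in> I" using permutes_inv[OF w] b by (simp add: permutes_in_image)
      have z: "of_int (sign w) * oprod I (Rf w m) = (0 :: 'a mat list \<Rightarrow>\<^sub>0 'a)"
        if "k \<in> I - {inv w b}" "part k \<le> m k" for k m
      proof -
        have "k \<in> {1..n}" using that I' by blast
        with that have "Rf w m k = (0 :: 'a mat list \<Rightarrow>\<^sub>0 'a)" by (simp add: Rf_def ee_0 et_0)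
        then have "oprod I (Rf w m) = (0 :: 'a mat list \<Rightarrow>\<^sub>0 'a)"
          using that I' by (intro oprod_0[of k]) auto
        then show ?thesis by simp
      qed
      have "(\<Sum>q\<in>degs I T. of_int (sign w) * oprod I (Rf w (q(inv w b := q (inv w b) + s)))) =
        (\<Sum>m\<in>degs I (T + s). of_int (sign w) * oprod I (Rf w m) :: 'a mat list \<Rightarrow>\<^sub>0 'a)"
        by (rule sum_degs_shift[where G = "\<lambda>m. of_int (sign w) * oprod I (Rf w m)"])
          (use I' t extremalD[OF extr I t] in \<open>blast intro: z\<close>)+
      then show ?thesis by (simp only: b if_True)
    qed
    note shiftR = this
    show "(\<Sum>w\<in>perms I. \<Sum>q\<in>degs I T. of_int (sign w) * ?R I q w) = (if b \<in> I then Rsum I else 0)"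
    proof (cases "b \<in> I")
      case True
      then have "(\<Sum>w\<in>perms I. \<Sum>q\<in>degs I T. of_int (sign w) * ?R I q w) =
        (\<Sum>w\<in>perms I. \<Sum>m\<in>degs I (T + s). of_int (sign w) * oprod I (Rf w m))"
        by (intro sum.cong[OF refl] shiftR) auto
      also have "\<dots> = Rsum I" unfolding Rsum_def by (rule sum.swap)
      finally show ?thesis using True by simp
    qed simp
    have "(\<Sum>q\<in>degs I T. of_int (sign w) * ?C I q w) = (\<Sum>m\<in>degs I (T + s). of_int (sign w) * oprod I (Cf w m))"
      if w: "w permutes I" and b: "a \<in> I" for w
    proof -
      have z: "of_int (sign w) * oprod I (Cf w m) = (0 :: 'a mat list \<Rightarrow>\<^sub>0 'a)"
        if "k \<in> I - {a}" "part k \<le> m k" for k m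
      proof -
        have "k \<in> {1..n}" using that I' by blast
        with that have "Cf w m k = (0 :: 'a mat list \<Rightarrow>\<^sub>0 'a)" by (simp add: Cf_def et_0)
        then have "oprod I (Cf w m) = (0 :: 'a mat list \<Rightarrow>\<^sub>0 'a)"
          using that I' by (intro oprod_0[of k]) auto
        then show ?thesis by simp
      qed
      have "(\<Sum>q\<in>degs I T. of_int (sign w) * oprod I (Cf w (q(a := q a + s)))) =
        (\<Sum>m\<in>degs I (T + s). of_int (sign w) * oprod I (Cf w m) :: 'a mat list \<Rightarrow>\<^sub>0 'a)"
        by (rule sum_degs_shift[where G = "\<lambda>m. of_int (sign w) * oprod I (Cf w m)"])
          (use I' b extremalD[OF extr I b] in \<open>blast intro: z\<close>)+
      then show ?thesis by (simp only: b if_True)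
    qed
    note shiftC = this
    show "(\<Sum>w\<in>perms I. \<Sum>q\<in>degs I T. of_int (sign w) * ?C I q w) = (if a \<in> I then Csum I else 0)"
    proof (cases "a \<in> I")
      case True
      then have "(\<Sum>w\<in>perms I. \<Sum>q\<in>degs I T. of_int (sign w) * ?C I q w) =
        (\<Sum>w\<in>perms I. \<Sum>m\<in>degs I (T + s). of_int (sign w) * oprod I (Cf w m))"
        by (intro sum.cong[OF refl] shiftC) auto
      also have "\<dots> = Csum I" unfolding Csum_def by (rule sum.swap)
      finally show ?thesis using True by simp
    qed simp
  qed
  also have "\<dots> = sum Rsum {I\<in>subsets d. b \<in> I} - sum Csum {I\<in>subsets d. a \<in> I}"
    using finite_subsets[of d] by (simp add: sum_subtractf sum.inter_filter)
  finally have e2: "(\<Sum>I\<in>subsets d. \<Sum>q\<in>degs I T. \<Sum>w\<in>perms I. of_int (sign w) * (?R I q w - ?C I q w)) =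
    sum Rsum {I\<in>subsets d. b \<in> I} - sum Csum {I\<in>subsets d. a \<in> I}" .
  show ?thesis using c unfolding e1 e2 .
qed

text \<open>For \<open>a = b\<close> both replacements merely delete the shift in the factor with
  row and column \<open>b\<close>; all other factors stay the same.\<close>

lemma diagonal_case:
  assumes "a = b"
  shows "cg (ee a b s * zz d T - zz d T * ee a b s) 0"
proof -
  have "Rf w m = (Cf w m :: nat \<Rightarrow> 'a mat list \<Rightarrow>\<^sub>0 'a)" for w m
    by (rule ext) (unfold Rf_def Cf_def et_def, use assms in auto)
  then have "Rsum I = (Csum I :: 'a mat list \<Rightarrow>\<^sub>0 'a)" for I unfolding Rsum_def Csum_def by simp
  moreover have "{I \<in> subsets d. a \<in> I} = {I \<in> subsets d. b \<in> I}" by (simp only: assms)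
  ultimately have "sum Rsum {I \<in> subsets d. b \<in> I} - sum Csum {I \<in> subsets d. a \<in> I} = (0 :: 'a mat list \<Rightarrow>\<^sub>0 'a)"
    by simp
  then show ?thesis using zz_commutator[where 'a = 'a] by (simp only:)
qed

end

section \<open>Neighbouring indices: replaced rows against replaced columns\<close>

locale zz_adjacent = zz_commutator +
  assumes adj: "b = Suc a \<or> a = Suc b"
begin

abbreviation tr :: "nat \<Rightarrow> nat" where "tr \<equiv> transpose a b"

lemma a_neq_b: "a \<noteq> b" using adj by auto

definition opA :: "(nat \<Rightarrow> 'c) \<Rightarrow> 'c::monoid_mult" where
  "opA g = prod_list (map g [1..<min a b])"

definition opB :: "(nat \<Rightarrow> 'c) \<Rightarrow> 'c::monoid_mult" where
  "opB g = prod_list (map g [Suc (Suc (min a b))..<Suc n])"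

text \<open>The factors of columns \<open>a\<close> and \<open>b\<close> in their order of
  occurrence. As \<open>a\<close> and \<open>b\<close> are neighbours, no other factor stands
  between them.\<close>

definition pp :: "'c \<Rightarrow> 'c \<Rightarrow> 'c::monoid_mult" where
  "pp x y = (if a < b then x * y else y * x)"

lemma op_split: "op g = opA g * pp (g a) (g b) * opB g"
proof -
  define l where "l = min a b"
  have l: "1 \<le> l" "Suc l \<le> n" using ab adj by (auto simp: l_def)
  then have "[1..<Suc n] = [1..<l] @ [l, Suc l] @ [Suc (Suc l)..<Suc n]"
    using upt_add_eq_append[of 1 l "Suc n - l"] by (simp add: upt_conv_Cons)
  moreover have "g l * g (Suc l) = pp (g a) (g b)"
    using adj by (auto simp: l_def pp_def)
  ultimately show ?thesis
    by (simp add: op_def opA_def opB_def flip: l_def mult.assoc del: upt_Suc)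
qed

lemma opA_cong: "(\<And>k. k \<noteq> a \<Longrightarrow> k \<noteq> b \<Longrightarrow> f k = g k) \<Longrightarrow> opA f = opA g"
  unfolding opA_def by (intro arg_cong[of _ _ prod_list] map_cong) auto

lemma opB_cong: "(\<And>k. k \<noteq> a \<Longrightarrow> k \<noteq> b \<Longrightarrow> f k = g k) \<Longrightarrow> opB f = opB g"
  unfolding opB_def using adj by (intro arg_cong[of _ _ prod_list] map_cong) auto

lemma pp_1 [simp]: "pp 1 x = x" "pp x 1 = x"
  by (auto simp: pp_def)

lemma op_swap:
  assumes "f a = 1" "g b = 1" "f b = g a" "\<And>k. k \<noteq> a \<Longrightarrow> k \<noteq> b \<Longrightarrow> f k = g k"
  shows "op f = op g"
  unfolding op_split using assms opA_cong[of f g] opB_cong[of f g] by simp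

lemma tr_tr [simp]: "tr (tr x) = x"
  by simp

lemma inj_on_tr: "inj_on tr A"
  by (rule inj_onI) (metis tr_tr)

lemma tr_image: "k \<in> tr ` I \<longleftrightarrow> tr k \<in> I"
  by (metis image_iff tr_tr)

lemma sum_degs_tr:
  assumes "finite I"
  shows "(\<Sum>m\<in>degs I S. G m) = (\<Sum>m\<in>degs (tr ` I) S. G (m \<circ> tr))"
proof (rule sum.reindex_bij_witness[where i = "\<lambda>m. m \<circ> tr" and j = "\<lambda>m. m \<circ> tr"])
  have *: "sum (m \<circ> tr) (tr ` J) = sum m J" for m :: "nat \<Rightarrow> nat" and J
    by (simp add: sum.reindex inj_on_tr)
  have comp: "m \<circ> tr \<circ> tr = m" for m :: "nat \<Rightarrow> nat" by (simp add: fun_eq_iff)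
  have img: "tr ` tr ` J = J" for J by (auto simp: tr_image)
  fix m :: "nat \<Rightarrow> nat"
  show "m \<circ> tr \<circ> tr = m" "m \<circ> tr \<circ> tr = m" "G (m \<circ> tr \<circ> tr) = G m" by (simp_all only: comp)
  show "m \<in> degs I S \<Longrightarrow> m \<circ> tr \<in> degs (tr ` I) S"
    by (simp add: degs_def *[unfolded o_def] tr_image o_def)
  show "m \<in> degs (tr ` I) S \<Longrightarrow> m \<circ> tr \<in> degs I S"
    using *[of m "tr ` I"] by (simp add: degs_def tr_image img o_def)
qed

lemma tr_other: "k \<noteq> a \<Longrightarrow> k \<noteq> b \<Longrightarrow> tr k = k"
  by (simp add: transpose_apply_other)

lemma sum_perms_tr:
  assumes "finite I"
  shows "(\<Sum>w\<in>perms I. F w) = (\<Sum>w\<in>perms (tr ` I). F (tr \<circ> w \<circ> tr))"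
  by (rule sum_perms_conj[OF assms]) (simp_all add: permutation_swap_id bij_betw_def inj_on_tr)

text \<open>Replacing row \<open>b\<close> by \<open>a\<close> for \<open>I\<close>, and column
  \<open>a\<close> by \<open>b\<close> for the image of \<open>I\<close> under \<open>tr\<close>,
  both lead to rows in that image and columns in \<open>I\<close>. The new entries are off the
  diagonal, so no shift intervenes, and the factor of column \<open>b\<close> slides past a
  neighbouring 1.\<close>

lemma Rsum_eq_Csum:
  assumes I: "I \<in> subsets d" "b \<in> I" "a \<notin> I"
  shows "Rsum I = (Csum (tr ` I) :: 'a::field_char_0 mat list \<Rightarrow>\<^sub>0 'a)"
proof -
  note I' = subsetsD[OF I(1)]
  let ?I = "tr ` I"
  have fin: "finite ?I" using I' by simp
  have aI: "a \<in> ?I" "b \<notin> ?I" using I by (auto simp: tr_image)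
  have kI: "k \<in> ?I \<longleftrightarrow> k \<in> I" if "k \<noteq> a" "k \<noteq> b" for k using that by (simp add: tr_image tr_other)
  have "Rsum I = (\<Sum>m\<in>degs ?I (T + s). \<Sum>w\<in>perms ?I.
      of_int (sign (tr \<circ> w \<circ> tr)) * oprod I (Rf (tr \<circ> w \<circ> tr) (m \<circ> tr)) :: 'a mat list \<Rightarrow>\<^sub>0 'a)"
    unfolding Rsum_def by (subst sum_degs_tr) (use I' in \<open>simp_all add: sum_perms_tr[where I = I]\<close>)
  also have "\<dots> = Csum ?I"
    unfolding Csum_def
  proof (intro sum.cong refl arg_cong2[where f = "(*)"])
    fix m w assume "w \<in> perms ?I"
    then have w: "w permutes ?I" by simp
    show "of_int (sign (tr \<circ> w \<circ> tr)) = (of_int (sign w) :: 'a mat list \<Rightarrow>\<^sub>0 'a)"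
      using sign_conj[OF fin w] by simp
    have wa: "w a \<noteq> b" using permutes_in_image[OF w, of a] aI by auto
    have wk: "w k \<noteq> b" if "k \<noteq> a" "k \<noteq> b" for k
      by (metis w aI(2) permutes_def that(2))
    show "oprod I (Rf (tr \<circ> w \<circ> tr) (m \<circ> tr)) = (oprod ?I (Cf w m) :: 'a mat list \<Rightarrow>\<^sub>0 'a)"
      unfolding oprod_op
    proof (rule op_swap)
      show "(if b \<in> I then Rf (tr \<circ> w \<circ> tr) (m \<circ> tr) b else 1) = (if a \<in> ?I then Cf w m a else 1 :: 'a mat list \<Rightarrow>\<^sub>0 'a)"
        using I aI wa a_neq_b by (cases "w a = a") (simp_all add: Rf_def Cf_def et_def tr_other)
      fix k assume k: "k \<noteq> a" "k \<noteq> b"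
      show "(if k \<in> I then Rf (tr \<circ> w \<circ> tr) (m \<circ> tr) k else 1) = (if k \<in> ?I then Cf w m k else 1 :: 'a mat list \<Rightarrow>\<^sub>0 'a)"
        using k kI[OF k] wk[OF k] by (cases "w k = a") (simp_all add: Rf_def Cf_def et_def tr_other)
    qed (use I aI in auto)
  qed
  finally show ?thesis .
qed

lemma sum_Rsum_eq_sum_Csum:
  "sum Rsum {I\<in>subsets d. b \<in> I \<and> a \<notin> I} = (sum Csum {I\<in>subsets d. a \<in> I \<and> b \<notin> I} :: 'a::field_char_0 mat list \<Rightarrow>\<^sub>0 'a)"
proof (rule sum.reindex_bij_witness[where i = "\<lambda>I. tr ` I" and j = "\<lambda>I. tr ` I"])
  fix I
  have img: "tr ` tr ` I = I" by (auto simp: tr_image)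
  show "tr ` tr ` I = I" "tr ` tr ` I = I" by (rule img)+
  have sub: "tr ` I \<in> subsets d" if "I \<in> subsets d"
  proof -
    have "card (tr ` I) = card I" by (rule card_image[OF inj_on_tr])
    moreover have "tr ` I \<subseteq> {1..n}"
    proof
      fix k assume "k \<in> tr ` I"
      then have "tr k \<in> {1..n}" using subsetsD[OF that] by (auto simp: tr_image)
      then show "k \<in> {1..n}" using ab tr_other[of k] by (cases "k = a \<or> k = b") auto
    qed
    ultimately show ?thesis using that by (simp add: subsets_def)
  qed
  show "I \<in> {I\<in>subsets d. b \<in> I \<and> a \<notin> I} \<Longrightarrow> tr ` I \<in> {I\<in>subsets d. a \<in> I \<and> b \<notin> I}"
    using sub by (simp add: tr_image)
  show "I \<in> {I\<in>subsets d. a \<in> I \<and> b \<notin> I} \<Longrightarrow> tr ` I \<in> {I\<in>subsets d. b \<in> I \<and> a \<notin> I}"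
    using sub by (simp add: tr_image)
  show "I \<in> {I\<in>subsets d. b \<in> I \<and> a \<notin> I} \<Longrightarrow> Csum (tr ` I) = (Rsum I :: 'a mat list \<Rightarrow>\<^sub>0 'a)"
    using Rsum_eq_Csum[of I, where 'a = 'a] by simp
qed

context
  fixes I assumes I: "I \<in> subsets d" "a \<in> I" "b \<in> I"
begin

lemma finI: "finite I" and I_sub: "I \<subseteq> {1..n}"
  using subsetsD[OF I(1)] by auto

lemma tr_I: "tr ` I = I"
  using I(2,3) tr_other by (auto simp: tr_image)

lemma tr_perm: "tr permutes I"
  using I by (intro permutes_swap_id)

text \<open>The shape of every correction term: the factors of columns \<open>a\<close> and
  \<open>b\<close> have merged into a single one of column \<open>b\<close>, placed at position
  \<open>a\<close>.\<close>

definition Wf :: "(nat \<Rightarrow> nat) \<Rightarrow> (nat \<Rightarrow> nat) \<Rightarrow> ('a::field_char_0 mat list \<Rightarrow>\<^sub>0 'a)" where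
  "Wf w p = op (\<lambda>k. if k = a then ee (w a) b (p b) else if k = b then 1
    else if k \<in> I then et (w k) k (p k) else 1)"

text \<open>Only the \<open>d - 1\<close> columns of \<open>I - {a}\<close> are left to hold the
  total degree \<open>T + s\<close>, and they hold at most \<open>T\<close>. A nonzero term thus has
  \<open>s = 0\<close> and every column at its top degree. Comparing \<open>I - {a}\<close> with
  \<open>I - {b}\<close>, and using \<open>part b \<le> part a + s\<close>, then gives equal
  parts.\<close>

lemma Wf_0_or_top:
  assumes p: "p \<in> degs (I - {a}) (T + s)"
  shows "Wf w p = 0 \<or> part a = part b \<and> Suc (p b) = part b"
proof (cases "\<forall>k\<in>I - {a}. p k < part k")
  case True
  have pos: "0 < part k" if "k \<in> I" for k using that I_sub by (intro part_pos) auto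
  have le: "p k \<le> part k - 1" if "k \<in> I - {a}" for k
    using bspec[OF True that] by simp
  have sp: "sum p (I - {a}) = T + s" using p by (simp add: degs_def)
  have "sum p (I - {a}) \<le> (\<Sum>k\<in>I - {a}. part k - 1)" by (rule sum_mono) (rule le)
  then have eq: "s = 0" "sum p (I - {a}) = (\<Sum>k\<in>I - {a}. part k - 1)" "(\<Sum>k\<in>I - {a}. part k - 1) = T"
    using sp extremalD[OF extr I(1,2)] by linarith+
  have "p b = part b - 1"
  proof (rule ccontr)
    assume "p b \<noteq> part b - 1"
    then have "p b < part b - 1" using le[of b] I a_neq_b by force
    then have "sum p (I - {a}) < (\<Sum>k\<in>I - {a}. part k - 1)"
      using I a_neq_b finI le by (intro sum_strict_mono_ex1) auto
    then show False using eq by simp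
  qed
  moreover have "(\<Sum>k\<in>I. part k - 1) = part a - 1 + (\<Sum>k\<in>I - {a}. part k - 1)"
    "(\<Sum>k\<in>I. part k - 1) = part b - 1 + (\<Sum>k\<in>I - {b}. part k - 1)"
    by (rule sum.remove; use I finI in blast)+
  moreover note extremalD[OF extr I(1,3)] eq pos[OF I(2)] pos[OF I(3)] ab(3)
  ultimately show ?thesis by linarith
next
  case False
  then obtain k where k: "k \<in> I - {a}" "part k \<le> p k" by (auto simp: not_less)
  have "Wf w p = 0"
  proof (cases "k = b")
    case True
    with k show ?thesis unfolding Wf_def using ab by (intro op_0[of a]) (auto intro: ee_0)
  next
    case False
    with k I_sub show ?thesis unfolding Wf_def by (intro op_0[of k]) (auto intro!: et_0)
  qed
  then show ?thesis ..
qed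

definition Wsum :: "((nat \<Rightarrow> nat) \<Rightarrow> 'a mat list \<Rightarrow>\<^sub>0 'a) \<Rightarrow> ('a::field_char_0 mat list \<Rightarrow>\<^sub>0 'a)" where
  "Wsum c = (\<Sum>p\<in>degs (I - {a}) (T + s). \<Sum>w\<in>perms I.
    if w b = b then of_int (sign w) * (c p * Wf w p) else 0)"

lemma degs_remove: "{m\<in>degs I S. m a = 0} = degs (I - {a}) S"
proof -
  have "sum m I = m a + sum m (I - {a})" for m :: "nat \<Rightarrow> nat"
    using finI I(2) by (rule sum.remove)
  then show ?thesis by (auto simp: degs_def)
qed

lemma sum_degs_remove:
  "(\<Sum>m\<in>degs I S. if m a = 0 then f m else 0) = (\<Sum>p\<in>degs (I - {a}) S. f p)"
  by (simp only: degs_remove[symmetric] sum.inter_filter[OF finite_degs[OF finI]])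

text \<open>After the replacement row \<open>a\<close> occurs twice, and a determinant with two
  equal rows vanishes even for noncommuting entries, since exchanging rows moves no factor. The
  shift in the entry of row and column \<open>a\<close> is the only difference between the two rows,
  so it alone survives.\<close>

lemma Rsum_eq_Wsum: "Rsum I = (Wsum (\<lambda>p. - of_nat (shift a)) :: 'a::field_char_0 mat list \<Rightarrow>\<^sub>0 'a)"
proof -
  \<comment> \<open>\<open>G\<close> is \<open>Rf\<close> with the shift dropped in row
    \<open>a\<close> as well, so that the two rows become truly equal.\<close>
  define G where "G w m k = (if w k = b \<or> w k = a then ee a k (m k) else et (w k) k (m k) :: 'a mat list \<Rightarrow>\<^sub>0 'a)"
    for w m :: "nat \<Rightarrow> nat" and k
  define U where "U w m = (oprod I ((Rf w m)(a := 1)) :: 'a mat list \<Rightarrow>\<^sub>0 'a)" for w m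
  have oprod_R: "oprod I (Rf w m) = oprod I (G w m) - (if w a = a \<and> m a = 0 then of_nat (shift a) * U w m else 0)" for w m
  proof (cases "w a = a \<and> m a = 0")
    case False
    then have "Rf w m k = G w m k" for k
      by (cases "k = a") (auto simp: Rf_def G_def et_def)
    then have "Rf w m = G w m" by (rule HOL.ext)
    then show ?thesis using False by (simp only: if_False diff_zero)
  next
    case True
    define g where "g = (\<lambda>k. if k \<in> I then G w m k else 1)"
    have ga: "g(a := ee a a 0) = g" using True I by (auto simp: g_def G_def)
    have RG: "Rf w m k = G w m k" if "k \<noteq> a" for k
      using that by (auto simp: Rf_def G_def et_def)
    have Ra: "Rf w m a = ee a a 0 - of_nat (shift a)"
      using True a_neq_b by (simp add: Rf_def et_def)
    have "oprod I (Rf w m) = op (g(a := ee a a 0 - of_nat (shift a)))"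
      unfolding oprod_op using I Ra RG by (intro op_cong) (auto simp: g_def)
    also have "\<dots> = op g - of_nat (shift a) * op (g(a := 1))"
      using ab(1) op_upd_diff[of a g "ee a a 0" "of_nat (shift a)"] op_upd_of_nat[of a g "shift a"] ga by simp
    also have "op g = oprod I (G w m)" by (simp add: oprod_op g_def)
    also have "op (g(a := 1)) = U w m"
      unfolding U_def oprod_op using RG by (intro op_cong) (auto simp: g_def)
    finally show ?thesis using True by simp
  qed
  have alt: "(\<Sum>w\<in>perms I. of_int (sign w) * oprod I (G w m)) = 0" for m
  proof -
    let ?S = "\<Sum>w\<in>perms I. of_int (sign w) * oprod I (G w m)"
    have "?S = (\<Sum>w\<in>perms I. of_int (sign (tr \<circ> w)) * oprod I (G (tr \<circ> w) m))"
      by (rule setum_permutations_compose_left[OF tr_perm])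
    also have "\<dots> = (\<Sum>w\<in>perms I. - (of_int (sign w) * oprod I (G w m)))"
    proof (rule sum.cong[OF refl])
      fix w assume "w \<in> perms I"
      then have "permutation w" using finI permutation_permutes by blast
      then have "sign (tr \<circ> w) = - sign w"
        by (simp add: sign_compose permutation_swap_id sign_swap_id a_neq_b)
      moreover have "G (tr \<circ> w) m = G w m"
        by (auto simp: fun_eq_iff G_def tr_other)
      ultimately show "of_int (sign (tr \<circ> w)) * oprod I (G (tr \<circ> w) m) = - (of_int (sign w) * oprod I (G w m))"
        by simp
    qed
    also have "\<dots> = - ?S" by (simp add: sum_negf)
    finally have "?S = - ?S" .
    then have "?S + ?S = 0" by (simp only: eq_neg_iff_add_eq_0)
    then show ?thesis by (rule double_eq_0)
  qed
  have "Rsum I = (\<Sum>m\<in>degs I (T + s). \<Sum>w\<in>perms I. of_int (sign w) * oprod I (G w m)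
      - (if m a = 0 then if w a = a then of_int (sign w) * (of_nat (shift a) * U w m) else 0 else 0))"
    unfolding Rsum_def by (intro sum.cong refl) (simp add: oprod_R right_diff_distrib)
  also have "\<dots> = - (\<Sum>m\<in>degs I (T + s). if m a = 0 then
      (\<Sum>w\<in>perms I. if w a = a then of_int (sign w) * (of_nat (shift a) * U w m) else 0) else 0)"
    unfolding sum_subtractf alt diff_0 sum_negf
    by (intro arg_cong[where f = uminus] sum.cong refl) simp
  also have "\<dots> = - (\<Sum>p\<in>degs (I - {a}) (T + s).
      \<Sum>w\<in>perms I. if w a = a then of_int (sign w) * (of_nat (shift a) * U w p) else 0)"
    by (simp only: sum_degs_remove)
  \<comment> \<open>Conjugation by \<open>tr\<close> moves the fixed point of \<open>w\<close> from
    \<open>a\<close> to \<open>b\<close>, which brings the term into the form of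
    \<open>Wf\<close>.\<close>
  also have "\<dots> = - (\<Sum>p\<in>degs (I - {a}) (T + s).
      \<Sum>w\<in>perms I. if w b = b then of_int (sign w) * (of_nat (shift a) * Wf w p) else 0)"
  proof (rule arg_cong[where f = uminus], rule sum.cong[OF refl])
    fix p
    let ?F = "\<lambda>w. if w a = a then of_int (sign w) * (of_nat (shift a) * U w p) else 0"
    have "sum ?F (perms I) = (\<Sum>w\<in>perms I. ?F (tr \<circ> w \<circ> tr))"
      using sum_perms_tr[OF finI, of ?F] by (simp only: tr_I)
    also have "\<dots> = (\<Sum>w\<in>perms I. if w b = b then of_int (sign w) * (of_nat (shift a) * Wf w p) else 0)"
    proof (rule sum.cong[OF refl])
      fix w assume "w \<in> perms I"
      then have w: "w permutes I" by simp
      have fix_iff: "(tr \<circ> w \<circ> tr) a = a \<longleftrightarrow> w b = b"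
        by simp (metis transpose_apply_second transpose_involutory)
      show "?F (tr \<circ> w \<circ> tr) = (if w b = b then of_int (sign w) * (of_nat (shift a) * Wf w p) else 0)"
      proof (cases "w b = b")
        case True
        have wk: "w k \<noteq> b" if "k \<noteq> b" for k using True that w by (metis permutes_inverses(2))
        have "U (tr \<circ> w \<circ> tr) p = Wf w p"
          unfolding U_def Wf_def oprod_op
        proof (rule op_swap)
          show "(if b \<in> I then ((Rf (tr \<circ> w \<circ> tr) p)(a := 1)) b else 1) =
            (if a = a then ee (w a) b (p b) else if a = b then 1 else if a \<in> I then et (w a) a (p a) else 1)"
            using I a_neq_b wk[of a] by (cases "w a = a") (simp_all add: Rf_def et_def tr_other)
          fix k assume k: "k \<noteq> a" "k \<noteq> b"
          then show "(if k \<in> I then ((Rf (tr \<circ> w \<circ> tr) p)(a := 1)) k else 1) =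
            (if k = a then ee (w a) b (p b) else if k = b then 1 else if k \<in> I then et (w k) k (p k) else 1)"
            using wk[of k] by (cases "w k = a") (simp_all add: Rf_def et_def tr_other)
        qed (use a_neq_b in auto)
        then show ?thesis using True fix_iff sign_conj[OF finI w] by simp
      qed (use fix_iff in simp)
    qed
    finally show "sum ?F (perms I) = (\<Sum>w\<in>perms I. if w b = b then of_int (sign w) * (of_nat (shift a) * Wf w p) else 0)" .
  qed
  also have "\<dots> = Wsum (\<lambda>p. - of_nat (shift a))"
    unfolding Wsum_def sum_negf[symmetric] by (intro sum.cong refl) simp
  finally show ?thesis .
qed

end

end

lemma prod_list_map_0: "k \<in> set ks \<Longrightarrow> f k = 0 \<Longrightarrow> prod_list (map f ks) = (0 :: 'c::semiring_1)"
  by (rule prod_list_0) (metis image_eqI set_map)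

section \<open>Neighbouring indices: the two equal columns\<close>

context zz_adjacent
begin

lemma pp_diff: "pp x (y - of_nat u) = pp x y - of_nat u * x" for x y :: "'c::ring_1"
  by (simp add: pp_def algebra_simps mult_of_nat_commute)

definition eps :: "'c::ring_1" where
  "eps = (if a < b then 1 else - 1)"

lemma pp_commutator: "pp x y - pp y x = eps * (x * y - y * x)" for x y :: "'c::ring_1"
  by (simp add: pp_def eps_def)

text \<open>The identity that dictates the shift: for neighbouring equal parts the numbers
  \<open>(i - 1) * part i\<close> differ by exactly one part, with the sign given by the order of
  the columns.\<close>

lemma eps_shift: "part a = part b \<Longrightarrow> - of_nat (shift a) = eps * of_nat (part b) - (of_nat (shift b) :: 'c::ring_1)"
  using adj ab by (auto simp: eps_def shift_def algebra_simps simp flip: of_nat_add of_nat_mult)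

context
  fixes I assumes I: "I \<in> subsets d" "a \<in> I" "b \<in> I"
begin

text \<open>A total of \<open>p b\<close> can be distributed over two columns in
  \<open>p b + 1\<close> ways, whence the multiplicity.\<close>

lemma sum_degs_collapse:
  fixes f :: "(nat \<Rightarrow> nat) \<Rightarrow> 'c::ring_1"
  shows "(\<Sum>m\<in>degs I S. f (m(a := 0, b := m a + m b))) = (\<Sum>p\<in>degs (I - {a}) S. of_nat (Suc (p b)) * f p)"
proof -
  have fin: "finite I" using finI[OF I] .
  have s1: "sum m I = m a + (m b + sum m (I - {a} - {b}))" for m :: "nat \<Rightarrow> nat"
    using fin I a_neq_b by (simp add: sum.remove)
  have s2: "sum m (I - {a}) = m b + sum m (I - {a} - {b})" for m :: "nat \<Rightarrow> nat"
    using fin I a_neq_b by (simp add: sum.remove)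
  have upd: "sum (m(a := u, b := v)) (I - {a} - {b}) = sum m (I - {a} - {b})" for m :: "nat \<Rightarrow> nat" and u v
    by (rule sum.cong) auto
  have "(\<Sum>m\<in>degs I S. f (m(a := 0, b := m a + m b))) = (\<Sum>(p, j)\<in>Sigma (degs (I - {a}) S) (\<lambda>p. {..p b}). f p)"
  proof (rule sum.reindex_bij_witness[where i = "\<lambda>(p, j). p(a := j, b := p b - j)"
        and j = "\<lambda>m. (m(a := 0, b := m a + m b), m a)"])
    fix m assume "m \<in> degs I S"
    then show "(m(a := 0, b := m a + m b), m a) \<in> Sigma (degs (I - {a}) S) (\<lambda>p. {..p b})"
      using I a_neq_b by (auto simp: degs_def s1 s2 upd)
  next
    fix x assume "x \<in> Sigma (degs (I - {a}) S) (\<lambda>p. {..p b})"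
    then obtain p j where x: "x = (p, j)" "p \<in> degs (I - {a}) S" "j \<le> p b" by auto
    then have "p a = 0" by (simp add: degs_def)
    then show "(case x of (p, j) \<Rightarrow> p(a := j, b := p b - j)) \<in> degs I S"
      using x I a_neq_b by (auto simp: degs_def s1 s2 upd)
    show "(\<lambda>m. (m(a := 0, b := m a + m b), m a)) (case x of (p, j) \<Rightarrow> p(a := j, b := p b - j)) = x"
      using x \<open>p a = 0\<close> a_neq_b by (auto simp: fun_eq_iff)
  qed (use a_neq_b in \<open>auto simp: fun_eq_iff\<close>)
  also have "\<dots> = (\<Sum>p\<in>degs (I - {a}) S. \<Sum>j\<in>{..p b}. f p)"
    using fin by (subst sum.Sigma) (auto intro: finite_degs)
  finally show ?thesis by simp
qed

lemma sum_swap_tr: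
  "(\<Sum>m\<in>degs I S. \<Sum>w\<in>perms I. F w m) = (\<Sum>m\<in>degs I S. \<Sum>w\<in>perms I. F (w \<circ> tr) (m \<circ> tr))"
proof -
  have "(\<Sum>m\<in>degs I S. \<Sum>w\<in>perms I. F w m) = (\<Sum>m\<in>degs I S. \<Sum>w\<in>perms I. F w (m \<circ> tr))"
    using sum_degs_tr[OF finI[OF I], of "\<lambda>m. \<Sum>w\<in>perms I. F w m" S] by (simp only: tr_I[OF I])
  then show ?thesis
    by (simp only: sum_permutations_compose_right[OF tr_perm[OF I], of "\<lambda>w. F w m" for m])
qed

lemma sign_comp_tr: "w \<in> perms I \<Longrightarrow> sign (w \<circ> tr) = - sign w"
proof -
  assume "w \<in> perms I"
  then have "permutation w" using finI[OF I] permutation_permutes by blast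
  then show ?thesis by (simp add: sign_compose permutation_swap_id sign_swap_id a_neq_b)
qed

abbreviation (input) cf :: "(nat \<Rightarrow> nat) \<Rightarrow> (nat \<Rightarrow> nat) \<Rightarrow> nat \<Rightarrow> ('a::field_char_0 mat list \<Rightarrow>\<^sub>0 'a)" where
  "cf w m \<equiv> \<lambda>k. if k \<in> I then et (w k) k (m k) else 1"

definition Am :: "(nat \<Rightarrow> nat) \<Rightarrow> (nat \<Rightarrow> nat) \<Rightarrow> ('a::field_char_0 mat list \<Rightarrow>\<^sub>0 'a)" where
  "Am w m = opA (cf w m)"

definition Bm :: "(nat \<Rightarrow> nat) \<Rightarrow> (nat \<Rightarrow> nat) \<Rightarrow> ('a::field_char_0 mat list \<Rightarrow>\<^sub>0 'a)" where
  "Bm w m = opB (cf w m)"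

lemma Am_Bm_tr: "Am (w \<circ> tr) (m \<circ> tr) = Am w m" "Bm (w \<circ> tr) (m \<circ> tr) = Bm w m"
  unfolding Am_def Bm_def by (intro opA_cong opB_cong; simp add: tr_other)+

lemma Am_Bm_FA: "Am w m \<in> FA L" "Bm w m \<in> FA L"
  unfolding Am_def Bm_def opA_def opB_def
  by (intro prod_list_in_FA; auto simp: et_in_FA one_in_FA)+

lemma Wf_collapse: "Am w m * ee (w a) b (m a + m b) * Bm w m = Wf I w (m(a := 0, b := m a + m b))"
proof -
  define p where "p = m(a := 0, b := m a + m b)"
  define g where "g = (\<lambda>k. if k = a then ee (w a) b (p b) else if k = b then 1
    else if k \<in> I then et (w k) k (p k) else (1 :: 'a mat list \<Rightarrow>\<^sub>0 'a))"
  have "opA g = Am w m" "opB g = Bm w m"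
    unfolding Am_def Bm_def by (intro opA_cong opB_cong; simp add: g_def p_def)+
  moreover have "g a = ee (w a) b (m a + m b)" "g b = 1"
    using a_neq_b by (simp_all add: g_def p_def)
  moreover have "Wf I w p = op g" unfolding Wf_def[OF I] g_def ..
  ultimately show ?thesis unfolding p_def[symmetric] by (simp add: op_split)
qed

text \<open>The shift in column \<open>b\<close> is split off. Its term has lost the factor of
  column \<open>b\<close> and so has the form \<open>Wf\<close>; the degrees are exchanged by
  \<open>tr\<close> because \<open>Wf\<close> reads the degree of the merged factor at
  \<open>b\<close>.\<close>

lemma oprod_Cf:
  "(oprod I (Cf w m) :: 'a::field_char_0 mat list \<Rightarrow>\<^sub>0 'a) = Am w m * pp (ee (w a) b (m a)) (ee (w b) b (m b)) * Bm w m -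
    (if m b = 0 \<and> w b = b then of_nat (shift b) * Wf I w (m \<circ> tr) else 0)"
proof -
  define u where "u = (if m b = 0 \<and> w b = b then shift b else 0)"
  define g where "g = (\<lambda>k. if k \<in> I then Cf w m k else (1 :: 'a mat list \<Rightarrow>\<^sub>0 'a))"
  have "opA g = Am w m" "opB g = Bm w m"
    unfolding Am_def Bm_def by (intro opA_cong opB_cong; simp add: Cf_def g_def)+
  moreover have "g a = ee (w a) b (m a)" "g b = ee (w b) b (m b) - of_nat u"
    using I a_neq_b by (simp_all add: Cf_def et_def u_def g_def)
  moreover have "oprod I (Cf w m) = op g" unfolding oprod_op g_def ..
  ultimately have "(oprod I (Cf w m) :: 'a mat list \<Rightarrow>\<^sub>0 'a) = Am w m * pp (ee (w a) b (m a)) (ee (w b) b (m b) - of_nat u) * Bm w m"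
    by (simp add: op_split)
  also have "\<dots> = Am w m * pp (ee (w a) b (m a)) (ee (w b) b (m b)) * Bm w m
      - Am w m * (of_nat u * ee (w a) b (m a)) * Bm w m"
    unfolding pp_diff by (simp add: left_diff_distrib right_diff_distrib)
  also have "(Am w m :: 'a mat list \<Rightarrow>\<^sub>0 'a) * (of_nat u * ee (w a) b (m a)) * Bm w m = of_nat u * (Am w m * ee (w a) b (m a) * Bm w m)"
  proof -
    have "Am w m * (of_nat u * z) = of_nat u * (Am w m * z)" for z :: "'a mat list \<Rightarrow>\<^sub>0 'a"
      by (metis mult.assoc mult_of_nat_commute)
    then show ?thesis by (simp only: mult.assoc)
  qed
  also have "\<dots> = (if m b = 0 \<and> w b = b then of_nat (shift b) * Wf I w (m \<circ> tr) else 0)"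
  proof (cases "m b = 0")
    case True
    have "m \<circ> tr = m(a := 0, b := m a + m b)"
    proof
      fix k show "(m \<circ> tr) k = (m(a := 0, b := m a + m b)) k"
        using True a_neq_b by (cases "k = a"; cases "k = b") (simp_all add: tr_other)
    qed
    then show ?thesis using Wf_collapse[of w m, where 'a = 'a] True by (simp add: u_def)
  qed (simp add: u_def)
  finally show ?thesis .
qed

text \<open>The degree count of \<open>idx_of_extremal\<close> when both columns have index
  \<open>b\<close>: what is lost by replacing \<open>part a\<close> with \<open>part b\<close> is
  covered by the extra degree \<open>s\<close>.\<close>

lemma idx_of_others:
  assumes m: "m \<in> degs I (T + s)" and x: "x \<in> I"
    and le: "\<And>k. k \<in> I - {a} - {b} \<Longrightarrow> m k < part k"
    and uv: "(u = a \<and> v = b) \<or> (u = b \<and> v = a)" "m u < part b" "m v < part b"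
  shows "(x, b, m u) \<in> idx"
proof -
  have fin: "finite I" using finI[OF I] .
  have pos: "0 < part k" if "k \<in> I" for k using that I_sub[OF I] by (intro part_pos) auto
  have r2: "sum f I = f a + (f b + sum f (I - {a} - {b}))" for f :: "nat \<Rightarrow> nat"
    using fin I a_neq_b by (simp add: sum.remove)
  have "sum m (I - {a} - {b}) \<le> (\<Sum>k\<in>I - {a} - {b}. part k - 1)"
  proof (rule sum_mono)
    fix k assume "k \<in> I - {a} - {b}"
    from le[OF this] show "m k \<le> part k - 1" by simp
  qed
  moreover have "sum m I = T + s" using m by (simp add: degs_def)
  moreover have "m a + m b = m u + m v" using uv(1) by auto
  moreover have "(\<Sum>k\<in>I. part k - 1) = part x - 1 + (\<Sum>k\<in>I - {x}. part k - 1)"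
    by (rule sum.remove) (use x fin in auto)
  moreover note r2[of m] r2[of "\<lambda>k. part k - 1"] extremalD[OF extr I(1) x] ab(3) pos[OF I(2)] pos[OF I(3)] pos[OF x] uv(3)
  ultimately have "part b \<le> part x + m u" by linarith
  then show ?thesis using x I_sub[OF I] ab uv(2) by (auto simp: idx_def)
qed

text \<open>The bracket formula applies when both middle degrees are below \<open>part b\<close>; if
  one of them is not, both sides vanish. If another column reaches its part, one of the outer
  products is zero.\<close>

lemma ucong_middle:
  assumes m: "m \<in> degs I (T + s)" and w: "w permutes I"
  shows "cg (Am w m * (ee (w a) b (m a) * ee (w b) b (m b) - ee (w b) b (m b) * ee (w a) b (m a)) * Bm w m)
    (Am w m * ((if w b = b then ee (w a) b (m a + m b) else 0) - (if w a = b then ee (w b) b (m b + m a) else 0)) * Bm w m)"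
    (is "cg (_ * ?x * _) (_ * ?y * _)")
proof (cases "\<forall>k\<in>I - {a} - {b}. m k < part k")
  case True
  have wI: "w a \<in> I" "w b \<in> I" using w I by (simp_all add: permutes_in_image)
  show ?thesis
  proof (intro ucong_mult_left ucong_mult_right Am_Bm_FA)
    show "cg ?x ?y"
    proof (cases "m a < part b \<and> m b < part b")
      case lt: True
      have 1: "(w a, b, m a) \<in> idx"
        by (rule idx_of_others[OF m wI(1), of a b]) (use True lt in auto)
      have 2: "(w b, b, m b) \<in> idx"
        by (rule idx_of_others[OF m wI(2), of b a]) (use True lt in auto)
      have wb: "w b \<in> {1..n}" using wI I_sub[OF I] by blast
      show ?thesis
        unfolding eq_commute[of _ b] add.commute[of "m a"]
        by (rule ucong_comm_ee[OF 1 wb ab(2) disjI1[OF 2]])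
    next
      case False
      then have "part b \<le> m a \<or> part b \<le> m b" by auto
      then show ?thesis by (auto simp: ee_0)
    qed
  qed
next
  case False
  then obtain k where k: "k \<in> I" "k \<noteq> a" "k \<noteq> b" "part k \<le> m k" by (auto simp: not_less)
  then have kn: "k \<in> {1..n}" using I_sub[OF I] by auto
  then have z: "cf w m k = (0 :: 'a mat list \<Rightarrow>\<^sub>0 'a)" using k by (simp add: et_0)
  have "k \<in> set [1..<min a b] \<or> k \<in> set [Suc (Suc (min a b))..<Suc n]"
    using k kn adj by auto
  then have "Am w m = (0 :: 'a mat list \<Rightarrow>\<^sub>0 'a) \<or> Bm w m = (0 :: 'a mat list \<Rightarrow>\<^sub>0 'a)"
  proof
    assume "k \<in> set [1..<min a b]"
    then have "Am w m = (0 :: 'a mat list \<Rightarrow>\<^sub>0 'a)"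
      unfolding Am_def opA_def by (rule prod_list_map_0[where f = "cf w m", OF _ z])
    then show ?thesis ..
  next
    assume "k \<in> set [Suc (Suc (min a b))..<Suc n]"
    then have "Bm w m = (0 :: 'a mat list \<Rightarrow>\<^sub>0 'a)"
      unfolding Bm_def opB_def by (rule prod_list_map_0[where f = "cf w m", OF _ z])
    then show ?thesis ..
  qed
  then show ?thesis by auto
qed

text \<open>With commuting entries, two equal columns would make the determinant vanish. Here,
  exchanging them in permutations and degrees alike shows that twice the sum is an alternating sum
  of commutators. These collapse to single entries of column \<open>b\<close>, and the number of
  degree splittings supplies \<open>Suc (p b)\<close>.\<close>

lemma ucong_Csum_Wsum:
  "cg (Csum I) (Wsum I (\<lambda>p. eps * of_nat (Suc (p b)) - of_nat (shift b)))"
proof -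
  let ?S = "T + s"
  define X where "X w m = (ee (w a) b (m a) :: 'a mat list \<Rightarrow>\<^sub>0 'a)" for w m :: "nat \<Rightarrow> nat"
  define Y where "Y w m = (ee (w b) b (m b) :: 'a mat list \<Rightarrow>\<^sub>0 'a)" for w m :: "nat \<Rightarrow> nat"
  define D where "D w m = (if w b = b then ee (w a) b (m a + m b) else 0 :: 'a mat list \<Rightarrow>\<^sub>0 'a)" for w m :: "nat \<Rightarrow> nat"
  define D' where "D' w m = (if w a = b then ee (w b) b (m b + m a) else 0 :: 'a mat list \<Rightarrow>\<^sub>0 'a)" for w m :: "nat \<Rightarrow> nat"
  have tr_XY: "X (w \<circ> tr) (m \<circ> tr) = Y w m" "Y (w \<circ> tr) (m \<circ> tr) = X w m" "D' (w \<circ> tr) (m \<circ> tr) = D w m" for w m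
    by (simp_all add: X_def Y_def D_def D'_def)
  define H where "H = (\<Sum>m\<in>degs I ?S. \<Sum>w\<in>perms I. of_int (sign w) * (Am w m * pp (X w m) (Y w m) * Bm w m))"
  define K where "K = (\<Sum>m\<in>degs I ?S. \<Sum>w\<in>perms I. of_int (sign w) * (eps * (Am w m * D w m * Bm w m)))"
  define M where "M = (\<Sum>m\<in>degs I ?S. \<Sum>w\<in>perms I.
    if m b = 0 then if w b = b then of_int (sign w) * (of_nat (shift b) * Wf I w (m \<circ> tr)) else 0 else 0 :: 'a mat list \<Rightarrow>\<^sub>0 'a)"
  have CHM: "Csum I = H - M"
    unfolding Csum_def H_def M_def X_def Y_def sum_subtractf[symmetric]
    by (intro sum.cong refl) (simp add: oprod_Cf right_diff_distrib)
  have neg: "(\<Sum>m\<in>degs I ?S. \<Sum>w\<in>perms I. of_int (sign (w \<circ> tr)) * f w m) =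
      - (\<Sum>m\<in>degs I ?S. \<Sum>w\<in>perms I. of_int (sign w) * f w m)" for f :: "(nat \<Rightarrow> nat) \<Rightarrow> (nat \<Rightarrow> nat) \<Rightarrow> 'a mat list \<Rightarrow>\<^sub>0 'a"
    unfolding sum_negf[symmetric] by (intro sum.cong refl) (simp add: sign_comp_tr)
  \<comment> \<open>Composing with \<open>tr\<close> on the right exchanges the two middle factors
    and reverses the sign.\<close>
  have "H = (\<Sum>m\<in>degs I ?S. \<Sum>w\<in>perms I. of_int (sign (w \<circ> tr)) * (Am w m * pp (Y w m) (X w m) * Bm w m))"
    unfolding H_def by (subst sum_swap_tr) (simp only: tr_XY Am_Bm_tr)
  then have H': "H = - (\<Sum>m\<in>degs I ?S. \<Sum>w\<in>perms I. of_int (sign w) * (Am w m * pp (Y w m) (X w m) * Bm w m))"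
    unfolding neg .
  have ecomm: "x * (eps * y) = eps * (x * y)" for x y :: "'a mat list \<Rightarrow>\<^sub>0 'a"
    by (simp add: eps_def)
  have "H + H = (\<Sum>m\<in>degs I ?S. \<Sum>w\<in>perms I. of_int (sign w) * (Am w m * pp (X w m) (Y w m) * Bm w m)) -
      (\<Sum>m\<in>degs I ?S. \<Sum>w\<in>perms I. of_int (sign w) * (Am w m * pp (Y w m) (X w m) * Bm w m))"
    by (subst (2) H') (simp add: H_def)
  also have "\<dots> = (\<Sum>m\<in>degs I ?S. \<Sum>w\<in>perms I. of_int (sign w) *
      (eps * (Am w m * (X w m * Y w m - Y w m * X w m) * Bm w m)))"
    unfolding sum_subtractf[symmetric]
  proof (intro sum.cong refl)
    fix m w
    have "Am w m * (eps * z) * Bm w m = eps * (Am w m * z * Bm w m)" for z :: "'a mat list \<Rightarrow>\<^sub>0 'a"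
      by (simp only: ecomm mult.assoc)
    then have "Am w m * pp (X w m) (Y w m) * Bm w m - Am w m * pp (Y w m) (X w m) * Bm w m =
      eps * (Am w m * (X w m * Y w m - Y w m * X w m) * Bm w m)"
      by (simp only: left_diff_distrib[symmetric] right_diff_distrib[symmetric] pp_commutator)
    then show "of_int (sign w) * (Am w m * pp (X w m) (Y w m) * Bm w m) - of_int (sign w) * (Am w m * pp (Y w m) (X w m) * Bm w m) =
      of_int (sign w) * (eps * (Am w m * (X w m * Y w m - Y w m * X w m) * Bm w m))"
      by (simp only: right_diff_distrib[symmetric])
  qed
  finally have HH: "H + H = (\<Sum>m\<in>degs I ?S. \<Sum>w\<in>perms I. of_int (sign w) *
      (eps * (Am w m * (X w m * Y w m - Y w m * X w m) * Bm w m)))" .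
  have "cg (H + H) (\<Sum>m\<in>degs I ?S. \<Sum>w\<in>perms I. of_int (sign w) * (eps * (Am w m * (D w m - D' w m) * Bm w m)))"
    unfolding HH X_def Y_def D_def D'_def
    by (intro ucong_sum ucong_mult_left ucong_middle of_int_in_FA)
      (auto simp: eps_def one_in_FA uminus_in_FA)
  also have "(\<Sum>m\<in>degs I ?S. \<Sum>w\<in>perms I. of_int (sign w) * (eps * (Am w m * (D w m - D' w m) * Bm w m))) =
      K - (\<Sum>m\<in>degs I ?S. \<Sum>w\<in>perms I. of_int (sign w) * (eps * (Am w m * D' w m * Bm w m)))"
    unfolding K_def by (simp only: left_diff_distrib right_diff_distrib sum_subtractf)
  \<comment> \<open>The second half of the commutator becomes the first half under the same
    exchange; the sign it picks up makes the halves add rather than cancel.\<close>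
  also have "(\<Sum>m\<in>degs I ?S. \<Sum>w\<in>perms I. of_int (sign w) * (eps * (Am w m * D' w m * Bm w m))) =
      (\<Sum>m\<in>degs I ?S. \<Sum>w\<in>perms I. of_int (sign (w \<circ> tr)) * (eps * (Am w m * D w m * Bm w m)))"
    by (subst sum_swap_tr) (simp only: tr_XY Am_Bm_tr)
  also have "\<dots> = - K" unfolding neg K_def ..
  finally have "cg (H + H) (K + K)" by simp
  then have "cg (fa_scal 2 * H) (fa_scal 2 * K)"
  proof -
    have "fa_scal 2 = (2 :: 'a mat list \<Rightarrow>\<^sub>0 'a)" by (metis fa_scal_of_nat of_nat_numeral)
    with \<open>cg (H + H) (K + K)\<close> show ?thesis by (simp only: mult_2)
  qed
  \<comment> \<open>Characteristic zero permits the division by 2.\<close>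
  then have HK: "cg H K" by (rule ucong_scal_cancel) simp
  define E where "E p = (\<Sum>w\<in>perms I. if w b = b then of_int (sign w) * (eps * Wf I w p) else 0 :: 'a mat list \<Rightarrow>\<^sub>0 'a)" for p
  have "K = (\<Sum>m\<in>degs I ?S. E (m(a := 0, b := m a + m b)))"
    unfolding K_def E_def D_def by (intro sum.cong refl) (simp add: Wf_collapse)
  then have K: "K = (\<Sum>p\<in>degs (I - {a}) ?S. of_nat (Suc (p b)) * E p)"
    by (simp only: sum_degs_collapse)
  define E' where "E' p = (\<Sum>w\<in>perms I. if w b = b then of_int (sign w) * (of_nat (shift b) * Wf I w p) else 0 :: 'a mat list \<Rightarrow>\<^sub>0 'a)" for p
  have "M = (\<Sum>m\<in>degs I ?S. if m b = 0 then E' (m \<circ> tr) else 0)"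
    unfolding M_def E'_def by (intro sum.cong refl) simp
  also have "\<dots> = (\<Sum>m\<in>degs I ?S. if m a = 0 then E' m else 0)"
    using sum_degs_tr[OF finI[OF I], of "\<lambda>m. if m a = 0 then E' m else 0" ?S] by (simp add: tr_I[OF I])
  also have "\<dots> = (\<Sum>p\<in>degs (I - {a}) ?S. E' p)"
    by (rule sum_degs_remove[OF I])
  finally have M: "M = (\<Sum>p\<in>degs (I - {a}) ?S. E' p)" .
  have "K - M = Wsum I (\<lambda>p. eps * of_nat (Suc (p b)) - of_nat (shift b))"
    unfolding K M Wsum_def[OF I] E_def E'_def sum_distrib_left sum_subtractf[symmetric]
  proof (intro sum.cong refl)
    fix p w
    have "x * (y * z) = y * (x * z)" if "\<And>z. x * z = z * x" for x y z :: "'a mat list \<Rightarrow>\<^sub>0 'a"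
      using that by (metis mult.assoc)
    then have nc: "of_nat u * (y * z) = y * (of_nat u * z)" for u and y z :: "'a mat list \<Rightarrow>\<^sub>0 'a"
      by (metis mult_of_nat_commute)
    have "of_nat (Suc (p b)) * (of_int (sign w) * (eps * Wf I w p)) =
      of_int (sign w) * (eps * (of_nat (Suc (p b)) * Wf I w p) :: 'a mat list \<Rightarrow>\<^sub>0 'a)"
      by (simp only: nc[of _ "of_int (sign w)"] nc[of _ eps])
    then show "of_nat (Suc (p b)) * (if w b = b then of_int (sign w) * (eps * Wf I w p) else 0) -
      (if w b = b then of_int (sign w) * (of_nat (shift b) * Wf I w p) else 0) =
      (if w b = b then of_int (sign w) * ((eps * of_nat (Suc (p b)) - of_nat (shift b)) * Wf I w p) else 0 :: 'a mat list \<Rightarrow>\<^sub>0 'a)"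
      by (simp only: if_split left_diff_distrib right_diff_distrib mult.assoc) simp
  qed
  then show ?thesis
    using ucong_diff[OF HK ucong_refl[of _ _ M]] by (simp add: CHM)
qed

text \<open>Where \<open>Wf\<close> is nonzero, the two parts agree and \<open>Suc (p b)\<close>
  equals \<open>part b\<close>; there the coefficients coincide by \<open>eps_shift\<close>.\<close>

lemma ucong_Csum_Rsum: "cg (Csum I) (Rsum I)"
proof -
  have "Wsum I (\<lambda>p. eps * of_nat (Suc (p b)) - of_nat (shift b)) = (Wsum I (\<lambda>p. - of_nat (shift a)) :: 'a mat list \<Rightarrow>\<^sub>0 'a)"
    unfolding Wsum_def[OF I]
  proof (intro sum.cong refl)
    fix p w assume p: "p \<in> degs (I - {a}) (T + s)"
    have "(eps * of_nat (Suc (p b)) - of_nat (shift b)) * Wf I w p = (- of_nat (shift a) * Wf I w p :: 'a mat list \<Rightarrow>\<^sub>0 'a)"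
    proof (cases "Wf I w p = (0 :: 'a mat list \<Rightarrow>\<^sub>0 'a)")
      case False
      then have "part a = part b" "Suc (p b) = part b" using Wf_0_or_top[OF I p, of w, where 'a = 'a] by blast+
      moreover from this have "eps * of_nat (part b) - of_nat (shift b) = (- of_nat (shift a) :: 'a mat list \<Rightarrow>\<^sub>0 'a)"
        using eps_shift by (metis (no_types))
      ultimately show ?thesis by (simp only:)
    qed simp
    then show "(if w b = b then of_int (sign w) * ((eps * of_nat (Suc (p b)) - of_nat (shift b)) * Wf I w p) else 0) =
      (if w b = b then of_int (sign w) * (- of_nat (shift a) * Wf I w p) else 0 :: 'a mat list \<Rightarrow>\<^sub>0 'a)"
      by (simp only:)
  qed
  then show ?thesis
    using ucong_Csum_Wsum[where 'a = 'a] Rsum_eq_Wsum[OF I, where 'a = 'a] by (simp only:)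
qed

end

text \<open>Sets containing exactly one of \<open>a\<close> and \<open>b\<close> match termwise
  under \<open>tr\<close>; only sets containing both involve the bracket of columns and the
  shift.\<close>

lemma adjacent_case: "cg (ee a b s * zz d T - zz d T * ee a b s) 0"
proof -
  define P where "P = {I\<in>subsets d. a \<in> I \<and> b \<in> I}"
  have fin: "finite (subsets d)" by (rule finite_subsets)
  define R C X where "R = (sum Rsum P :: 'a mat list \<Rightarrow>\<^sub>0 'a)" and "C = (sum Csum P :: 'a mat list \<Rightarrow>\<^sub>0 'a)"
    and "X = (sum Rsum {I\<in>subsets d. b \<in> I \<and> a \<notin> I} :: 'a mat list \<Rightarrow>\<^sub>0 'a)"
  have 1: "sum Rsum {I\<in>subsets d. b \<in> I} = R + X"
    unfolding P_def R_def X_def using fin by (subst sum.union_disjoint[symmetric]) (auto intro: sum.cong)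
  have 2: "sum Csum {I\<in>subsets d. a \<in> I} = C + X"
    unfolding P_def C_def X_def sum_Rsum_eq_sum_Csum
    using fin by (subst sum.union_disjoint[symmetric]) (auto intro: sum.cong)
  have "cg C R"
    unfolding C_def R_def by (rule ucong_sum) (auto simp: P_def intro: ucong_Csum_Rsum)
  then have "cg (R - C) (R - R)" by (intro ucong_diff ucong_refl)
  then have "cg ((R + X) - (C + X)) 0" by simp
  then have "cg (sum Rsum {I\<in>subsets d. b \<in> I} - sum Csum {I\<in>subsets d. a \<in> I}) (0 :: 'a mat list \<Rightarrow>\<^sub>0 'a)"
    unfolding 1 2 .
  with zz_commutator show ?thesis by (rule ucong_trans)
qed

end

text \<open>The largest element of \<open>J\<close> is at least the cardinality of \<open>J\<close>,
  so its value is at most that of position \<open>card J\<close>; the rest is handled by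
  induction.\<close>

lemma sum_antimono_le:
  fixes f :: "nat \<Rightarrow> nat"
  assumes "\<And>i j. 1 \<le> i \<Longrightarrow> i \<le> j \<Longrightarrow> j \<le> m \<Longrightarrow> f j \<le> f i" "J \<subseteq> {1..m}"
  shows "sum f J \<le> sum f {1..card J}"
  using assms(2)
proof (induction "card J" arbitrary: J)
  case 0
  then have "J = {}" using finite_subset[of J] by auto
  then show ?case by simp
next
  case (Suc k)
  have fin: "finite J" using Suc.prems finite_subset by blast
  define x where "x = Max J"
  have x: "x \<in> J" using fin Suc.hyps(2) by (auto simp: x_def intro!: Max_in)
  have "J \<subseteq> {1..x}" using Suc.prems fin by (auto simp: x_def)
  then have "card J \<le> x" using card_mono[of "{1..x}" J] by simp
  have "card (J - {x}) = k" using Suc.hyps(2) fin x by simp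
  then have "sum f (J - {x}) \<le> sum f {1..k}" using Suc.hyps(1)[of "J - {x}"] Suc.prems by auto
  moreover have "f x \<le> f (Suc k)"
    using \<open>card J \<le> x\<close> Suc.hyps(2) Suc.prems x by (intro assms(1)) auto
  moreover have "sum f J = f x + sum f (J - {x})" using fin x by (rule sum.remove)
  ultimately show ?case by (simp flip: Suc.hyps(2))
qed

section \<open>Commuting with a generating set\<close>

context diagram
begin

definition commutes :: "('a::field_char_0 mat list \<Rightarrow>\<^sub>0 'a) \<Rightarrow> ('a mat list \<Rightarrow>\<^sub>0 'a) \<Rightarrow> bool" where
  "commutes z p \<longleftrightarrow> cg (p * z) (z * p)"

lemma commutes_diff: "commutes z p \<Longrightarrow> commutes z q \<Longrightarrow> commutes z (p - q)"
  unfolding commutes_def by (simp add: left_diff_distrib right_diff_distrib ucong_diff)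

lemma commutes_sum: "(\<And>i. i \<in> A \<Longrightarrow> commutes z (f i)) \<Longrightarrow> commutes z (sum f A)"
  unfolding commutes_def by (simp add: sum_distrib_left sum_distrib_right ucong_sum)

lemma commutes_mult:
  assumes "commutes z p" "commutes z q" "p \<in> FA L" "q \<in> FA L"
  shows "commutes z (p * q)"
proof -
  have "cg (p * (q * z)) (p * (z * q))"
    using assms by (intro ucong_mult_left) (auto simp: commutes_def)
  moreover have "cg (p * z * q) (z * p * q)"
    using assms by (intro ucong_mult_right) (auto simp: commutes_def)
  ultimately show ?thesis
    unfolding commutes_def mult.assoc by (rule ucong_trans)
qed

lemma commutes_scal: "commutes z (fa_scal c)"
  unfolding commutes_def fa_scal_commute by simp

lemma commutes_cong:
  assumes "cg p q" "commutes z p" "z \<in> FA L"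
  shows "commutes z q"
  unfolding commutes_def
proof (rule ucong_trans[OF ucong_trans])
  show "cg (q * z) (p * z)" using assms ucong_sym by (intro ucong_mult_right) auto
  show "cg (p * z) (z * p)" using assms(2) by (simp add: commutes_def)
  show "cg (z * p) (z * q)" using assms by (intro ucong_mult_left)
qed

lemma ucong_gen_expand:
  fixes A :: "'a::field_char_0 mat"
  assumes "A \<in> L"
  shows "cg (fa_gen A) (\<Sum>b\<in>idx. fa_scal (coord b A) * fa_gen (emat b))"
proof -
  have "S \<subseteq> idx \<Longrightarrow> (\<lambda>h k. \<Sum>b\<in>S. coord b A * emat b h k) \<in> L \<and>
    cg (fa_gen (\<lambda>h k. \<Sum>b\<in>S. coord b A * emat b h k)) (\<Sum>b\<in>S. fa_scal (coord b A) * fa_gen (emat b))"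
    if "finite S" for S
    using that
  proof induction
    case empty
    show ?case by (simp add: zero_in_L ucong_gen_zero)
  next
    case (insert b S)
    let ?R = "\<lambda>h k. \<Sum>b\<in>S. coord b A * emat b h k"
    have e: "(\<lambda>h k. \<Sum>b\<in>insert b S. coord b A * emat b h k) = madd (msmult (coord b A) (emat b)) ?R"
      using insert by (simp add: madd_def msmult_def)
    have bL: "emat b \<in> L" using insert.prems by (intro emat_in_L) auto
    have R: "?R \<in> L" "cg (fa_gen ?R) (\<Sum>b\<in>S. fa_scal (coord b A) * fa_gen (emat b))"
      using insert by auto
    have "cg (fa_gen (madd (msmult (coord b A) (emat b)) ?R))
        (fa_gen (msmult (coord b A) (emat b)) + fa_gen ?R)"
      by (intro ucong_madd msmult_in_L bL R)
    moreover have "cg (fa_gen (msmult (coord b A) (emat b)) + fa_gen ?R)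
        (fa_scal (coord b A) * fa_gen (emat b) + (\<Sum>b\<in>S. fa_scal (coord b A) * fa_gen (emat b)))"
      by (intro ucong_add ucong_msmult bL R)
    ultimately show ?case
      unfolding e using insert.hyps madd_in_L[OF msmult_in_L[OF bL] R(1)]
      by (auto intro: ucong_trans)
  qed
  from this[OF finite_idx subset_refl] show ?thesis
    unfolding L_expand[OF assms, symmetric] by blast
qed

lemma fa_gen_emat: "b \<in> idx \<Longrightarrow> fa_gen (emat b) = (case b of (i, j, r) \<Rightarrow> ee i j r)"
  by (cases b) (simp add: emat_def ee_def)

lemma uea_center_iff:
  "u \<in> uea_center N L \<longleftrightarrow> u \<in> FA L \<and> (\<forall>A\<in>L. commutes u (fa_gen A))"
proof
  assume u: "u \<in> uea_center N L"
  then show "u \<in> FA L \<and> (\<forall>A\<in>L. commutes u (fa_gen A))"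
    by (auto simp: uea_center_def commutes_def ucong_def fa_mult_eq_times intro: fa_gen_in_FA)
next
  assume u: "u \<in> FA L \<and> (\<forall>A\<in>L. commutes u (fa_gen A))"
  have "commutes u v" if v: "v \<in> FA L" for v
  proof -
    have "commutes u (prod_list (map fa_gen w))" if "set w \<subseteq> L" for w
      using that
    proof (induction w)
      case Nil
      show ?case by (simp add: commutes_def)
    next
      case (Cons A w)
      then show ?case using u by (auto intro!: commutes_mult fa_gen_in_FA prod_list_in_FA)
    qed
    then have "commutes u (\<Sum>w\<in>Poly_Mapping.keys v. fa_scal (Poly_Mapping.lookup v w) * prod_list (map fa_gen w))"
    proof (intro commutes_sum commutes_mult commutes_scal fa_scal_in_FA prod_list_in_FA)
      fix w assume "w \<in> Poly_Mapping.keys v"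
      then have w: "set w \<subseteq> L" using v by (simp add: FA_def)
      then show "commutes u (prod_list (map fa_gen w))" by fact
      show "p \<in> FA L" if "p \<in> set (map fa_gen w)" for p
        using that w by (auto intro: fa_gen_in_FA)
    qed
    also have "(\<Sum>w\<in>Poly_Mapping.keys v. fa_scal (Poly_Mapping.lookup v w) * prod_list (map fa_gen w)) = v"
      unfolding single_eq_prod_list[symmetric] fa_scal_times_single mult_1_right
      by (rule poly_mapping_sum_single[symmetric])
    finally show ?thesis .
  qed
  with u show "u \<in> uea_center N L"
    by (simp add: uea_center_def commutes_def ucong_def fa_mult_eq_times)
qed

end

section \<open>Monotone parts and their decreasing order\<close>

locale sorted_diagram = diagram +
  assumes mono: "sorted (rev lam) \<or> sorted lam"
begin

text \<open>The position in the order of decreasing parts: the identity or the reversal, hence an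
  involution of \<open>{1..n}\<close>.\<close>

definition dpos :: "nat \<Rightarrow> nat" where
  "dpos i = (if sorted (rev lam) then i else Suc n - i)"

text \<open>The diagram with the same parts in decreasing order; the invariant degree of
  \<open>r\<close> is the row of box \<open>r\<close> in it.\<close>

definition dlam :: "nat list" where
  "dlam = (if sorted (rev lam) then lam else rev lam)"

lemma dpos_in: "i \<in> {1..n} \<Longrightarrow> dpos i \<in> {1..n}"
  by (auto simp: dpos_def)

lemma dpos_dpos: "i \<in> {1..n} \<Longrightarrow> dpos (dpos i) = i"
  by (auto simp: dpos_def)

lemma dpos_inj: "i \<in> {1..n} \<Longrightarrow> j \<in> {1..n} \<Longrightarrow> dpos i = dpos j \<longleftrightarrow> i = j"
  using dpos_dpos by metis

lemma part_antimono:
  assumes "i \<in> {1..n}" "j \<in> {1..n}" "dpos i \<le> dpos j"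
  shows "part j \<le> part i"
proof (cases "sorted (rev lam)")
  case True
  then show ?thesis using assms sorted_rev_nth_mono[of lam "i - 1" "j - 1"] by (auto simp: dpos_def lam_at_def)
next
  case False
  then have "sorted lam" using mono by simp
  moreover have "j \<le> i" using assms False by (auto simp: dpos_def)
  ultimately show ?thesis using assms sorted_nth_mono[of lam "j - 1" "i - 1"] by (auto simp: lam_at_def)
qed

lemma dlam_at: "i \<in> {1..n} \<Longrightarrow> lam_at dlam i = part (dpos i)"
  by (auto simp: dlam_def dpos_def lam_at_def rev_nth)

lemma length_dlam: "length dlam = n"
  by (simp add: dlam_def)

sublocale D: diagram dlam
  using parts_pos by unfold_locales (auto simp: dlam_def)

lemma Nsz_dlam: "Nsz dlam = N"
  by (simp add: Nsz_def dlam_def)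

lemma dseq_eq: "dseq lam r = row dlam r"
  by (simp add: dseq_def dlam_def)

lemma pre_dlam: "d \<in> {1..Suc n} \<Longrightarrow> pre dlam d = (\<Sum>i\<in>{1..<d}. part (dpos i))"
proof (induction d)
  case (Suc d)
  show ?case
  proof (cases "d = 0")
    case False
    then have "pre dlam (Suc d) = pre dlam d + lam_at dlam d"
      using Suc.prems by (intro D.pre_Suc) (auto simp: length_dlam)
    then show ?thesis using Suc False dlam_at[of d] by (simp add: atLeastLessThanSuc)
  qed (simp add: pre_def)
qed simp

lemma dseq_cases:
  assumes "r \<in> {1..N}"
  obtains d c where "d = dseq lam r" "d \<in> {1..n}" "c \<in> {1..part (dpos d)}" "r = pre dlam d + c"
proof -
  from assms obtain d c where dc: "d \<in> {1..n}" "c \<in> {1..lam_at dlam d}" "r = pre dlam d + c"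
    using D.box_ex[of r] by (auto simp: Nsz_dlam length_dlam)
  then have "dseq lam r = d" unfolding dseq_eq using D.row_box[of d c] by (simp add: length_dlam)
  with dc that[of d c] show thesis by (simp add: dlam_at)
qed

lemma pre_dlam_ge:
  assumes "d \<in> {1..Suc n}"
  shows "d - 1 \<le> pre dlam d"
proof -
  have "d - 1 = (\<Sum>i\<in>{1..<d}. 1)" by simp
  also have "\<dots> \<le> (\<Sum>i\<in>{1..<d}. part (dpos i))"
  proof (rule sum_mono)
    fix i assume "i \<in> {1..<d}"
    then have "dpos i \<in> {1..n}" using assms by (intro dpos_in) auto
    from part_pos[OF this] show "1 \<le> part (dpos i)" by simp
  qed
  finally show ?thesis by (simp only: pre_dlam[OF assms])
qed

lemma dseq_le:
  assumes "r \<in> {1..N}"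
  shows "dseq lam r \<le> r"
proof -
  obtain d c where "d = dseq lam r" "d \<in> {1..n}" "c \<in> {1..part (dpos d)}" "r = pre dlam d + c"
    by (rule dseq_cases[OF assms])
  then show ?thesis using pre_dlam_ge[of d] by auto
qed

text \<open>The \<open>d - 1\<close> largest parts come first in \<open>dlam\<close>, and
  \<open>pre dlam d\<close> is their sum.\<close>

lemma sum_part_le:
  assumes "J \<subseteq> {1..n}" "Suc (card J) = d"
  shows "sum part J \<le> pre dlam d"
proof -
  have inj: "inj_on dpos J" using assms(1) dpos_inj by (auto simp: inj_on_def subset_iff)
  have "sum part J = sum (\<lambda>j. part (dpos j)) (dpos ` J)"
    unfolding sum.reindex[OF inj] using assms(1) dpos_dpos by (intro sum.cong) (auto simp: subset_iff)
  also have "\<dots> \<le> sum (\<lambda>j. part (dpos j)) {1..card (dpos ` J)}"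
    using assms(1) dpos_in dpos_dpos by (intro sum_antimono_le[of n] part_antimono) auto
  also have "card (dpos ` J) = card J" by (rule card_image[OF inj])
  also have "{1..card J} = {1..<d}" using assms(2) by auto
  also have "sum (\<lambda>j. part (dpos j)) {1..<d} = pre dlam d"
    using assms card_mono[of "{1..n}" J] by (intro pre_dlam[symmetric]) auto
  finally show ?thesis .
qed

text \<open>Box \<open>r\<close> lies in row \<open>d\<close> of the decreasing diagram, so
  \<open>r\<close> exceeds the sum of the \<open>d - 1\<close> largest parts. Taking 1 off each of
  \<open>d - 1\<close> parts and \<open>d\<close> off \<open>r\<close> turns this into the weak
  inequality required.\<close>

lemma extremal_dseq:
  assumes "r \<in> {1..N}"
  shows "extremal (dseq lam r) (r - dseq lam r)"
  unfolding extremal_def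
proof (intro allI impI)
  fix J assume J: "J \<subseteq> {1..n}" "Suc (card J) = dseq lam r"
  have "sum part J = (\<Sum>k\<in>J. (part k - 1) + 1)"
    using J(1) part_pos by (intro sum.cong) (auto simp: subset_iff)
  also have "\<dots> = (\<Sum>k\<in>J. part k - 1) + card J" by (simp only: sum.distrib) simp
  finally have "sum part J = (\<Sum>k\<in>J. part k - 1) + card J" .
  moreover obtain d c where "d = dseq lam r" "d \<in> {1..n}" "c \<in> {1..part (dpos d)}" "r = pre dlam d + c"
    by (rule dseq_cases[OF assms])
  moreover from this have "1 \<le> c" "sum part J \<le> pre dlam d" using sum_part_le[OF J] by simp_all
  moreover note J(2)
  ultimately have "(\<Sum>k\<in>J. part k - 1) + dseq lam r \<le> r" by linarith
  then show "(\<Sum>k\<in>J. part k - 1) \<le> r - dseq lam r" by (rule add_le_imp_le_diff)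
qed

lemma zgen_zz: "r \<in> {1..N} \<Longrightarrow> zgen lam r = zz (dseq lam r) (r - dseq lam r)"
  by (rule zgen_eq_zz[OF refl dseq_le extremal_dseq])

text \<open>Monotonicity of \<open>lam\<close> makes the neighbours' root vectors generate the centralizer.\<close>

lemma commutes_ee:
  fixes z :: "'a::field_char_0 mat list \<Rightarrow>\<^sub>0 'a"
  assumes z: "z \<in> FA L"
    and adj: "\<And>i j r. (i, j, r) \<in> idx \<Longrightarrow> i = j \<or> j = Suc i \<or> i = Suc j \<Longrightarrow> commutes z (ee i j r)"
  shows "(i, j, r) \<in> idx \<Longrightarrow> commutes z (ee i j r)"
proof (induction "(i - j) + (j - i)" arbitrary: i j r rule: less_induct)
  case less
  note ij = less.prems
  show ?case
  proof (cases "i = j \<or> j = Suc i \<or> i = Suc j")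
    case False
    define i' where "i' = (if i < j then Suc i else i - 1)"
    \<comment> \<open>The least admissible degree for \<open>(i, i')\<close>, where
      \<open>i'\<close> is the neighbour of \<open>i\<close> on the side of \<open>j\<close>. Since
      \<open>part i'\<close> lies between \<open>part i\<close> and \<open>part j\<close>, the
      remainder \<open>r - s\<close> is admissible for \<open>(i', j)\<close>.\<close>
    define s where "s = part i' - part i"
    have i': "i' \<in> {1..n}" "i' \<noteq> j" "(i' - j) + (j - i') < (i - j) + (j - i)"
      using False ij by (auto simp: i'_def idx_def)
    have i_j: "i \<in> {1..n}" "j \<in> {1..n}" "i \<noteq> j" using ij False by (auto simp: idx_def)
    have "i \<le> i' \<and> i' \<le> j \<or> j \<le> i' \<and> i' \<le> i"
      unfolding i'_def using i_j(3) by arith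
    then have "dpos i \<le> dpos i' \<and> dpos i' \<le> dpos j \<or> dpos j \<le> dpos i' \<and> dpos i' \<le> dpos i"
    proof (cases "sorted (rev lam)")
      case False
      have "x \<le> y \<Longrightarrow> dpos y \<le> dpos x" for x y using False by (simp add: dpos_def)
      then show ?thesis using \<open>i \<le> i' \<and> i' \<le> j \<or> j \<le> i' \<and> i' \<le> i\<close> by blast
    qed (simp add: dpos_def)
    then have "part i' \<le> part i \<and> part j \<le> part i' \<or> part i' \<le> part j \<and> part i \<le> part i'"
      using part_antimono i'(1) i_j(1,2) by blast
    moreover have "part j \<le> r + part i" "r < part j" using ij by (auto simp: idx_def)
    ultimately have "s \<le> r" "part i' \<le> s + part i" "s < part i'" "part j \<le> r - s + part i'" "r - s < part j"
      using part_pos[OF i_j(1)] part_pos[OF i'(1)] by (auto simp: s_def)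
    then have v: "s \<le> r" "(i, i', s) \<in> idx" "(i', j, r - s) \<in> idx"
      using i'(1) i_j by (auto simp: idx_def min_def)
    \<comment> \<open>As \<open>i\<close> and \<open>j\<close> differ, only one of the two terms of
      the bracket is present.\<close>
    have c1: "cg (ee i i' s * ee i' j (r - s) - ee i' j (r - s) * ee i i' s) (ee i j r :: 'a mat list \<Rightarrow>\<^sub>0 'a)"
      using ucong_comm_ee[OF v(2) i'(1) i_j(2) disjI1[OF v(3)], where 'a = 'a] i_j v(1) by simp
    have c2: "commutes z (ee i i' s)"
      using v(2) False by (intro adj) (auto simp: i'_def)
    have c3: "commutes z (ee i' j (r - s))"
      by (rule less.hyps[OF i'(3) v(3)])
    show ?thesis
      by (rule commutes_cong[OF c1 commutes_diff[OF commutes_mult[OF c2 c3 ee_in_FA ee_in_FA]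
        commutes_mult[OF c3 c2 ee_in_FA ee_in_FA]] z])
  qed (use adj ij in blast)
qed

lemma zgen_in_center:
  assumes "r \<in> {1..N}"
  shows "(zgen lam r :: 'a::field_char_0 mat list \<Rightarrow>\<^sub>0 'a) \<in> uea_center N L"
proof -
  let ?z = "zgen lam r :: 'a mat list \<Rightarrow>\<^sub>0 'a"
  have z: "?z = zz (dseq lam r) (r - dseq lam r)" by (rule zgen_zz[OF assms])
  have FA: "?z \<in> FA L" unfolding z by (rule zz_in_FA)
  have com: "commutes ?z (ee i j s)" if ij: "(i, j, s) \<in> idx" "i = j \<or> j = Suc i \<or> i = Suc j" for i j s
  proof -
    interpret C: zz_commutator lam i j s "dseq lam r" "r - dseq lam r"
      by unfold_locales (rule ij, rule extremal_dseq[OF assms])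
    have "cg (ee i j s * ?z - ?z * ee i j s) 0"
    proof (cases "i = j")
      case True
      then show ?thesis unfolding z by (rule C.diagonal_case)
    next
      case False
      then interpret A: zz_adjacent lam i j s "dseq lam r" "r - dseq lam r"
        using ij by unfold_locales auto
      show ?thesis unfolding z by (rule A.adjacent_case)
    qed
    then show ?thesis by (simp add: commutes_def ucong_def)
  qed
  have "commutes ?z (fa_gen A)" if A: "A \<in> L" for A
  proof (rule commutes_cong[OF ucong_sym[OF ucong_gen_expand[OF A]] _ FA])
    show "commutes ?z (\<Sum>b\<in>idx. fa_scal (coord b A) * fa_gen (emat b))"
    proof (intro commutes_sum commutes_mult commutes_scal fa_scal_in_FA fa_gen_in_FA emat_in_L)
      fix b assume "b \<in> idx"
      then show "commutes ?z (fa_gen (emat b))"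
        by (auto simp: fa_gen_emat split: prod.splits intro!: commutes_ee[OF FA com])
    qed
  qed
  with FA show ?thesis by (simp add: uea_center_iff)
qed

end

section \<open>Matrix coefficients as functionals and the symbol of an element\<close>

lemma mmul_assoc: "mmul N (mmul N A B) C = mmul N A (mmul N B C)"
proof (intro HOL.ext)
  fix h k
  show "mmul N (mmul N A B) C h k = mmul N A (mmul N B C) h k"
    unfolding mmul_def sum_distrib_left sum_distrib_right
    by (subst sum.swap) (simp add: mult.assoc)
qed

lemma fa_scal_sum: "fa_scal (sum f A) = (\<Sum>i\<in>A. fa_scal (f i))"
  by (induction A rule: infinite_finite_induct) (simp_all add: fa_scal_0 fa_scal_add)

definition msum :: "('i \<Rightarrow> 'a::comm_ring_1) \<Rightarrow> ('i \<Rightarrow> 'a mat) \<Rightarrow> 'i set \<Rightarrow> 'a mat" where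
  "msum c M S = (\<lambda>h k. \<Sum>b\<in>S. c b * M b h k)"

lemma mmul_msum_right: "mmul N X (msum c M S) h k = (\<Sum>b\<in>S. c b * mmul N X (M b) h k)"
  unfolding mmul_def msum_def sum_distrib_left
  by (subst sum.swap) (simp add: mult_ac)

lemma mmul_msum_left: "mmul N (msum c M S) X h k = (\<Sum>b\<in>S. c b * mmul N (M b) X h k)"
  unfolding mmul_def msum_def sum_distrib_left sum_distrib_right
  by (subst sum.swap) (simp add: mult_ac)

lemma mbracket_msum_right: "mbracket N X (msum c M S) h k = (\<Sum>b\<in>S. c b * mbracket N X (M b) h k)"
  unfolding mbracket_def mmul_msum_right mmul_msum_left by (simp add: right_diff_distrib sum_subtractf)

context diagram
begin

text \<open>A projection onto \<open>L\<close> through coordinates. Words may contain letters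
  outside \<open>L\<close>; letting functionals see only the coordinates of a letter keeps
  statements about them valid on all words.\<close>

definition proj :: "'a::comm_ring_1 mat \<Rightarrow> 'a mat" where
  "proj A = msum (\<lambda>b. coord b A) emat idx"

lemma proj_L: "A \<in> L \<Longrightarrow> proj A = A"
  unfolding proj_def msum_def by (rule L_expand[symmetric])

lemma coord_madd: "coord b (madd A B) = coord b A + coord b B"
  by (simp add: coord_def madd_def split: prod.splits)

lemma coord_msmult: "coord b (msmult c A) = c * coord b A"
  by (simp add: coord_def msmult_def split: prod.splits)

lemma proj_madd: "proj (madd A B) h k = proj A h k + proj B h k"
  by (simp add: proj_def msum_def coord_madd distrib_right sum.distrib)

lemma proj_msmult: "proj (msmult c A) h k = c * proj A h k"
  by (simp add: proj_def msum_def coord_msmult sum_distrib_left mult_ac)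

lemma mbracket_in_L:
  assumes "A \<in> L" "B \<in> L"
  shows "mbracket N A B \<in> L"
proof -
  have g: "A \<in> glN N" "B \<in> glN N" and
    c: "mmul N A (nil_e lam) = mmul N (nil_e lam) A" "mmul N B (nil_e lam) = mmul N (nil_e lam) B"
    using assms by (simp_all add: centralizer_def)
  have eq: "mmul N (mmul N X Y) (nil_e lam) = mmul N (nil_e lam) (mmul N X Y)"
    if "mmul N X (nil_e lam) = mmul N (nil_e lam) X" "mmul N Y (nil_e lam) = mmul N (nil_e lam) Y" for X Y :: "'a mat"
  proof -
    have "mmul N (mmul N X Y) (nil_e lam) = mmul N X (mmul N (nil_e lam) Y)"
      by (simp only: mmul_assoc that(2))
    also have "\<dots> = mmul N (nil_e lam) (mmul N X Y)"
      by (simp only: mmul_assoc[symmetric] that(1))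
    finally show ?thesis .
  qed
  have d: "mmul N (mbracket N A B) C = (\<lambda>h k. mmul N (mmul N A B) C h k - mmul N (mmul N B A) C h k)"
    "mmul N C (mbracket N A B) = (\<lambda>h k. mmul N C (mmul N A B) h k - mmul N C (mmul N B A) h k)" for C
    unfolding mbracket_def mmul_def[of N "\<lambda>h k. mmul N A B h k - mmul N B A h k"] mmul_def[of N C]
      mmul_def[of N "mmul N A B" C] mmul_def[of N "mmul N B A" C]
    by (simp_all add: left_diff_distrib right_diff_distrib sum_subtractf)
  have "mbracket N A B \<in> glN N"
    using mmul_in_glN[OF g] mmul_in_glN[OF g(2,1)] by (auto simp: glN_def mbracket_def)
  then show ?thesis
    unfolding centralizer_def mem_Collect_eq d eq[OF c] eq[OF c(2,1)] by simp
qed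

definition idm :: "'a::comm_ring_1 mat" where
  "idm = (\<lambda>h k. if h = k then 1 else 0)"

fun wmat :: "'a::comm_ring_1 mat list \<Rightarrow> 'a mat" where
  "wmat [] = idm"
| "wmat (x # w) = mmul N (proj x) (wmat w)"

lemma wmat_madd: "wmat (u @ madd x y # v) h k = wmat (u @ x # v) h k + wmat (u @ y # v) h k"
proof (induction u arbitrary: h k)
  case Nil
  show ?case by (simp add: mmul_def proj_madd distrib_right sum.distrib)
next
  case (Cons z u)
  show ?case unfolding append_Cons wmat.simps mmul_def Cons by (simp add: distrib_left sum.distrib)
qed

lemma wmat_msmult: "wmat (u @ msmult c x # v) h k = c * wmat (u @ x # v) h k"
proof (induction u arbitrary: h k)
  case Nil
  show ?case by (simp add: mmul_def proj_msmult sum_distrib_left mult_ac)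
next
  case (Cons z u)
  show ?case unfolding append_Cons wmat.simps mmul_def Cons by (simp add: sum_distrib_left mult_ac)
qed

lemma mmul_mbracket: "mmul N (mbracket N x y) V h k = mmul N x (mmul N y V) h k - mmul N y (mmul N x V) h k"
  unfolding mmul_assoc[symmetric] unfolding mbracket_def mmul_def[of N "\<lambda>h k. mmul N x y h k - mmul N y x h k"]
    mmul_def[of N "mmul N x y" V] mmul_def[of N "mmul N y x" V]
  by (simp add: left_diff_distrib sum_subtractf)

lemma wmat_mbracket:
  assumes "x \<in> L" "y \<in> L"
  shows "wmat (u @ x # y # v) h k - wmat (u @ y # x # v) h k = wmat (u @ mbracket N x y # v) h k"
proof (induction u arbitrary: h k)
  case Nil
  show ?case using assms by (simp add: proj_L mbracket_in_L mmul_mbracket)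
next
  case (Cons z u)
  show ?case
    unfolding append_Cons wmat.simps mmul_def Cons[symmetric] by (simp add: right_diff_distrib sum_subtractf)
qed

definition Theta :: "(nat \<times> nat \<times> nat \<Rightarrow> 'a) \<Rightarrow> 'a::comm_ring_1 mat \<Rightarrow> 'a" where
  "Theta \<theta> A = (\<Sum>b\<in>idx. \<theta> b * coord b A)"

text \<open>On one letter this is the linear form given by \<open>\<theta>\<close>; on longer words
  the same form is applied to the matrix product, so the bracket relation holds at every length. The
  value 0 at the empty word gives order at least 1.\<close>

definition hat :: "(nat \<times> nat \<times> nat \<Rightarrow> 'a) \<Rightarrow> ('a::comm_ring_1 mat, 'a) wfun" where
  "hat \<theta> = Wfun (\<lambda>w. if w = [] then 0 else Theta \<theta> (wmat w))"

lemma ap_hat: "ap (hat \<theta>) w = (if w = [] then 0 else Theta \<theta> (wmat w))"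
  unfolding hat_def by (subst Wfun_inverse) auto

lemma Theta_linear:
  "(\<And>h k. A h k = B h k + C h k) \<Longrightarrow> Theta \<theta> A = Theta \<theta> B + Theta \<theta> C"
  "(\<And>h k. A h k = c * B h k) \<Longrightarrow> Theta \<theta> A = c * Theta \<theta> B"
  "(\<And>h k. A h k = B h k - C h k) \<Longrightarrow> Theta \<theta> A = Theta \<theta> B - Theta \<theta> C"
  unfolding Theta_def coord_def
  by (simp_all add: distrib_left right_diff_distrib sum.distrib sum_subtractf sum_distrib_left mult_ac
      case_prod_beta)

lemma good_hat: "good N L (hat \<theta>)"
proof (rule goodI)
  fix u v :: "'a mat list" and x y :: "'a mat" and c
  assume x: "x \<in> L"
  show "ap (hat \<theta>) (u @ msmult c x # v) = c * ap (hat \<theta>) (u @ x # v)"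
    unfolding ap_hat by (simp add: Theta_linear(2)[OF wmat_msmult])
  assume y: "y \<in> L"
  show "ap (hat \<theta>) (u @ madd x y # v) = ap (hat \<theta>) (u @ x # v) + ap (hat \<theta>) (u @ y # v)"
    unfolding ap_hat by (simp add: Theta_linear(1)[OF wmat_madd])
  show "ap (hat \<theta>) (u @ x # y # v) - ap (hat \<theta>) (u @ y # x # v) = ap (hat \<theta>) (u @ mbracket N x y # v)"
    unfolding ap_hat by (simp add: Theta_linear(3)[OF wmat_mbracket[OF x y, symmetric]])
qed

lemma coord_mmul_idm: "b \<in> idx \<Longrightarrow> coord b (mmul N A idm) = coord b A"
proof -
  assume b: "b \<in> idx"
  obtain i j r where e: "b = (i, j, r)" by (cases b)
  then have "box j (1 + r) \<in> {1..N}" using b by (intro box_range) (auto simp: idx_def)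
  moreover have "mmul N A idm h k = (\<Sum>l\<in>{1..N}. if l = k then A h l else 0)" for h k
    unfolding mmul_def idm_def by (rule sum.cong) auto
  ultimately show ?thesis by (simp add: e coord_def del: atLeastAtMost_iff)
qed

lemma coord_proj: "b \<in> idx \<Longrightarrow> coord b (proj A) = coord b A"
proof -
  assume b: "b \<in> idx"
  have "coord b (proj A) = (\<Sum>b'\<in>idx. coord b' A * coord b (emat b'))"
    by (simp add: coord_def proj_def msum_def split: prod.splits)
  also have "\<dots> = (\<Sum>b'\<in>idx. if b = b' then coord b' A else 0)"
    by (rule sum.cong) (simp_all add: coord_emat b)
  finally show ?thesis using b by (simp add: finite_idx)
qed

lemma ap_hat_single: "ap (hat \<theta>) [A] = Theta \<theta> A"
  by (simp add: ap_hat Theta_def coord_mmul_idm coord_proj)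

lemma ord_ge_hat: "ord_ge 1 (hat \<theta>)"
  by (simp add: ord_ge_def ap_hat)

lemma hat_expand: "hat \<theta> = (\<Sum>b\<in>idx. wcst (\<theta> b) * hat (\<lambda>b'. if b' = b then 1 else 0))"
proof (rule wfun_eqI)
  fix w
  have "Theta (\<lambda>b'. if b' = b then 1 else 0) A = coord b A" if "b \<in> idx" for b and A :: "'a mat"
  proof -
    have "Theta (\<lambda>b'. if b' = b then 1 else 0) A = (\<Sum>b'\<in>idx. if b' = b then coord b A else 0)"
      unfolding Theta_def by (rule sum.cong) auto
    then show ?thesis using that by (simp add: finite_idx)
  qed
  then show "ap (hat \<theta>) w = ap (\<Sum>b\<in>idx. wcst (\<theta> b) * hat (\<lambda>b'. if b' = b then 1 else 0)) w"
    by (simp add: ap_sum ap_hat Theta_def[of \<theta>])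
qed

lemma hat_add: "hat (\<lambda>b. \<theta> b + \<theta>' b) = hat \<theta> + hat \<theta>'"
  by (rule wfun_eqI) (simp add: ap_hat Theta_def distrib_right sum.distrib)

lemma hat_scale: "hat (\<lambda>b. c * \<theta> b) = wcst c * hat \<theta>"
  by (rule wfun_eqI) (simp add: ap_hat Theta_def sum_distrib_left mult_ac)

text \<open>The action on linear forms dual to the bracket: the coadjoint action up to sign.\<close>

definition act :: "'a::comm_ring_1 mat \<Rightarrow> (nat \<times> nat \<times> nat \<Rightarrow> 'a) \<Rightarrow> nat \<times> nat \<times> nat \<Rightarrow> 'a" where
  "act x \<theta> b = Theta \<theta> (mbracket N x (emat b))"

text \<open>On a single letter \<open>y\<close> the two matrix products with \<open>x\<close> differ
  by the bracket. The discrepancy on longer words has order two and leaves symbols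
  unaffected.\<close>

lemma ord_ge_adiff_hat:
  fixes x :: "'a::comm_ring_1 mat"
  assumes x: "x \<in> L"
  shows "ord_ge 2 (adiff x (hat \<theta>) - hat (act x \<theta>))"
  unfolding ord_ge_def
proof (intro allI impI)
  fix w :: "'a mat list" assume "length w < 2"
  then consider "w = []" | y where "w = [y]"
    by (cases w; cases "tl w") auto
  then show "ap (adiff x (hat \<theta>) - hat (act x \<theta>)) w = 0"
  proof cases
    case 2
    have "Theta \<theta> (wmat [x, y]) - Theta \<theta> (wmat [y, x]) = Theta \<theta> (mmul N (mbracket N x (proj y)) idm)"
      using proj_L[OF x] mmul_mbracket[of x "proj y" idm]
      by (intro Theta_linear(3)[symmetric]) simp
    also have "\<dots> = Theta \<theta> (mbracket N x (proj y))"
      by (simp add: Theta_def coord_mmul_idm)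
    also have "\<dots> = (\<Sum>b\<in>idx. coord b y * Theta \<theta> (mbracket N x (emat b)))"
    proof -
      have "coord c (mbracket N x (proj y)) = (\<Sum>b\<in>idx. coord b y * coord c (mbracket N x (emat b)))" for c
        unfolding coord_def proj_def by (cases c) (simp add: mbracket_msum_right)
      then show ?thesis
        unfolding Theta_def sum_distrib_left by (subst sum.swap) (simp add: sum_distrib_left mult_ac)
    qed
    also have "\<dots> = Theta (act x \<theta>) y"
      unfolding act_def Theta_def[of "\<lambda>b. Theta \<theta> (mbracket N x (emat b))"] by (simp add: mult.commute)
    finally have "Theta \<theta> (wmat [x, y]) - Theta \<theta> (wmat [y, x]) = Theta (act x \<theta>) y" .
    then show ?thesis
      using 2 ap_hat_single[of "act x \<theta>" y] by (simp add: ap_adiff ap_hat)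
  qed (simp add: ap_adiff ap_hat)
qed

section \<open>Elements with vanishing symbol have smaller degree\<close>

text \<open>It is the class modulo the ideal that has a representative with short words;
  \<open>p\<close> itself may contain long ones.\<close>

definition low :: "nat \<Rightarrow> ('a::field_char_0 mat list \<Rightarrow>\<^sub>0 'a) \<Rightarrow> bool" where
  "low d p \<longleftrightarrow> (\<exists>r\<in>FA L. (\<forall>w\<in>Poly_Mapping.keys r. length w < d) \<and> cg p r)"

lemma lowI: "p \<in> FA L \<Longrightarrow> (\<And>w. w \<in> Poly_Mapping.keys p \<Longrightarrow> length w < d) \<Longrightarrow> low d p"
  unfolding low_def by (intro bexI[of _ p]) auto

lemma low_0: "low d 0"
  by (rule lowI) (auto simp: zero_in_FA)

lemma low_add: "low d p \<Longrightarrow> low d q \<Longrightarrow> low d (p + q)"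
proof -
  assume "low d p" "low d q"
  then obtain r r' where r: "r \<in> FA L" "\<forall>w\<in>Poly_Mapping.keys r. length w < d" "cg p r"
    "r' \<in> FA L" "\<forall>w\<in>Poly_Mapping.keys r'. length w < d" "cg q r'"
    unfolding low_def by blast
  then have "\<forall>w\<in>Poly_Mapping.keys (r + r'). length w < d"
    using Poly_Mapping.keys_add[of r r'] by blast
  then show "low d (p + q)"
    unfolding low_def using r by (intro bexI[of _ "r + r'"] conjI ucong_add add_in_FA) auto
qed

lemma low_sum: "(\<And>i. i \<in> A \<Longrightarrow> low d (f i)) \<Longrightarrow> low d (sum f A)"
  by (induction A rule: infinite_finite_induct) (simp_all add: low_0 low_add)

lemma low_cong: "cg p q \<Longrightarrow> low d q \<Longrightarrow> low d p"
  unfolding low_def by (blast intro: ucong_trans)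

lemma low_mult:
  assumes "low d p" "q \<in> FA L" "len_le e q"
  shows "low (e + d) (q * p)"
proof -
  obtain r where r: "r \<in> FA L" "\<forall>w\<in>Poly_Mapping.keys r. length w < d" "cg p r"
    using assms(1) by (auto simp: low_def)
  have "low (e + d) (q * r)"
  proof (rule lowI)
    fix w assume "w \<in> Poly_Mapping.keys (q * r)"
    then obtain u v where "w = u + v" "u \<in> Poly_Mapping.keys q" "v \<in> Poly_Mapping.keys r"
      using keys_mult[of q r] by blast
    then show "length w < e + d"
      using r(2) assms(3) by (auto simp: len_le_def plus_list_def intro!: add_le_less_mono)
  qed (intro mult_in_FA assms(2) r(1))
  then show ?thesis by (rule low_cong[OF ucong_mult_left[OF r(3) assms(2)]])
qed

lemma low_scal: "low d p \<Longrightarrow> low d (fa_scal c * p)"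
  using low_mult[of d p "fa_scal c" 0] by (simp add: fa_scal_in_FA len_le_scal)

lemma low_diff_trans: "low d (p - q) \<Longrightarrow> low d (q - r) \<Longrightarrow> low d (p - r)"
  using low_add[of d "p - q" "q - r"] by simp

section \<open>Monomials in the basis, up to shorter words\<close>

definition mon :: "(nat \<times> nat \<times> nat) list \<Rightarrow> ('a::field_char_0 mat list \<Rightarrow>\<^sub>0 'a)" where
  "mon bs = prod_list (map (\<lambda>b. fa_gen (emat b)) bs)"

lemma mon_Cons: "mon (b # bs) = fa_gen (emat b) * mon bs"
  by (simp add: mon_def)

lemma mon_single: "mon bs = Poly_Mapping.single (map emat bs) 1"
  by (simp add: mon_def single_eq_prod_list o_def)

lemma mon_in_FA: "set bs \<subseteq> idx \<Longrightarrow> mon bs \<in> FA L"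
  unfolding mon_single by (intro single_in_FA) (auto intro: emat_in_L)

definition blists :: "nat \<Rightarrow> (nat \<times> nat \<times> nat) list set" where
  "blists d = {bs. set bs \<subseteq> idx \<and> length bs = d}"

lemma finite_blists: "finite (blists d)"
  unfolding blists_def by (rule finite_lists_length_eq[OF finite_idx])

lemma sum_blists_Suc: "(\<Sum>bs\<in>blists (Suc d). f bs) = (\<Sum>b\<in>idx. \<Sum>bs\<in>blists d. f (b # bs))"
proof -
  have "(\<Sum>bs\<in>blists (Suc d). f bs) = (\<Sum>(b, bs)\<in>idx \<times> blists d. f (b # bs))"
    by (rule sum.reindex_bij_witness[where i = "\<lambda>(b, bs). b # bs" and j = "\<lambda>bs. (hd bs, tl bs)"])
      (auto simp: blists_def length_Suc_conv)
  then show ?thesis by (simp add: sum.cartesian_product)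
qed

lemma word_expand:
  "set w \<subseteq> (L :: 'a::field_char_0 mat set) \<Longrightarrow>
    \<exists>c. cg (Poly_Mapping.single w 1) (\<Sum>bs\<in>blists (length w). fa_scal (c bs) * mon bs)"
proof (induction w)
  case Nil
  have "blists 0 = {[]}" by (auto simp: blists_def)
  then show ?case
    by (intro exI[of _ "\<lambda>_. 1"]) (simp add: mon_def fa_scal_1 fa_scal_def[symmetric])
next
  case (Cons A w)
  then obtain c where c: "cg (Poly_Mapping.single w 1) (\<Sum>bs\<in>blists (length w). fa_scal (c bs) * mon bs)"
    by auto
  have A: "A \<in> L" using Cons.prems by simp
  let ?c = "\<lambda>bs. coord (hd bs) A * c (tl bs)"
  have "cg (fa_gen A * Poly_Mapping.single w 1)
    ((\<Sum>b\<in>idx. fa_scal (coord b A) * fa_gen (emat b)) * (\<Sum>bs\<in>blists (length w). fa_scal (c bs) * mon bs))"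
    using Cons.prems
    by (intro ucong_mult ucong_gen_expand A c single_in_FA sum_in_FA mult_in_FA fa_scal_in_FA fa_gen_in_FA emat_in_L) auto
  also have "\<dots> = (\<Sum>b\<in>idx. \<Sum>bs\<in>blists (length w). fa_scal (?c (b # bs)) * mon (b # bs))"
  proof -
    have "fa_scal x * y * (fa_scal x' * y') = fa_scal (x * x') * (y * y')" for x x' and y y' :: "'a mat list \<Rightarrow>\<^sub>0 'a"
    proof -
      have "y * (fa_scal x' * y') = fa_scal x' * (y * y')"
        by (simp only: mult.assoc[symmetric] fa_scal_commute[of x' y])
      then show ?thesis by (simp only: mult.assoc fa_scal_mult)
    qed
    then show ?thesis by (simp add: sum_product mon_Cons)
  qed
  also have "\<dots> = (\<Sum>bs\<in>blists (length (A # w)). fa_scal (?c bs) * mon bs)"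
    by (simp add: sum_blists_Suc)
  finally show ?case unfolding single_Cons by (rule exI[of _ ?c])
qed

text \<open>The exchange costs a bracket, which is one letter of \<open>L\<close> in place of
  two.\<close>

lemma mon_swap:
  assumes "set (x # y # zs) \<subseteq> idx"
  shows "low (length (x # y # zs)) (mon (x # y # zs) - mon (y # x # zs) :: 'a::field_char_0 mat list \<Rightarrow>\<^sub>0 'a)"
proof -
  have xy: "(emat x :: 'a mat) \<in> L" "(emat y :: 'a mat) \<in> L" and z: "(mon zs :: 'a mat list \<Rightarrow>\<^sub>0 'a) \<in> FA L"
    using assms by (auto intro: emat_in_L mon_in_FA)
  have "(mon (x # y # zs) :: 'a mat list \<Rightarrow>\<^sub>0 'a) - mon (y # x # zs) =
      (fa_gen (emat x) * fa_gen (emat y) - fa_gen (emat y) * fa_gen (emat x)) * mon zs"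
    by (simp add: mon_Cons algebra_simps)
  moreover have "cg \<dots> (fa_gen (mbracket N (emat x) (emat y)) * mon zs)"
    by (intro ucong_mult_right ucong_bracket xy z)
  moreover have "low (length (x # y # zs)) (fa_gen (mbracket N (emat x) (emat y)) * mon zs :: 'a mat list \<Rightarrow>\<^sub>0 'a)"
    unfolding mon_single single_Cons[symmetric]
  proof (rule lowI)
    show "Poly_Mapping.single (mbracket N (emat x) (emat y) # map emat zs) (1 :: 'a) \<in> FA L"
      using assms by (intro single_in_FA) (auto intro!: mbracket_in_L emat_in_L)
  qed auto
  ultimately show ?thesis using low_cong by metis
qed

lemma mon_move:
  "set (x # ys @ zs) \<subseteq> idx \<Longrightarrow> low (Suc (length ys + length zs)) (mon (x # ys @ zs) - mon (ys @ x # zs) :: 'a::field_char_0 mat list \<Rightarrow>\<^sub>0 'a)"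
proof (induction ys)
  case Nil
  show ?case by (simp add: low_0)
next
  case (Cons y ys)
  have "low (1 + Suc (length ys + length zs)) (fa_gen (emat y) * (mon (x # ys @ zs) - mon (ys @ x # zs)) :: 'a mat list \<Rightarrow>\<^sub>0 'a)"
    using Cons by (intro low_mult len_le_gen fa_gen_in_FA emat_in_L Cons.IH) auto
  then have "low (Suc (length (y # ys) + length zs)) (mon (y # x # ys @ zs) - mon (y # ys @ x # zs) :: 'a mat list \<Rightarrow>\<^sub>0 'a)"
    by (simp add: mon_Cons right_diff_distrib)
  moreover have "low (Suc (length (y # ys) + length zs)) (mon (x # y # ys @ zs) - mon (y # x # ys @ zs) :: 'a mat list \<Rightarrow>\<^sub>0 'a)"
    using mon_swap[of x y "ys @ zs", where 'a = 'a] Cons.prems by simp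
  ultimately show ?case by (auto intro: low_diff_trans)
qed

text \<open>Locate the head of one list in the other and bring it to the front; each exchange with a
  neighbour changes the monomial by shorter words only.\<close>

lemma mon_mset:
  "mset xs = mset ys \<Longrightarrow> set xs \<subseteq> idx \<Longrightarrow> low (length xs) (mon xs - mon ys :: 'a::field_char_0 mat list \<Rightarrow>\<^sub>0 'a)"
proof (induction xs arbitrary: ys)
  case Nil
  then show ?case by (simp add: low_0)
next
  case (Cons x xs)
  have "x \<in> set ys" using Cons.prems(1) by (metis list.set_intros(1) set_mset_mset)
  then obtain y1 y2 where ys: "ys = y1 @ x # y2" by (auto simp: in_set_conv_decomp)
  have m: "mset xs = mset (y1 @ y2)" using Cons.prems(1) ys by simp
  have set: "set (x # y1 @ y2) \<subseteq> idx"
    using Cons.prems(2) mset_eq_setD[OF m] by auto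
  have len: "length xs = length y1 + length y2" using mset_eq_length[OF m] by simp
  have "low (1 + length xs) (fa_gen (emat x) * (mon xs - mon (y1 @ y2)) :: 'a mat list \<Rightarrow>\<^sub>0 'a)"
    using Cons.prems(2) by (intro low_mult Cons.IH m len_le_gen fa_gen_in_FA emat_in_L) auto
  then have "low (length (x # xs)) (mon (x # xs) - mon (x # y1 @ y2) :: 'a mat list \<Rightarrow>\<^sub>0 'a)"
    by (simp add: mon_Cons right_diff_distrib)
  moreover have "low (length (x # xs)) (mon (x # y1 @ y2) - mon ys :: 'a mat list \<Rightarrow>\<^sub>0 'a)"
    using mon_move[OF set, where 'a = 'a] len ys by simp
  ultimately show ?case by (rule low_diff_trans)
qed

section \<open>Dual monomials\<close>

abbreviation delta :: "nat \<times> nat \<times> nat \<Rightarrow> nat \<times> nat \<times> nat \<Rightarrow> 'a::field_char_0" where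
  "delta b \<equiv> \<lambda>b'. if b' = b then 1 else 0"

abbreviation dhat :: "nat \<times> nat \<times> nat \<Rightarrow> ('a::field_char_0 mat, 'a) wfun" where
  "dhat b \<equiv> hat (delta b)"

lemma ap_dhat_emat:
  assumes "b \<in> idx" "c \<in> idx"
  shows "ap (dhat c) [emat b] = (if c = b then 1 else 0 :: 'a::field_char_0)"
proof -
  have "ap (dhat c) [emat b] = (\<Sum>b'\<in>idx. if b' = c then coord c (emat b) else 0 :: 'a)"
    unfolding ap_hat_single Theta_def by (rule sum.cong) auto
  then show ?thesis using assms by (simp add: finite_idx coord_emat)
qed

lemma prod_list_remove1: "b \<in> set cs \<Longrightarrow> f b * prod_list (map f (remove1 b cs)) = prod_list (map f cs)"
  for f :: "'b \<Rightarrow> 'c::comm_monoid_mult"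
  by (induction cs) (auto simp: mult.left_commute)

text \<open>To leading order, removing the letter \<open>emat b\<close> acts as the partial
  derivative in the variable \<open>b\<close>; the count is the exponent that it brings
  down.\<close>

lemma ldiff_prod_dhat:
  fixes b :: "nat \<times> nat \<times> nat"
  assumes "b \<in> idx" "set cs \<subseteq> idx"
  shows "ord_ge (length cs) (ldiff (emat b) (prod_list (map dhat cs)) -
    of_nat (count (mset cs) b) * (prod_list (map dhat (remove1 b cs)) :: ('a::field_char_0 mat, 'a) wfun))"
  using assms(2)
proof (induction cs)
  case Nil
  show ?case by simp
next
  case (Cons c cs)
  let ?P = "\<lambda>cs. prod_list (map dhat cs) :: ('a mat, 'a) wfun" and ?x = "emat b :: 'a mat"
  let ?\<delta> = "if c = b then 1 else 0 :: ('a mat, 'a) wfun"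
  let ?k = "of_nat (count (mset cs) b) :: ('a mat, 'a) wfun"
  have "ord_ge 1 (ldiff ?x (dhat c) - ?\<delta>)"
    using ap_dhat_emat[OF assms(1), of c, where 'a = 'a] Cons.prems by (auto simp: ord_ge_def ap_1)
  then have 1: "ord_ge (1 + length cs) ((ldiff ?x (dhat c) - ?\<delta>) * ?P cs)"
    using ord_ge_prod_list[of "map dhat cs :: ('a mat, 'a) wfun list"] ord_ge_hat
    by (intro ord_ge_mult) auto
  have 2: "ord_ge (1 + length cs) (dhat c * (ldiff ?x (?P cs) - ?k * ?P (remove1 b cs)))"
    using Cons by (intro ord_ge_mult ord_ge_hat) auto
  have 3: "?\<delta> * ?P cs + dhat c * (?k * ?P (remove1 b cs)) =
    of_nat (count (mset (c # cs)) b) * ?P (remove1 b (c # cs))"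
  proof (cases "c = b")
    case True
    have "?k * (dhat b * ?P (remove1 b cs)) = ?k * ?P cs"
    proof (cases "b \<in> set cs")
      case False
      then have "count (mset cs) b = 0" by (simp add: count_mset_0_iff)
      then show ?thesis by (simp only: of_nat_0 mult_zero_left)
    qed (simp add: prod_list_remove1[of b cs dhat])
    then show ?thesis using True by (simp add: algebra_simps)
  next
    case False
    then show ?thesis by (simp add: algebra_simps)
  qed
  have "ldiff ?x (?P (c # cs)) - of_nat (count (mset (c # cs)) b) * ?P (remove1 b (c # cs)) =
    (ldiff ?x (dhat c) - ?\<delta>) * ?P cs + dhat c * (ldiff ?x (?P cs) - ?k * ?P (remove1 b cs))"
    unfolding 3[symmetric] by (simp add: ldiff_mult algebra_simps)
  then show ?case using ord_ge_add[OF 1 2] by simp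
qed

text \<open>Iterated partial derivatives leave the product of the factorials of the multiplicities
  if the multisets agree, and zero otherwise. In characteristic zero the value is nonzero exactly
  when \<open>k\<close> is.\<close>

lemma ap_prod_dhat:
  assumes "length bs = length cs" "set bs \<subseteq> idx" "set cs \<subseteq> idx"
  shows "\<exists>k. ap (prod_list (map dhat cs)) (map emat bs) = (of_nat k :: 'a::field_char_0) \<and>
    (k \<noteq> 0 \<longleftrightarrow> mset bs = mset cs)"
  using assms
proof (induction bs arbitrary: cs)
  case Nil
  then show ?case by (intro exI[of _ 1]) (simp add: ap_1)
next
  case (Cons b bs)
  let ?P = "\<lambda>cs. prod_list (map dhat cs) :: ('a mat, 'a) wfun"
  let ?R = "ldiff (emat b) (?P cs) - of_nat (count (mset cs) b) * ?P (remove1 b cs)"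
  have b: "b \<in> idx" using Cons.prems by simp
  have "ap ?R (map emat bs) = 0"
    using ldiff_prod_dhat[OF b Cons.prems(3), where 'a = 'a] Cons.prems(1) by (simp only: ord_ge_def) simp
  then have e: "ap (?P cs) (map emat (b # bs)) =
      of_nat (count (mset cs) b) * ap (?P (remove1 b cs)) (map emat bs)"
    by (simp add: of_nat_eq_wcst)
  show ?case
  proof (cases "b \<in> set cs")
    case True
    then have "length bs = length (remove1 b cs)" "set (remove1 b cs) \<subseteq> idx"
      using Cons.prems set_remove1_subset[of b cs] by (auto simp: length_remove1)
    then obtain k where k: "ap (?P (remove1 b cs)) (map emat bs) = of_nat k"
      "k \<noteq> 0 \<longleftrightarrow> mset bs = mset (remove1 b cs)"
      using Cons.IH[of "remove1 b cs"] Cons.prems by auto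
    have "mset bs = mset (remove1 b cs) \<longleftrightarrow> mset (b # bs) = mset cs"
    proof
      assume "mset (b # bs) = mset cs"
      then have "mset (remove1 b cs) = mset (b # bs) - {#b#}" by simp
      then show "mset bs = mset (remove1 b cs)" by simp
    qed (use True in simp)
    moreover have "count (mset cs) b \<noteq> 0" using True by (simp add: count_mset_0_iff)
    ultimately show ?thesis
      using e k by (intro exI[of _ "count (mset cs) b * k"]) simp
  next
    case False
    then have "count (mset cs) b = 0" by (simp add: count_mset_0_iff)
    moreover have "mset (b # bs) \<noteq> mset cs" using False by (metis list.set_intros(1) set_mset_mset)
    ultimately show ?thesis using e by (intro exI[of _ 0]) simp
  qed
qed

lemma pair_low:
  assumes "good N L f" "ord_ge d f" "low d p"
  shows "pair f p = 0"
proof -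
  obtain r where r: "\<forall>w\<in>Poly_Mapping.keys r. length w < d" "cg p r"
    using assms(3) by (auto simp: low_def)
  have "pair f r = 0"
    unfolding pair_def ext_def using r(1) assms(2) by (intro sum.neutral) (auto simp: ord_ge_def)
  moreover have "pair f (p - r) = 0"
    using good_ideal[OF assms(1)] r(2) by (simp add: ucong_def)
  ultimately show ?thesis by (simp add: pair_diff_right)
qed

text \<open>The stand-in for linear independence of ordered monomials. Modulo shorter words
  \<open>p\<close> is a combination of one monomial for each multiset of basis indices. Pairing
  these with the dual monomials gives a diagonal matrix with nonzero entries, so all coefficients
  vanish.\<close>

theorem low_of_symbol_zero:
  fixes p :: "'a::field_char_0 mat list \<Rightarrow>\<^sub>0 'a"
  assumes p: "p \<in> FA L" "len_le d p"
    and zero: "\<And>bs. bs \<in> blists d \<Longrightarrow> pair (prod_list (map dhat bs)) p = 0"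
  shows "low d p"
proof -
  define K where "K = {w\<in>Poly_Mapping.keys p. length w = d}"
  have "\<forall>w\<in>K. \<exists>c. cg (Poly_Mapping.single w 1) (\<Sum>bs\<in>blists d. fa_scal (c bs) * mon bs)"
    using word_expand p(1) by (fastforce simp: K_def FA_def)
  from bchoice[OF this] obtain cc where
    "\<forall>w\<in>K. cg (Poly_Mapping.single w 1) (\<Sum>bs\<in>blists d. fa_scal (cc w bs) * mon bs)" by blast
  then have cc: "\<And>w. w \<in> K \<Longrightarrow> cg (Poly_Mapping.single w 1) (\<Sum>bs\<in>blists d. fa_scal (cc w bs) * mon bs)"
    by blast
  define c where "c bs = (\<Sum>w\<in>K. Poly_Mapping.lookup p w * cc w bs)" for bs
  \<comment> \<open>One ordering is fixed for every multiset; any choice will do, because orderings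
    differ by shorter words only.\<close>
  define rep where "rep M = (SOME bs. mset bs = M)" for M :: "(nat \<times> nat \<times> nat) multiset"
  have rep: "mset (rep M) = M" for M unfolding rep_def by (rule someI_ex) (rule ex_mset)
  define q where "q = (\<Sum>bs\<in>blists d. fa_scal (c bs) * mon bs)"
  define q' where "q' = (\<Sum>bs\<in>blists d. fa_scal (c bs) * mon (rep (mset bs)))"
  have "low d (p - q)"
  proof -
    have fin: "finite K" by (simp add: K_def)
    define A R where "A = (\<Sum>w\<in>K. fa_scal (Poly_Mapping.lookup p w) * Poly_Mapping.single w 1)"
      and "R = (\<Sum>w\<in>Poly_Mapping.keys p - K. Poly_Mapping.single w (Poly_Mapping.lookup p w))"
    have "p = (\<Sum>w\<in>K. fa_scal (Poly_Mapping.lookup p w) * Poly_Mapping.single w 1) +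
      (\<Sum>w\<in>Poly_Mapping.keys p - K. Poly_Mapping.single w (Poly_Mapping.lookup p w))"
      unfolding fa_scal_times_single mult_1_right
      using sum.subset_diff[of K "Poly_Mapping.keys p" "\<lambda>w. Poly_Mapping.single w (Poly_Mapping.lookup p w)"]
        poly_mapping_sum_single[of p] by (simp add: K_def add.commute)
    then have pAR: "p = A + R" by (simp only: A_def R_def)
    have "cg A q"
    proof -
      have "cg (\<Sum>w\<in>K. fa_scal (Poly_Mapping.lookup p w) * Poly_Mapping.single w 1)
        (\<Sum>w\<in>K. fa_scal (Poly_Mapping.lookup p w) * (\<Sum>bs\<in>blists d. fa_scal (cc w bs) * mon bs))"
        by (intro ucong_sum ucong_mult_left cc fa_scal_in_FA)
      also have "(\<Sum>w\<in>K. fa_scal (Poly_Mapping.lookup p w) * (\<Sum>bs\<in>blists d. fa_scal (cc w bs) * mon bs)) = q"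
      proof -
        have *: "fa_scal (c bs) = (\<Sum>w\<in>K. fa_scal (Poly_Mapping.lookup p w) * fa_scal (cc w bs) :: 'a mat list \<Rightarrow>\<^sub>0 'a)" for bs
          unfolding c_def fa_scal_mult[symmetric] by (rule fa_scal_sum)
        show ?thesis
          unfolding q_def * sum_distrib_left sum_distrib_right mult.assoc by (rule sum.swap)
      qed
      finally show ?thesis unfolding A_def .
    qed
    then have "cg (p - q) R"
    proof -
      have "A + R - q - R = A - q" by (simp add: algebra_simps)
      then show ?thesis using \<open>cg A q\<close> by (simp only: ucong_def pAR)
    qed
    moreover have "low d R"
      unfolding R_def
    proof (rule low_sum)
      fix w assume w: "w \<in> Poly_Mapping.keys p - K"
      then have "length w < d" "set w \<subseteq> L" using p by (force simp: K_def len_le_def, auto simp: FA_def)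
      then show "low d (Poly_Mapping.single w (Poly_Mapping.lookup p w))"
        by (intro lowI single_in_FA) (auto split: if_splits)
    qed
    ultimately show ?thesis by (rule low_cong)
  qed
  moreover have "low d (q - q')"
    unfolding q_def q'_def sum_subtractf[symmetric] right_diff_distrib[symmetric]
  proof (intro low_sum low_scal)
    fix bs assume "bs \<in> blists d"
    then have "set bs \<subseteq> idx" "length bs = d" by (auto simp: blists_def)
    then show "low d (mon bs - mon (rep (mset bs)))"
      using mon_mset[OF rep[symmetric]] by metis
  qed
  ultimately have pq': "low d (p - q')" by (rule low_diff_trans)
  define C where "C M = (\<Sum>bs\<in>{bs\<in>blists d. mset bs = M}. c bs)" for M
  have rep_in: "rep (mset bs) \<in> blists d" if "bs \<in> blists d" for bs
    using that rep[of "mset bs"] mset_eq_setD mset_eq_length unfolding blists_def by (metis (no_types, lifting) mem_Collect_eq)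
  have "q' = (\<Sum>M\<in>mset ` blists d. \<Sum>bs\<in>{bs\<in>blists d. mset bs = M}. fa_scal (c bs) * mon (rep (mset bs)))"
    unfolding q'_def by (rule sum.image_gen[OF finite_blists])
  also have "\<dots> = (\<Sum>M\<in>mset ` blists d. fa_scal (C M) * mon (rep M))"
  proof (rule sum.cong[OF refl])
    fix M
    have "fa_scal (C M) = (\<Sum>bs\<in>{bs\<in>blists d. mset bs = M}. fa_scal (c bs) :: 'a mat list \<Rightarrow>\<^sub>0 'a)"
      unfolding C_def by (rule fa_scal_sum)
    then show "(\<Sum>bs\<in>{bs\<in>blists d. mset bs = M}. fa_scal (c bs) * mon (rep (mset bs))) = (fa_scal (C M) * mon (rep M) :: 'a mat list \<Rightarrow>\<^sub>0 'a)"
      by (simp add: sum_distrib_right)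
  qed
  finally have q': "q' = (\<Sum>M\<in>mset ` blists d. fa_scal (C M) * mon (rep M))" .
  have "C M = 0" if M: "M \<in> mset ` blists d" for M
  proof -
    have rM: "rep M' \<in> blists d" if "M' \<in> mset ` blists d" for M' using that rep_in by auto
    let ?f = "prod_list (map dhat (rep M)) :: ('a mat, 'a) wfun"
    have len: "length (rep M) = d" using rM[OF M] by (simp add: blists_def)
    have "ord_ge (length (map dhat (rep M) :: ('a mat, 'a) wfun list)) ?f"
      by (rule ord_ge_prod_list) (auto simp del: One_nat_def intro: ord_ge_hat)
    then have f: "good N L ?f" "ord_ge d ?f"
      using len by (auto intro!: good_prod_list good_hat)
    have "pair ?f q' = 0"
      using pair_low[OF f pq'] zero[OF rM[OF M]] by (simp add: pair_diff_right)
    moreover have "pair ?f q' = (\<Sum>M'\<in>mset ` blists d. C M' * ap ?f (map emat (rep M')))"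
      unfolding q' mon_single fa_scal_times_single by (simp add: pair_sum_right pair_single)
    moreover have "\<dots> = (\<Sum>M'\<in>mset ` blists d. if M' = M then C M * ap ?f (map emat (rep M)) else 0)"
    proof (rule sum.cong[OF refl])
      fix M' assume M': "M' \<in> mset ` blists d"
      have "\<exists>k. ap ?f (map emat (rep M')) = of_nat k \<and> (k \<noteq> 0 \<longleftrightarrow> mset (rep M') = mset (rep M))"
        using rM[OF M] rM[OF M'] by (intro ap_prod_dhat) (auto simp: blists_def)
      then show "C M' * ap ?f (map emat (rep M')) = (if M' = M then C M * ap ?f (map emat (rep M)) else 0)"
        by (auto simp: rep)
    qed
    moreover have "ap ?f (map emat (rep M)) \<noteq> 0"
    proof -
      have "\<exists>k. ap ?f (map emat (rep M)) = of_nat k \<and> (k \<noteq> 0 \<longleftrightarrow> mset (rep M) = mset (rep M))"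
        using rM[OF M] by (intro ap_prod_dhat) (auto simp: blists_def)
      then show ?thesis by auto
    qed
    ultimately show ?thesis using M finite_blists by simp
  qed
  then have "q' = 0" unfolding q' by (simp add: fa_scal_0)
  then show ?thesis using pq' by simp
qed

end

text \<open>A nonzero polynomial has finitely many roots, and a field of characteristic zero is
  infinite.\<close>

lemma poly_fun_eq_0:
  fixes a :: "nat \<Rightarrow> 'a::field_char_0"
  assumes "\<And>t. (\<Sum>j\<le>m. a j * t ^ j) = 0" "j \<le> m"
  shows "a j = 0"
proof -
  define p where "p = (\<Sum>j\<le>m. monom (a j) j)"
  have "poly p t = 0" for t
    using assms(1)[of t] by (simp add: p_def poly_sum poly_monom)
  then have "p = 0" using poly_all_0_iff_0[of p] by blast
  moreover have "coeff p j = (\<Sum>i\<le>m. if i = j then a i else 0)"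
    by (simp add: p_def coeff_sum)
  ultimately show ?thesis using assms(2) by simp
qed

context diagram
begin

section \<open>Invariants vanishing on the slice\<close>

lemma pair_adiff_center:
  fixes u :: "'a::field_char_0 mat list \<Rightarrow>\<^sub>0 'a"
  assumes "u \<in> uea_center N L" "x \<in> L" "good N L f"
  shows "pair (adiff x f) u = 0"
proof -
  have "fa_gen x * u - u * fa_gen x \<in> uea_ideal N L"
    using assms(1,2) by (simp add: uea_center_iff commutes_def ucong_def)
  then show ?thesis unfolding pair_adiff by (rule good_ideal[OF assms(3)])
qed

text \<open>Sums of products of \<open>k\<close> matrix coefficients. On elements of length at most
  \<open>k\<close> they evaluate polarized symbols of degree \<open>k\<close>.\<close>

inductive prodp :: "nat \<Rightarrow> ('a::comm_ring_1 mat, 'a) wfun \<Rightarrow> bool" where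
  one: "prodp 0 1"
| mul: "prodp k f \<Longrightarrow> prodp (Suc k) (hat \<theta> * f)"
| add: "prodp k f \<Longrightarrow> prodp k g \<Longrightarrow> prodp k (f + g)"
| zero: "prodp k 0"

lemma prodp_good: "prodp k f \<Longrightarrow> good N L f"
proof (induction rule: prodp.induct)
  case (zero k)
  show ?case by (rule goodI) simp_all
qed (simp_all add: good_1 good_mult good_hat good_add)

lemma prodp_ord: "prodp k f \<Longrightarrow> ord_ge k f"
proof (induction rule: prodp.induct)
  case (mul k f \<theta>)
  then show ?case using ord_ge_mult[OF ord_ge_hat mul.IH] by simp
qed (simp_all add: ord_ge_add)

lemma prodp_prod_list: "prodp (length bs) (prod_list (map (\<lambda>b. hat (\<theta> b)) bs))"
  by (induction bs) (auto intro: prodp.one prodp.mul)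

text \<open>The derivation \<open>adiff x\<close> acts on each factor by \<open>act x\<close> up to
  higher order, so by the Leibniz rule it preserves the degree \<open>k\<close> modulo order
  \<open>k + 1\<close>.\<close>

lemma prodp_adiff:
  fixes x :: "'a::comm_ring_1 mat"
  assumes x: "x \<in> L"
  shows "prodp k f \<Longrightarrow> \<exists>g. prodp k g \<and> ord_ge (Suc k) (adiff x f - g)"
proof (induction rule: prodp.induct)
  case one
  show ?case by (intro exI[of _ 0]) (simp add: adiff_1 prodp.zero)
next
  case (mul k f \<theta>)
  then obtain g where g: "prodp k g" "ord_ge (Suc k) (adiff x f - g)" by blast
  have "ord_ge (2 + k) ((adiff x (hat \<theta>) - hat (act x \<theta>)) * f)"
    by (intro ord_ge_mult ord_ge_adiff_hat x prodp_ord mul.hyps)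
  moreover have "ord_ge (1 + Suc k) (hat \<theta> * (adiff x f - g))"
    by (intro ord_ge_mult ord_ge_hat g)
  ultimately have "ord_ge (Suc (Suc k)) ((adiff x (hat \<theta>) - hat (act x \<theta>)) * f + hat \<theta> * (adiff x f - g))"
    by (intro ord_ge_add) simp_all
  moreover have "adiff x (hat \<theta> * f) - (hat (act x \<theta>) * f + hat \<theta> * g) =
    (adiff x (hat \<theta>) - hat (act x \<theta>)) * f + hat \<theta> * (adiff x f - g)"
    by (simp add: adiff_mult algebra_simps)
  moreover have "prodp (Suc k) (hat (act x \<theta>) * f + hat \<theta> * g)"
    by (intro prodp.add prodp.mul mul.hyps g)
  ultimately show ?case by metis
next
  case (add k f g)
  then obtain f' g' where "prodp k f'" "ord_ge (Suc k) (adiff x f - f')" "prodp k g'" "ord_ge (Suc k) (adiff x g - g')"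
    by blast
  moreover from this have "ord_ge (Suc k) ((adiff x f - f') + (adiff x g - g'))" by (intro ord_ge_add)
  moreover have "(adiff x f - f') + (adiff x g - g') = adiff x (f + g) - (f' + g')"
    by (simp add: adiff_add)
  ultimately show ?case by (metis prodp.add)
next
  case (zero k)
  have "adiff x 0 = (0 :: ('a mat, 'a) wfun)" by (rule wfun_eqI) (simp add: ap_adiff)
  then show ?case by (intro exI[of _ 0]) (simp add: prodp.zero)
qed

lemma Theta_emat: "b \<in> idx \<Longrightarrow> Theta \<theta> (emat b) = (\<theta> b :: 'a::comm_ring_1)"
proof -
  assume b: "b \<in> idx"
  have "Theta \<theta> (emat b) = (\<Sum>b'\<in>idx. if b' = b then \<theta> b' else 0)"
    unfolding Theta_def by (rule sum.cong) (simp_all add: coord_emat b)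
  then show ?thesis using b by (simp add: finite_idx)
qed

text \<open>The extension by zero matches the vanishing of \<open>Emat lam i j r\<close> for large
  \<open>r\<close>.\<close>

definition rst :: "(nat \<times> nat \<times> nat \<Rightarrow> 'a::zero) \<Rightarrow> nat \<times> nat \<times> nat \<Rightarrow> 'a" where
  "rst \<theta> b = (if b \<in> idx then \<theta> b else 0)"

lemma Theta_Emat:
  assumes "i \<in> {1..n}" "j \<in> {1..n}" "part j - min (part i) (part j) \<le> p"
  shows "Theta \<theta> (Emat lam i j p) = (rst \<theta> (i, j, p) :: 'a::comm_ring_1)"
proof (cases "p < part j")
  case True
  then have "(i, j, p) \<in> idx" using assms by (simp add: idx_def)
  then show ?thesis using Theta_emat[of "(i, j, p)" \<theta>] by (simp add: emat_def rst_def)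
next
  case False
  then show ?thesis using assms by (auto simp: Emat_eq_0 Theta_def coord_def rst_def idx_def split: prod.splits)
qed

lemma act_Emat:
  assumes "(k, l, r) \<in> idx" "(i, j, q) \<in> idx"
  shows "act (Emat lam k l r) \<theta> (i, j, q) =
    ((if l = i then rst \<theta> (k, j, r + q) else 0) - (if j = k then rst \<theta> (i, l, q + r) else 0) :: 'a::comm_ring_1)"
proof -
  have z: "Theta \<theta> (\<lambda>h k. 0) = (0 :: 'a)" by (simp add: Theta_def coord_def split: prod.splits)
  have 1: "l = i \<Longrightarrow> Theta \<theta> (Emat lam k j (r + q)) = rst \<theta> (k, j, r + q)"
    using assms by (intro Theta_Emat) (auto simp: idx_def)
  have 2: "j = k \<Longrightarrow> Theta \<theta> (Emat lam i l (q + r)) = rst \<theta> (i, l, q + r)"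
    using assms by (intro Theta_Emat) (auto simp: idx_def)
  have "act (Emat lam k l r) \<theta> (i, j, q) =
    Theta \<theta> (if l = i then Emat lam k j (r + q) else (\<lambda>h k. 0)) +
    Theta \<theta> (msmult (- 1) (if j = k then Emat lam i l (q + r) else (\<lambda>h k. 0)))"
    unfolding act_def emat_def prod.case mbracket_Emat[OF assms]
    by (rule Theta_linear(1)) (simp add: madd_def)
  also have "Theta \<theta> (msmult (- 1) (if j = k then Emat lam i l (q + r) else (\<lambda>h k. 0))) =
    - 1 * Theta \<theta> (if j = k then Emat lam i l (q + r) else (\<lambda>h k. 0))"
    by (rule Theta_linear(2)) (simp add: msmult_def)
  finally show ?thesis using 1 2 z by auto
qed

end

context sorted_diagram
begin

text \<open>In the order of decreasing parts, the slice consists of the matrices with ones of lowest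
  degree below the diagonal and an arbitrary first row: companion matrices.\<close>

definition eta :: "nat \<times> nat \<times> nat \<Rightarrow> 'a::comm_ring_1" where
  "eta b = (case b of (i, j, q) \<Rightarrow> if dpos i = Suc (dpos j) \<and> Suc q = part j then 1 else 0)"

text \<open>The first-row direction attached to box \<open>r\<close> of the decreasing diagram,
  which lies in row \<open>dpos j\<close> and column \<open>q + 1\<close>; hence the
  \<open>Suc\<close>. There are \<open>N\<close> boxes, so the slice has \<open>N\<close>
  coordinates.\<close>

definition vv :: "nat \<Rightarrow> nat \<times> nat \<times> nat \<Rightarrow> 'a::comm_ring_1" where
  "vv r b = (case b of (i, j, q) \<Rightarrow> if dpos i = 1 \<and> dpos j = dseq lam r \<and> r = Suc (pre dlam (dpos j) + q) then 1 else 0)"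

definition slice :: "(nat \<Rightarrow> 'a) \<Rightarrow> nat \<times> nat \<times> nat \<Rightarrow> 'a::comm_ring_1" where
  "slice c b = eta b + (\<Sum>r\<in>{1..N}. c r * vv r b)"

lemma dseq_box:
  assumes "d \<in> {1..n}" "q < part (dpos d)"
  shows "Suc (pre dlam d + q) \<in> {1..N}" "dseq lam (Suc (pre dlam d + q)) = d"
proof -
  have "d \<in> {1..length dlam}" "Suc q \<in> {1..lam_at dlam d}"
    using assms by (auto simp: length_dlam dlam_at)
  from D.box_range[OF this] D.row_box[OF this]
  show "Suc (pre dlam d + q) \<in> {1..N}" "dseq lam (Suc (pre dlam d + q)) = d"
    by (simp_all add: Nsz_dlam dseq_eq)
qed

lemma vv_first_row:
  assumes "(i, j, q) \<in> idx" "dpos i = 1" "b \<in> idx"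
  shows "vv (Suc (pre dlam (dpos j) + q)) b = (if b = (i, j, q) then 1 else 0 :: 'a::comm_ring_1)"
proof -
  obtain i' j' q' where b: "b = (i', j', q')" by (cases b)
  have in_n: "i \<in> {1..n}" "j \<in> {1..n}" "i' \<in> {1..n}" "j' \<in> {1..n}" "q < part j"
    using assms by (auto simp: b idx_def)
  have "dseq lam (Suc (pre dlam (dpos j) + q)) = dpos j"
    using in_n dpos_in dpos_dpos by (intro dseq_box(2)) auto
  then show ?thesis
    using dpos_inj[OF in_n(3,1)] dpos_inj[OF in_n(4,2)] assms(2) by (auto simp: vv_def b)
qed

lemma rst_slice_eta:
  assumes "dpos i \<noteq> 1"
  shows "rst (slice c) (i, j, q) = (if (i, j, q) \<in> idx \<and> dpos i = Suc (dpos j) \<and> Suc q = part j then 1 else 0 :: 'a::comm_ring_1)"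
  using assms by (simp add: rst_def slice_def eta_def vv_def)

text \<open>Dually, first-row directions and orbit directions at a slice point span everything, so a
  \<open>y\<close> annihilating both is zero. Testing with \<open>Emat lam k l r\<close>, where
  \<open>k\<close> is not the first index in decreasing order, involves only the ones below the
  diagonal, and equates an entry of \<open>y\<close> with the next one down its diagonal. Below the
  main diagonal the chain runs out past the last row; elsewhere it is followed up to the first row,
  where \<open>y\<close> vanishes.\<close>

lemma stabilizer_trivial:
  fixes y :: "nat \<times> nat \<times> nat \<Rightarrow> 'a::field_char_0"
  assumes first: "\<And>i j q. (i, j, q) \<in> idx \<Longrightarrow> dpos i = 1 \<Longrightarrow> y (i, j, q) = 0"
    and stab: "\<And>k l r. (k, l, r) \<in> idx \<Longrightarrow> (\<Sum>b\<in>idx. act (Emat lam k l r) (slice c) b * y b) = 0"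
    and b: "b \<in> idx"
  shows "y b = 0"
proof -
  define Y where "Y = rst y"
  have Y1: "Y (i, j, q) = 0" if "dpos i = 1" for i j q using first that by (simp add: Y_def rst_def)
  have E: "(if r < part j then Y (l, j, part j - 1 - r) else 0) = (if dpos l = n then 0 else Y (dpos (Suc (dpos l)), k, part l - 1 - r))"
    if klr: "(k, l, r) \<in> idx" and k: "dpos k = Suc (dpos j)" and j: "j \<in> {1..n}" for k l r j
  proof -
    have kl: "k \<in> {1..n}" "l \<in> {1..n}" "r < part l" using klr by (auto simp: idx_def)
    have j1: "1 \<le> dpos j" using dpos_in[OF j] by simp
    let ?A = "\<lambda>b. case b of (i', j', q) \<Rightarrow> if l = i' then rst (slice c) (k, j', r + q) * y b else 0"
    let ?B = "\<lambda>b. case b of (i', j', q) \<Rightarrow> if j' = k then rst (slice c) (i', l, q + r) * y b else 0"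
    have "0 = (\<Sum>b\<in>idx. act (Emat lam k l r) (slice c) b * y b)"
      by (rule stab[OF klr, symmetric])
    also have "\<dots> = (\<Sum>b\<in>idx. ?A b - ?B b)"
      by (rule sum.cong) (auto simp: act_Emat[OF klr] left_diff_distrib split: prod.splits)
    also have "\<dots> = sum ?A idx - sum ?B idx" by (rule sum_subtractf)
    also have "sum ?A idx = (\<Sum>b\<in>idx. if r < part j \<and> b = (l, j, part j - 1 - r) then y b else 0)"
    proof (rule sum.cong[OF refl])
      fix b assume b: "b \<in> idx"
      obtain i' j' q where e: "b = (i', j', q)" by (cases b)
      have j': "j' \<in> {1..n}" using b by (simp add: e idx_def)
      have "rst (slice c) (k, j', r + q) = (if (k, j', r + q) \<in> idx \<and> dpos k = Suc (dpos j') \<and> Suc (r + q) = part j' then 1 else 0 :: 'a)"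
        using k j1 by (intro rst_slice_eta) simp
      moreover have "dpos k = Suc (dpos j') \<longleftrightarrow> j' = j" using k dpos_inj[OF j' j] by auto
      moreover have "Suc (r + q) = part j \<longleftrightarrow> r < part j \<and> q = part j - 1 - r" by auto
      moreover have "r < part j \<Longrightarrow> (k, j, r + (part j - 1 - r)) \<in> idx"
        using kl j part_pos[OF kl(1)] by (auto simp: idx_def)
      ultimately show "?A b = (if r < part j \<and> b = (l, j, part j - 1 - r) then y b else 0)" by (auto simp: e)
    qed
    also have "\<dots> = (if r < part j then Y (l, j, part j - 1 - r) else 0)"
      by (cases "r < part j") (simp_all add: finite_idx Y_def rst_def)
    also have "sum ?B idx = (\<Sum>b\<in>idx. if dpos l \<noteq> n \<and> b = (dpos (Suc (dpos l)), k, part l - 1 - r) then y b else 0)"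
    proof (rule sum.cong[OF refl])
      fix b assume b: "b \<in> idx"
      obtain i' j' q where e: "b = (i', j', q)" by (cases b)
      have i': "i' \<in> {1..n}" using b by (simp add: e idx_def)
      show "?B b = (if dpos l \<noteq> n \<and> b = (dpos (Suc (dpos l)), k, part l - 1 - r) then y b else 0)"
      proof (cases "dpos i' = 1")
        \<comment> \<open>Here the coordinates \<open>c\<close> of the slice point could enter, but
          \<open>y\<close> vanishes on the first row.\<close>
        case True
        then have "y b = 0" using first b by (simp add: e)
        then show ?thesis by (auto simp: e)
      next
        case False
        have "rst (slice c) (i', l, q + r) = (if (i', l, q + r) \<in> idx \<and> dpos i' = Suc (dpos l) \<and> Suc (q + r) = part l then 1 else 0 :: 'a)"
          using False by (rule rst_slice_eta)
        moreover have "dpos i' = Suc (dpos l) \<longleftrightarrow> dpos l \<noteq> n \<and> i' = dpos (Suc (dpos l))"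
          using dpos_in[OF i'] dpos_in[OF kl(2)] dpos_dpos[OF i'] dpos_dpos[of "Suc (dpos l)"] by auto
        moreover have "Suc (q + r) = part l \<longleftrightarrow> q = part l - 1 - r" using kl(3) by auto
        moreover have "(i', l, (part l - 1 - r) + r) \<in> idx"
          using kl i' part_pos[OF i'] by (auto simp: idx_def)
        ultimately show ?thesis by (auto simp: e)
      qed
    qed
    also have "\<dots> = (if dpos l = n then 0 else Y (dpos (Suc (dpos l)), k, part l - 1 - r))"
      by (cases "dpos l = n") (simp_all add: finite_idx Y_def rst_def)
    finally show ?thesis by simp
  qed
  have lower: "Y (l, j, q) = 0" if "dpos j < dpos l" "(l, j, q) \<in> idx" for l j q
    using that
  proof (induction "n - dpos l" arbitrary: l j q rule: less_induct)
    case less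
    have lj: "l \<in> {1..n}" "j \<in> {1..n}" "q < part j" "part j \<le> q + part l" using less.prems(2) by (auto simp: idx_def)
    define k where "k = dpos (Suc (dpos j))"
    have Sj: "Suc (dpos j) \<in> {1..n}" using less.prems(1) dpos_in[OF lj(1)] by simp
    have k: "k \<in> {1..n}" "dpos k = Suc (dpos j)"
      unfolding k_def by (rule dpos_in[OF Sj], rule dpos_dpos[OF Sj])
    have pk: "part l \<le> part k" using less.prems(1) k lj by (intro part_antimono) auto
    have "(k, l, part j - 1 - q) \<in> idx" using k lj pk by (auto simp: idx_def)
    from E[OF this k(2) lj(2)] have eq: "Y (l, j, q) =
        (if dpos l = n then 0 else Y (dpos (Suc (dpos l)), k, part l - 1 - (part j - 1 - q)))"
      using lj by simp
    show ?case
    proof (cases "dpos l = n")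
      case False
      then have "Suc (dpos l) \<in> {1..n}" using dpos_in[OF lj(1)] by simp
      then have l': "dpos (dpos (Suc (dpos l))) = Suc (dpos l)" by (rule dpos_dpos)
      have "Y (dpos (Suc (dpos l)), k, q') = 0" for q'
      proof (cases "(dpos (Suc (dpos l)), k, q') \<in> idx")
        case True
        show ?thesis
          by (rule less.hyps[OF _ _ True]) (use l' k less.prems(1) False dpos_in[OF lj(1)] in auto)
      qed (simp add: Y_def rst_def)
      then show ?thesis unfolding eq by simp
    qed (simp add: eq)
  qed
  have upper: "Y (l, j, q) = 0" if "dpos l \<le> dpos j" "(l, j, q) \<in> idx" for l j q
    using that
  proof (induction "dpos l" arbitrary: l j q rule: less_induct)
    case less
    have lj: "l \<in> {1..n}" "j \<in> {1..n}" "q < part j" using less.prems(2) by (auto simp: idx_def)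
    show ?case
    proof (cases "dpos l = 1")
      case False
      define l0 j0 where "l0 = dpos (dpos l - 1)" and "j0 = dpos (dpos j - 1)"
      have m: "dpos l - 1 \<in> {1..n}" "dpos j - 1 \<in> {1..n}"
        using False less.prems(1) dpos_in[OF lj(1)] dpos_in[OF lj(2)] by auto
      have l0: "l0 \<in> {1..n}" "dpos l0 = dpos l - 1" and j0: "j0 \<in> {1..n}" "dpos j0 = dpos j - 1"
        unfolding l0_def j0_def by (rule dpos_in[OF m(1)], rule dpos_dpos[OF m(1)], rule dpos_in[OF m(2)], rule dpos_dpos[OF m(2)])
      have d1: "1 \<le> dpos l" "1 \<le> dpos j" "dpos l \<le> n" using dpos_in[OF lj(1)] dpos_in[OF lj(2)] by auto
      have S: "Suc (dpos l0) = dpos l" "dpos j = Suc (dpos j0)" "dpos l0 \<noteq> n" using l0(2) j0(2) d1 False less.prems(1) by auto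
      have p: "part j \<le> part l0" "part j \<le> part j0" "part j0 \<le> part l0"
        using l0 j0 lj less.prems(1) d1 by (auto intro!: part_antimono)
      \<comment> \<open>Chosen so that \<open>q\<close> is the degree on the right-hand side of
        \<open>E\<close>.\<close>
      define r where "r = part l0 - 1 - q"
      have r: "r < part l0" "part l0 - 1 - r = q" "(j, l0, r) \<in> idx"
        using p lj l0 by (auto simp: idx_def r_def)
      have "Y (l0, j0, q') = 0" for q'
      proof (cases "(l0, j0, q') \<in> idx")
        case True
        show ?thesis
          by (rule less.hyps[OF _ _ True]) (use S less.prems(1) in auto)
      qed (simp add: Y_def rst_def)
      then show ?thesis
        using E[OF r(3) S(2) j0(1)] S(1,3) r(2) dpos_dpos[OF lj(1)] by (simp split: if_splits)
    qed (simp add: Y1)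
  qed
  obtain i j q where "b = (i, j, q)" by (cases b)
  then have "Y b = 0" using lower[of j i q] upper[of i j q] b by (cases "dpos j < dpos i") auto
  then show ?thesis using b by (simp add: Y_def rst_def)
qed

section \<open>Taylor coefficients along the slice\<close>

lemma slice_upd: "r \<in> {1..N} \<Longrightarrow> slice (c(r := c r + t)) b = slice c b + t * (vv r b :: 'a::comm_ring_1)"
proof -
  assume r: "r \<in> {1..N}"
  have "(\<Sum>x\<in>{1..N}. (c(r := c r + t)) x * vv x b) =
    (\<Sum>x\<in>{1..N}. c x * vv x b + (if x = r then t * vv r b else 0))"
    by (rule sum.cong) (auto simp: distrib_right)
  also have "\<dots> = (\<Sum>x\<in>{1..N}. c x * vv x b) + t * vv r b"
    using r by (simp add: sum.distrib del: atLeastAtMost_iff)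
  finally show ?thesis by (simp add: slice_def add.assoc)
qed

text \<open>The pairing is a polynomial in \<open>t\<close>, and its linear coefficient is the
  quantity in question times the nonzero number \<open>Suc m\<close>.\<close>

lemma pair_power_linear:
  fixes f g h :: "('x, 'a::field_char_0) wfun"
  assumes "\<And>t. pair (f * (wcst t * g + h) ^ Suc m) u = 0"
  shows "pair (f * (g * h ^ m)) u = 0"
proof -
  have "pair (f * (wcst t * g + h) ^ Suc m) u =
    (\<Sum>j\<le>Suc m. (of_nat (Suc m choose j) * pair (f * (g ^ j * h ^ (Suc m - j))) u) * t ^ j)" for t
  proof -
    have "f * (wcst t * g + h) ^ Suc m =
      (\<Sum>j\<le>Suc m. wcst (t ^ j) * (of_nat (Suc m choose j) * (f * (g ^ j * h ^ (Suc m - j)))))"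
      unfolding binomial_ring sum_distrib_left
      by (rule sum.cong) (simp_all add: power_mult_distrib wcst_power mult_ac)
    then show ?thesis
      by (simp only: pair_sum pair_wcst pair_of_nat) (simp only: mult_ac)
  qed
  then have "(\<Sum>j\<le>Suc m. (of_nat (Suc m choose j) * pair (f * (g ^ j * h ^ (Suc m - j))) u) * t ^ j) = 0" for t
    using assms by simp
  then have "of_nat (Suc m choose 1) * pair (f * (g ^ 1 * h ^ (Suc m - 1))) u = 0"
    by (rule poly_fun_eq_0) simp
  then show ?thesis by (simp del: of_nat_Suc)
qed

text \<open>Induction on the order \<open>k\<close> of differentiation. Once all derivatives of
  order \<open>k\<close> vanish at all slice points, those of order \<open>k + 1\<close> vanish in
  slice directions, because the point may move within the slice, and in orbit directions, because
  \<open>u\<close> is invariant. By \<open>stabilizer_trivial\<close> these directions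
  suffice.\<close>

lemma invariant_vanishing_on_slice:
  fixes u :: "'a::field_char_0 mat list \<Rightarrow>\<^sub>0 'a"
  assumes u: "u \<in> uea_center N L" "len_le d u"
    and van: "\<And>c. pair (hat (slice c) ^ d) u = 0"
  shows "k \<le> d \<Longrightarrow> prodp k f \<Longrightarrow> pair (f * hat (slice c) ^ (d - k)) u = 0"
proof (induction k arbitrary: f c)
  case 0
  have "prodp k f \<Longrightarrow> k = 0 \<Longrightarrow> pair (f * hat (slice c) ^ d) u = 0" for k f
    by (induction rule: prodp.induct) (simp_all add: van distrib_right pair_add pair_zero)
  with 0 show ?case by simp
next
  case (Suc k)
  define m where "m = d - Suc k"
  have m: "d - k = Suc m" "k + Suc m = d" using Suc.prems(1) by (simp_all add: m_def)
  have IH: "prodp k f \<Longrightarrow> pair (f * hat (slice c) ^ Suc m) u = 0" for f c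
    using Suc.IH[of f c] Suc.prems(1) m by simp
  have "prodp k' f \<Longrightarrow> k' = Suc k \<Longrightarrow> pair (f * hat (slice c) ^ m) u = 0" for k' f
  proof (induction rule: prodp.induct)
    case (mul k'' f \<theta>)
    then have f: "prodp k f" by simp
    let ?s = "hat (slice c)"
    \<comment> \<open>The further derivative in direction \<open>b\<close>, as a function of
      \<open>b\<close>, is the vector to which \<open>stabilizer_trivial\<close> applies.\<close>
    have y0: "pair (f * (dhat b * ?s ^ m)) u = 0" if b: "b \<in> idx" for b
    proof (rule stabilizer_trivial[where y = "\<lambda>b. pair (f * (dhat b * ?s ^ m)) u" and c = c, OF _ _ b])
      fix i j q assume ijq: "(i, j, q) \<in> idx" "dpos i = 1"
      define r where "r = Suc (pre dlam (dpos j) + q)"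
      have j: "j \<in> {1..n}" "q < part j" using ijq by (auto simp: idx_def)
      have r: "r \<in> {1..N}"
        unfolding r_def using dseq_box(1)[OF dpos_in[OF j(1)], of q] j dpos_dpos[OF j(1)] by simp
      have "Theta (vv r) A = Theta (delta (i, j, q)) (A :: 'a mat)" for A
        unfolding Theta_def by (rule sum.cong) (simp_all add: r_def vv_first_row[OF ijq])
      then have hv: "hat (vv r) = (dhat (i, j, q) :: ('a mat, 'a) wfun)"
        by (intro wfun_eqI) (simp add: ap_hat)
      have hs: "hat (slice (c(r := c r + t))) = wcst t * hat (vv r) + ?s" for t
      proof -
        have "slice (c(r := c r + t)) = (\<lambda>b. slice c b + t * vv r b)"
          by (rule HOL.ext) (rule slice_upd[OF r])
        then show ?thesis by (simp only: hat_add hat_scale add.commute)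
      qed
      have "pair (f * (wcst t * hat (vv r) + ?s) ^ Suc m) u = 0" for t
        unfolding hs[symmetric] by (rule IH[OF f])
      from pair_power_linear[OF this] show "pair (f * (dhat (i, j, q) * ?s ^ m)) u = 0"
        by (simp only: hv)
    next
      fix k0 l r assume klr: "(k0, l, r) \<in> idx"
      let ?x = "Emat lam k0 l r :: 'a mat"
      have x: "?x \<in> L" using klr by (intro Emat_in_L) (auto simp: idx_def)
      obtain g where g: "prodp k g" "ord_ge (Suc k) (adiff ?x f - g)" using prodp_adiff[OF x f] by blast
      have os: "ord_ge (j * 1) (?s ^ j)" for j by (rule ord_ge_power[OF ord_ge_hat])
      \<comment> \<open>Both error terms have order \<open>d + 1\<close>, so they are invisible to
        \<open>u\<close>, whose words have length at most \<open>d\<close>.\<close>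
      have "ord_ge (Suc k + Suc m * 1) ((adiff ?x f - g) * ?s ^ Suc m)"
        by (rule ord_ge_mult[OF g(2) os])
      then have 1: "pair ((adiff ?x f - g) * ?s ^ Suc m) u = 0"
        using pair_ord_ge[OF _ u(2)] m(2) by simp
      have "ord_ge ((k + m * 1) + 2) ((f * ?s ^ m) * (adiff ?x ?s - hat (act ?x (slice c))))"
        by (intro ord_ge_mult prodp_ord[OF f] os ord_ge_adiff_hat x)
      then have 2: "pair ((f * ?s ^ m) * (adiff ?x ?s - hat (act ?x (slice c)))) u = 0"
        using pair_ord_ge[OF _ u(2)] m(2) by simp
      have "0 = pair (adiff ?x (f * ?s ^ Suc m)) u"
        by (rule pair_adiff_center[OF u(1) x, symmetric]) (intro good_mult good_power good_hat prodp_good[OF f])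
      also have "adiff ?x (f * ?s ^ Suc m) = ((adiff ?x f - g) * ?s ^ Suc m + g * ?s ^ Suc m) +
          of_nat (Suc m) * ((f * ?s ^ m) * (adiff ?x ?s - hat (act ?x (slice c))) + f * (hat (act ?x (slice c)) * ?s ^ m))"
        unfolding adiff_mult adiff_power by (simp add: algebra_simps del: of_nat_Suc)
      also have "pair \<dots> u = of_nat (Suc m) * pair (f * (hat (act ?x (slice c)) * ?s ^ m)) u"
        unfolding pair_add pair_of_nat 1 2 IH[OF g(1)] by simp
      finally have "pair (f * (hat (act ?x (slice c)) * ?s ^ m)) u = 0" by (simp del: of_nat_Suc)
      moreover have "pair (f * (hat (act ?x (slice c)) * ?s ^ m)) u =
          (\<Sum>b\<in>idx. act ?x (slice c) b * pair (f * (dhat b * ?s ^ m)) u)"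
        by (subst hat_expand) (simp only: sum_distrib_right sum_distrib_left pair_sum mult.assoc
          mult.left_commute[of f "wcst _"] pair_wcst)
      ultimately show "(\<Sum>b\<in>idx. act ?x (slice c) b * pair (f * (dhat b * ?s ^ m)) u) = 0" by simp
    qed
    have "pair (hat \<theta> * f * ?s ^ m) u = (\<Sum>b\<in>idx. \<theta> b * pair (f * (dhat b * ?s ^ m)) u)"
    proof -
      have "hat \<theta> * f * ?s ^ m = (\<Sum>b\<in>idx. wcst (\<theta> b) * (f * (dhat b * ?s ^ m)))"
        by (subst hat_expand) (simp only: sum_distrib_right sum_distrib_left mult_ac)
      then show ?thesis by (simp only: pair_sum pair_wcst)
    qed
    then show ?case using y0 by simp
  qed (simp_all add: distrib_right pair_add pair_zero)
  with Suc.prems(2) show ?case by (simp add: m_def)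
qed

text \<open>At \<open>k = d\<close> no power of the slice functional is left over, so every dual
  monomial of degree \<open>d\<close> pairs to zero with \<open>u\<close>.\<close>

lemma low_of_vanishing_on_slice:
  fixes u :: "'a::field_char_0 mat list \<Rightarrow>\<^sub>0 'a"
  assumes u: "u \<in> uea_center N L" "len_le d u"
    and van: "\<And>c. pair (hat (slice c) ^ d) u = 0"
  shows "low d u"
proof (rule low_of_symbol_zero[OF _ u(2)])
  show "u \<in> FA L" using u(1) by (simp add: uea_center_iff)
  fix bs assume "bs \<in> blists d"
  then have "prodp d (prod_list (map dhat bs) :: ('a mat, 'a) wfun)"
    using prodp_prod_list[where \<theta> = delta and bs = bs] by (simp add: blists_def)
  from invariant_vanishing_on_slice[OF u van order_refl this] show "pair (prod_list (map dhat bs)) u = 0"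
    by simp
qed

end

section \<open>Symbols as polynomial functions\<close>

lemma coeff_mult_top:
  fixes p q :: "'a::comm_ring_1 poly"
  assumes "degree p \<le> a" "degree q \<le> b"
  shows "coeff (p * q) (a + b) = coeff p a * coeff q b"
proof -
  have "coeff (p * q) (a + b) = (\<Sum>i\<le>a + b. if i = a then coeff p a * coeff q b else 0)"
    unfolding coeff_mult
  proof (rule sum.cong[OF refl])
    fix i assume "i \<in> {..a + b}"
    then show "coeff p i * coeff q (a + b - i) = (if i = a then coeff p a * coeff q b else 0)"
      using assms by (cases i a rule: linorder_cases) (auto simp: coeff_eq_0)
  qed
  then show ?thesis by simp
qed

interpretation const_hom: scalar_hom "\<lambda>c::'a::comm_ring_1. [:c:]"
  by standard (simp_all add: one_pCons)

context diagram
begin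

text \<open>Each letter \<open>A\<close> goes to \<open>Theta \<theta> A\<close> times the variable.
  The variable records word length, so the coefficient at \<open>d\<close> is the symbol of degree
  \<open>d\<close> evaluated at \<open>\<theta>\<close>. This lives on the free algebra;
  \<open>pair_hat_power\<close> links it to functionals on the enveloping algebra.\<close>

definition Psi :: "(nat \<times> nat \<times> nat \<Rightarrow> 'a) \<Rightarrow> ('a::comm_ring_1 mat list \<Rightarrow>\<^sub>0 'a) \<Rightarrow> 'a poly" where
  "Psi \<theta> = ext (\<lambda>c. [:c:]) (\<lambda>w. monom (prod_list (map (Theta \<theta>) w)) (length w))"

definition sym :: "nat \<Rightarrow> (nat \<times> nat \<times> nat \<Rightarrow> 'a) \<Rightarrow> ('a::comm_ring_1 mat list \<Rightarrow>\<^sub>0 'a) \<Rightarrow> 'a" where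
  "sym d \<theta> p = coeff (Psi \<theta> p) d"

lemma Psi_mult: "Psi \<theta> (p * q) = Psi \<theta> p * Psi \<theta> q"
  unfolding Psi_def by (rule const_hom.ext_hom_mult) (simp add: plus_list_def mult_monom)

lemma sym_diff: "sym d \<theta> (p - q) = sym d \<theta> p - sym d \<theta> q"
  by (simp add: sym_def Psi_def const_hom.ext_diff)

lemma sym_sum: "sym d \<theta> (sum f A) = (\<Sum>i\<in>A. sym d \<theta> (f i))"
  by (simp add: sym_def Psi_def const_hom.ext_sum coeff_sum)

lemma sym_single: "sym d \<theta> (Poly_Mapping.single w c) = (if length w = d then c * prod_list (map (Theta \<theta>) w) else 0)"
  by (simp add: sym_def Psi_def const_hom.ext_single)

lemma sym_eq: "sym d \<theta> p = (\<Sum>w\<in>Poly_Mapping.keys p. Poly_Mapping.lookup p w *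
    (if length w = d then prod_list (map (Theta \<theta>) w) else 0))"
  unfolding sym_def Psi_def ext_def by (simp add: coeff_sum)

lemma sym_scal: "sym d \<theta> (fa_scal c * p) = c * sym d \<theta> p"
  unfolding sym_def Psi_mult by (simp add: Psi_def fa_scal_def const_hom.ext_single monom_0)

lemma sym_large: "len_le d p \<Longrightarrow> d < e \<Longrightarrow> sym e \<theta> p = 0"
  unfolding sym_eq by (rule sum.neutral) (auto simp: len_le_def)

lemma sym_mult:
  assumes "len_le a p" "len_le b q"
  shows "sym (a + b) \<theta> (p * q) = sym a \<theta> p * sym b \<theta> q"
proof -
  have "degree (Psi \<theta> p) \<le> a" "degree (Psi \<theta> q) \<le> b"
    using sym_large[OF assms(1)] sym_large[OF assms(2)] by (auto intro: degree_le simp: sym_def)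
  then show ?thesis unfolding sym_def Psi_mult by (rule coeff_mult_top)
qed

lemma sym_1: "sym 0 \<theta> 1 = 1"
proof -
  have "sym 0 \<theta> (fa_scal 1) = 1" by (simp add: fa_scal_def sym_single)
  then show ?thesis by (simp only: fa_scal_1)
qed

lemma sym_power: "len_le a p \<Longrightarrow> sym (k * a) \<theta> (p ^ k) = sym a \<theta> p ^ k"
  by (induction k) (simp_all add: sym_1 sym_mult len_le_power)

lemma sym_prod_list:
  "(\<And>i. i \<in> set is \<Longrightarrow> len_le (g i) (f i)) \<Longrightarrow>
    sym (sum_list (map g is)) \<theta> (prod_list (map f is)) = prod_list (map (\<lambda>i. sym (g i) \<theta> (f i)) is)"
proof (induction "is")
  case (Cons i "is")
  then show ?case
    using sym_mult[of "g i" "f i" "sum_list (map g is)" "prod_list (map f is)"] len_le_prod_list[of "is" g f] by simp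
qed (simp add: sym_1)

text \<open>Removing the first letter is a derivation, so each removal contributes the current
  exponent; together they form the factorial.\<close>

lemma ap_hat_power:
  "length w = d \<Longrightarrow> ap (hat \<theta> ^ d) w = fact d * prod_list (map (Theta \<theta>) w)"
proof (induction w arbitrary: d)
  case Nil
  then show ?case by (simp add: ap_1)
next
  case (Cons x w)
  then obtain e where d: "d = Suc e" "length w = e" by auto
  have pow: "ldiff x (f ^ Suc k) = of_nat (Suc k) * f ^ k * ldiff x f" for f :: "('a mat, 'a) wfun" and k
  proof (induction k)
    case (Suc k)
    have "ldiff x (f ^ Suc (Suc k)) = ldiff x f * f ^ Suc k + f * ldiff x (f ^ Suc k)"
      by (metis ldiff_mult power_Suc)
    then show ?case unfolding Suc by (simp add: algebra_simps)
  qed simp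
  have "ord_ge 1 (ldiff x (hat \<theta>) - wcst (Theta \<theta> x))"
    by (auto simp: ord_ge_def ap_hat_single ap_wcst)
  then have "ord_ge (e * 1 + 1) (hat \<theta> ^ e * (ldiff x (hat \<theta>) - wcst (Theta \<theta> x)))"
    by (intro ord_ge_mult ord_ge_power ord_ge_hat)
  then have "ap (hat \<theta> ^ e * (ldiff x (hat \<theta>) - wcst (Theta \<theta> x))) w = 0"
    using d by (simp add: ord_ge_def)
  then have z: "ap (hat \<theta> ^ e * ldiff x (hat \<theta>)) w = Theta \<theta> x * ap (hat \<theta> ^ e) w"
    by (simp add: right_diff_distrib mult.commute[of "hat \<theta> ^ e" "wcst _"])
  have "ap (hat \<theta> ^ d) (x # w) = ap (wcst (of_nat (Suc e)) * (hat \<theta> ^ e * ldiff x (hat \<theta>))) w"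
    unfolding d(1) ap_ldiff[symmetric] pow of_nat_eq_wcst by (simp only: mult.assoc)
  also have "\<dots> = of_nat (Suc e) * (Theta \<theta> x * ap (hat \<theta> ^ e) w)"
    unfolding ap_wcst_mult z ..
  finally show ?case using Cons.IH[OF d(2)] d(1) by (simp add: algebra_simps)
qed

text \<open>Through this identity the symbol of degree \<open>d\<close> of an element of length at
  most \<open>d\<close> depends, in characteristic zero, only on its class modulo the ideal.\<close>

lemma pair_hat_power: "len_le d p \<Longrightarrow> pair (hat \<theta> ^ d) p = fact d * sym d \<theta> p"
proof -
  assume p: "len_le d p"
  have "ord_ge d (hat \<theta> ^ d)" using ord_ge_power[OF ord_ge_hat, of d \<theta>] by simp
  then have "Poly_Mapping.lookup p w * ap (hat \<theta> ^ d) w = fact d * (Poly_Mapping.lookup p w *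
      (if length w = d then prod_list (map (Theta \<theta>) w) else 0))" if "w \<in> Poly_Mapping.keys p" for w
    using that p by (auto simp: ap_hat_power len_le_def ord_ge_def algebra_simps le_less)
  then show ?thesis unfolding pair_def ext_def sym_eq sum_distrib_left by (intro sum.cong refl) simp
qed

lemma sym_et:
  assumes "i \<in> {1..n}" "j \<in> {1..n}"
  shows "sym 1 \<theta> (et i j q) = (rst \<theta> (i, j, q) :: 'a::comm_ring_1)"
proof -
  have "sym 1 \<theta> (of_nat k :: 'a mat list \<Rightarrow>\<^sub>0 'a) = 0" for k
    using sym_single[of 1 \<theta> "[]" "of_nat k"] by (simp flip: fa_scal_of_nat add: fa_scal_def)
  moreover have "sym 1 \<theta> (0 :: 'a mat list \<Rightarrow>\<^sub>0 'a) = 0" by (simp add: sym_eq)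
  ultimately show ?thesis
    using Theta_emat[of "(i, j, q)" \<theta>]
    by (auto simp: et_def sym_diff ee_def rst_def fa_gen_def sym_single emat_def)
qed

lemma sym_oprod:
  assumes "I \<subseteq> {1..n}" "card I = d" "\<And>k. k \<in> I \<Longrightarrow> len_le 1 (f k)"
  shows "sym d \<theta> (oprod I f) = (\<Prod>k\<in>I. sym 1 \<theta> (f k))"
proof -
  have fin: "finite I" using assms(1) finite_subset by blast
  let ?g = "\<lambda>k. if k \<in> I then 1 else 0 :: nat"
  have "sym (\<Sum>k\<leftarrow>[1..<Suc n]. ?g k) \<theta> (oprod I f) =
    prod_list (map (\<lambda>k. sym (?g k) \<theta> (if k \<in> I then f k else 1)) [1..<Suc n])"
    unfolding oprod_def using assms(3) by (intro sym_prod_list) (auto simp: len_le_1)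
  also have "\<dots> = (\<Prod>k\<in>{1..n}. sym (?g k) \<theta> (if k \<in> I then f k else 1))"
    by (simp add: prod.distinct_set_conv_list[symmetric] atLeastLessThanSuc_atLeastAtMost del: upt_Suc)
  also have "\<dots> = (\<Prod>k\<in>I. sym 1 \<theta> (f k))"
    using assms(1) by (intro prod.mono_neutral_cong_right) (auto simp: sym_1)
  also have "(\<Sum>k\<leftarrow>[1..<Suc n]. ?g k) = d"
    using sum_ind[OF fin assms(1), of "\<lambda>_. 1::nat"] assms(2) by simp
  finally show ?thesis .
qed

end

lemma sum_eq_single:
  "finite S \<Longrightarrow> a \<in> S \<Longrightarrow> (\<And>x. x \<in> S \<Longrightarrow> x \<noteq> a \<Longrightarrow> f x = 0) \<Longrightarrow> sum f S = (f a :: 'b::comm_monoid_add)"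
  using sum.mono_neutral_right[of S "{a}" f] by auto

section \<open>The symbol of \<open>zgen\<close> on the slice\<close>

context sorted_diagram
begin

context
  fixes r d assumes r: "r \<in> {1..N}" and d: "d = dseq lam r"
begin

definition I0 :: "nat set" where
  "I0 = {k\<in>{1..n}. dpos k \<le> d}"

text \<open>The cycle through the first \<open>d\<close> positions in the order of decreasing parts.
  It picks ones below the diagonal and closes up with a single first-row entry, as in the
  determinant of a companion matrix.\<close>

definition w0 :: "nat \<Rightarrow> nat" where
  "w0 k = (if k \<in> I0 then (if dpos k = d then dpos 1 else dpos (Suc (dpos k))) else k)"

text \<open>Top degrees in all columns but the last. That one receives what the total
  \<open>r - d\<close> leaves over, which is the column of box \<open>r\<close> counted from
  zero.\<close>

definition q0 :: "nat \<Rightarrow> nat" where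
  "q0 k = (if k \<in> I0 then (if dpos k = d then r - pre dlam d - 1 else part k - 1) else 0)"

lemma d_bounds: "d \<in> {1..n}" "pre dlam d < r" "r \<le> pre dlam d + part (dpos d)"
proof -
  obtain d' c where "d' = dseq lam r" "d' \<in> {1..n}" "c \<in> {1..part (dpos d')}" "r = pre dlam d' + c"
    by (rule dseq_cases[OF r])
  then show "d \<in> {1..n}" "pre dlam d < r" "r \<le> pre dlam d + part (dpos d)" by (simp_all add: d)
qed

lemma I0_image: "I0 = dpos ` {1..d}"
proof
  show "I0 \<subseteq> dpos ` {1..d}"
  proof
    fix k assume "k \<in> I0"
    then have k: "k \<in> {1..n}" "dpos k \<le> d" by (auto simp: I0_def)
    then have "dpos (dpos k) = k" "dpos k \<in> {1..d}" using dpos_dpos dpos_in[OF k(1)] by auto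
    then show "k \<in> dpos ` {1..d}" by (metis imageI)
  qed
  show "dpos ` {1..d} \<subseteq> I0"
    using d_bounds(1) dpos_in dpos_dpos by (force simp: I0_def)
qed

lemma inj_dpos: "J \<subseteq> {1..n} \<Longrightarrow> inj_on dpos J"
  using dpos_inj by (auto simp: inj_on_def subset_iff)

lemma card_I0: "card I0 = d"
  unfolding I0_image using d_bounds(1) card_image[OF inj_dpos[of "{1..d}"]] by simp

lemma I0_subsets: "I0 \<in> subsets d"
  using card_I0 by (auto simp: subsets_def I0_def)

lemma w0_in: "k \<in> I0 \<Longrightarrow> w0 k \<in> I0 \<and> dpos (w0 k) = (if dpos k = d then 1 else Suc (dpos k))"
proof -
  assume k: "k \<in> I0"
  have 1: "1 \<in> {1..n}" using d_bounds(1) by auto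
  show ?thesis
  proof (cases "dpos k = d")
    case True
    then show ?thesis using k dpos_in[OF 1] dpos_dpos[OF 1] d_bounds(1) by (auto simp: w0_def I0_def)
  next
    case False
    then have S: "Suc (dpos k) \<in> {1..n}" "Suc (dpos k) \<le> d" using k d_bounds(1) by (auto simp: I0_def)
    show ?thesis using k False dpos_in[OF S(1)] dpos_dpos[OF S(1)] S(2) by (auto simp: w0_def I0_def)
  qed
qed

lemma w0_permutes: "w0 permutes I0"
proof (rule bij_imp_permutes)
  have fin: "finite I0" by (simp add: I0_def)
  have inj: "inj_on w0 I0"
  proof (rule inj_onI)
    fix x y assume xy: "x \<in> I0" "y \<in> I0" "w0 x = w0 y"
    then have "(if dpos x = d then 1 else Suc (dpos x)) = (if dpos y = d then 1 else Suc (dpos y))"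
      using w0_in by metis
    moreover have x: "x \<in> {1..n}" and y: "y \<in> {1..n}" using xy by (auto simp: I0_def)
    moreover have "(if a = d then 1 else Suc a) = (if b = d then 1 else Suc b) \<Longrightarrow> 1 \<le> a \<Longrightarrow> 1 \<le> b \<Longrightarrow> a = b" for a b
      by (cases "a = d"; cases "b = d"; simp)
    moreover have "1 \<le> dpos x" "1 \<le> dpos y" using dpos_in[OF x] dpos_in[OF y] by simp_all
    ultimately have "dpos x = dpos y" by blast
    then show "x = y" using dpos_inj[OF x y] by simp
  qed
  moreover have "w0 ` I0 \<subseteq> I0" using w0_in by blast
  ultimately show "bij_betw w0 I0 I0"
    using endo_inj_surj[OF fin] by (simp add: bij_betw_def)
qed (simp add: w0_def)

lemma sum_lower: "(\<Sum>k\<in>{k\<in>I0. dpos k < d}. part k - 1) + (d - 1) = pre dlam d"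
proof -
  have sub: "{1..<d} \<subseteq> {1..n}" using d_bounds(1) by auto
  have "{k\<in>I0. dpos k < d} = dpos ` {1..<d}"
  proof
    show "{k\<in>I0. dpos k < d} \<subseteq> dpos ` {1..<d}"
    proof
      fix k assume k: "k \<in> {k\<in>I0. dpos k < d}"
      then have kn: "k \<in> {1..n}" by (simp add: I0_def)
      then have "dpos k \<in> {1..<d}" using k dpos_in[OF kn] by simp
      then show "k \<in> dpos ` {1..<d}" using dpos_dpos[OF kn] by (metis imageI)
    qed
    show "dpos ` {1..<d} \<subseteq> {k\<in>I0. dpos k < d}"
    proof
      fix k assume "k \<in> dpos ` {1..<d}"
      then obtain m where m: "k = dpos m" "m \<in> {1..<d}" by blast
      then have "m \<in> {1..n}" using sub by blast
      then show "k \<in> {k\<in>I0. dpos k < d}" using m dpos_in[of m] dpos_dpos[of m] by (simp add: I0_def)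
    qed
  qed
  then have "(\<Sum>k\<in>{k\<in>I0. dpos k < d}. part k - 1) = (\<Sum>m\<in>{1..<d}. part (dpos m) - 1)"
    using sum.reindex[OF inj_dpos[OF sub], of "\<lambda>k. part k - 1"] by (simp add: o_def)
  moreover have "(\<Sum>m\<in>{1..<d}. part (dpos m) - 1) + (\<Sum>m\<in>{1..<d}. 1) = (\<Sum>m\<in>{1..<d}. part (dpos m))"
    unfolding sum.distrib[symmetric]
  proof (rule sum.cong[OF refl])
    fix m assume "m \<in> {1..<d}"
    then have "dpos m \<in> {1..n}" using sub dpos_in by blast
    from part_pos[OF this] show "part (dpos m) - 1 + 1 = part (dpos m)" by simp
  qed
  moreover have "pre dlam d = (\<Sum>m\<in>{1..<d}. part (dpos m))" using d_bounds(1) by (intro pre_dlam) auto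
  ultimately show ?thesis by simp
qed

lemma sum_split_top:
  fixes q :: "nat \<Rightarrow> nat"
  assumes "\<And>k. k \<in> I0 \<Longrightarrow> dpos k < d \<Longrightarrow> q k = part k - 1"
  shows "sum q I0 = q (dpos d) + (pre dlam d - (d - 1))"
proof -
  have dn: "dpos d \<in> I0" "dpos (dpos d) = d"
    using d_bounds(1) dpos_in[of d] dpos_dpos[of d] by (simp_all add: I0_def)
  have fin: "finite I0" by (simp add: I0_def)
  have "I0 - {dpos d} = {k\<in>I0. dpos k < d}"
  proof (intro equalityI subsetI)
    fix k assume k: "k \<in> I0 - {dpos d}"
    then have "k \<in> {1..n}" by (simp add: I0_def)
    then have "dpos k \<noteq> d" using k dpos_dpos by auto
    then show "k \<in> {k\<in>I0. dpos k < d}" using k by (simp add: I0_def)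
  qed (use dn in auto)
  then have "sum q (I0 - {dpos d}) = (\<Sum>k\<in>{k\<in>I0. dpos k < d}. part k - 1)"
    using assms by (intro sum.cong) auto
  then show ?thesis using sum.remove[OF fin dn(1), of q] sum_lower by simp
qed

lemma q0_degs: "q0 \<in> degs I0 (r - d)"
proof -
  have dn: "dpos d \<in> I0" "dpos (dpos d) = d"
    using d_bounds(1) dpos_in[of d] dpos_dpos[of d] by (simp_all add: I0_def)
  have "sum q0 I0 = q0 (dpos d) + (pre dlam d - (d - 1))"
    by (rule sum_split_top) (simp add: q0_def)
  also have "\<dots> = r - d"
    using dn d_bounds pre_dlam_ge[of d] by (auto simp: q0_def)
  finally show ?thesis by (simp add: degs_def q0_def)
qed

lemma rst_slice_first:
  assumes i: "dpos i = 1" and idx: "(i, j, q) \<in> idx"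
  shows "rst (slice c) (i, j, q) = (c (Suc (pre dlam (dpos j) + q)) :: 'a::comm_ring_1)"
proof -
  let ?r = "Suc (pre dlam (dpos j) + q)"
  have j: "j \<in> {1..n}" "q < part j" using idx by (auto simp: idx_def)
  have r': "?r \<in> {1..N}" "dseq lam ?r = dpos j"
    using dseq_box[OF dpos_in[OF j(1)], of q] j dpos_dpos[OF j(1)] by auto
  have "(\<Sum>x\<in>{1..N}. c x * vv x (i, j, q)) = (\<Sum>x\<in>{1..N}. if x = ?r then c ?r else 0)"
    using i r' by (intro sum.cong) (auto simp: vv_def)
  moreover have "eta (i, j, q) = (0 :: 'a)" using i dpos_in[OF j(1)] by (auto simp: eta_def)
  ultimately show ?thesis using idx r' by (simp add: rst_def slice_def)
qed

lemma slice_w0: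
  assumes k: "k \<in> I0"
  shows "rst (slice c) (w0 k, k, q0 k) = (if dpos k = d then c r else 1 :: 'a::comm_ring_1)"
proof -
  note w = w0_in[OF k]
  have kn: "k \<in> {1..n}" "w0 k \<in> {1..n}" using k w by (auto simp: I0_def)
  show ?thesis
  proof (cases "dpos k = d")
    case True
    have "part k \<le> part (w0 k)"
      using w True d_bounds(1) kn by (intro part_antimono) auto
    moreover have kd: "k = dpos d" using True dpos_dpos[OF kn(1)] by simp
    ultimately have "(w0 k, k, q0 k) \<in> idx"
      using kn k True d_bounds by (auto simp: idx_def q0_def)
    from rst_slice_first[OF _ this, of c] w True show ?thesis
      using k d_bounds(2) by (simp add: q0_def)
  next
    case False
    have "(w0 k, k, q0 k) \<in> idx"
      using kn k False part_pos[OF kn(1)] part_pos[OF kn(2)] by (auto simp: idx_def q0_def)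
    moreover have "Suc (q0 k) = part k" using k False part_pos[OF kn(1)] by (simp add: q0_def)
    moreover have "dpos (w0 k) \<noteq> 1" using w False dpos_in[OF kn(1)] by simp
    ultimately show ?thesis using False w by (subst rst_slice_eta) auto
  qed
qed

lemma slice_support:
  assumes "rst (slice c) (i, j, q) \<noteq> (0 :: 'a::comm_ring_1)"
  shows "dpos i = 1 \<or> dpos i = Suc (dpos j) \<and> q = part j - 1"
  using assms by (cases "dpos i = 1") (auto simp: rst_slice_eta split: if_splits)

text \<open>The highest position in \<open>I\<close> cannot be sent to its successor, so it is sent
  to the first row. Injectivity keeps all others away from that row, so each goes to the next
  position with top degree. Hence \<open>I\<close> is an initial segment and \<open>w\<close> its
  cycle, and the total degree fixes \<open>q\<close> in the last column.\<close>

lemma unique_term: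
  assumes I: "I \<in> subsets d" and w: "w permutes I" and q: "q \<in> degs I (r - d)"
    and nz: "\<And>k. k \<in> I \<Longrightarrow> rst (slice c) (w k, k, q k) \<noteq> (0 :: 'a::comm_ring_1)"
  shows "I = I0 \<and> w = w0 \<and> q = q0"
proof -
  note I' = subsetsD[OF I]
  have In: "k \<in> I \<Longrightarrow> k \<in> {1..n}" for k using I' by blast
  have wI: "k \<in> I \<Longrightarrow> w k \<in> I" for k using permutes_in_image[OF w] by simp
  have "I \<noteq> {}" using I' d_bounds(1) by auto
  define D where "D = Max (dpos ` I)"
  have D: "D \<in> dpos ` I" unfolding D_def using I' \<open>I \<noteq> {}\<close> by (intro Max_in) auto
  then obtain kD where kD: "kD \<in> I" "dpos kD = D" by blast
  have le: "dpos k \<le> D" if "k \<in> I" for k unfolding D_def using I' that by (intro Max_ge) auto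
  have wD: "dpos (w kD) = 1" using slice_support[OF nz[OF kD(1)]] le[OF wI[OF kD(1)]] kD(2) by auto
  have other: "dpos (w k) = Suc (dpos k) \<and> q k = part k - 1" if k: "k \<in> I" "k \<noteq> kD" for k
  proof -
    have "dpos (w k) \<noteq> 1"
    proof
      assume "dpos (w k) = 1"
      then have "w k = w kD" using wD dpos_inj[OF In[OF wI[OF k(1)]] In[OF wI[OF kD(1)]]] by simp
      then show False using permutes_inj[OF w] k(2) by (auto dest: injD)
    qed
    then show ?thesis using slice_support[OF nz[OF k(1)]] by blast
  qed
  have "m \<in> dpos ` I" if "1 \<le> m" "m \<le> D" for m
    using that
  proof (induction m)
    case (Suc m)
    show ?case
    proof (cases "m = 0")
      case True
      then show ?thesis using wD wI[OF kD(1)] by (metis One_nat_def imageI)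
    next
      case False
      then obtain k where k: "k \<in> I" "dpos k = m" using Suc by auto
      then have "k \<noteq> kD" using kD(2) Suc.prems by auto
      then show ?thesis using other[OF k(1)] k(2) wI[OF k(1)] by (metis imageI)
    qed
  qed simp
  moreover have "dpos k \<in> {1..D}" if "k \<in> I" for k using le[OF that] dpos_in[OF In[OF that]] by simp
  ultimately have img: "dpos ` I = {1..D}" by (auto simp: image_iff)
  have "card (dpos ` I) = d" using card_image[OF inj_dpos[of I]] I' by simp
  then have Dd: "D = d" unfolding img by simp
  have II: "I = I0"
  proof -
    have "I = dpos ` dpos ` I"
      using In dpos_dpos by (force simp: image_iff)
    then show ?thesis unfolding img Dd I0_image .
  qed
  have kd: "k = kD \<longleftrightarrow> dpos k = d" if "k \<in> I" for k
    using dpos_inj[OF In[OF that] In[OF kD(1)]] kD(2) Dd by simp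
  have "w k = w0 k" for k
  proof (cases "k \<in> I")
    case True
    have "dpos (w k) = dpos (w0 k)"
      using w0_in[of k] True II other[OF True] wD kd[OF True] by (cases "k = kD") auto
    then show ?thesis
      using dpos_inj[OF In[OF wI[OF True]], of "w0 k"] w0_in[of k] True II In by auto
  next
    case False
    then show ?thesis using permutes_not_in[OF w] II by (simp add: w0_def)
  qed
  then have ww: "w = w0" by (rule HOL.ext)
  have qk: "q k = part k - 1" if "k \<in> I0" "dpos k < d" for k
    using other[of k] that II kd[of k] by auto
  have "sum q I0 = q (dpos d) + (pre dlam d - (d - 1))"
    using qk by (rule sum_split_top)
  moreover have "sum q I0 = r - d" using q II by (simp add: degs_def)
  ultimately have qd: "q (dpos d) = r - pre dlam d - 1"
    using d_bounds pre_dlam_ge[of d] by auto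
  have "q k = q0 k" for k
  proof (cases "k \<in> I0")
    case True
    then have kn: "k \<in> {1..n}" by (simp add: I0_def)
    show ?thesis
    proof (cases "dpos k = d")
      case eq: True
      then have "k = dpos d" using dpos_dpos[OF kn] by simp
      then show ?thesis using True eq qd by (simp add: q0_def)
    next
      case False
      then have "dpos k < d" using True by (simp add: I0_def)
      then show ?thesis using qk[OF True] True False by (simp add: q0_def)
    qed
  next
    case False
    then show ?thesis using q II by (simp add: degs_def q0_def)
  qed
  then show ?thesis using II ww by auto
qed

lemma sym_zz_slice: "sym d (slice c) (zz d (r - d)) = of_int (sign w0) * (c r :: 'a::comm_ring_1)"
proof -
  let ?t = "\<lambda>I q w. of_int (sign w) * (\<Prod>k\<in>I. rst (slice c) (w k, k, q k)) :: 'a"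
  have "sym d (slice c) (zz d (r - d)) = (\<Sum>I\<in>subsets d. \<Sum>q\<in>degs I (r - d). \<Sum>w\<in>perms I. ?t I q w)"
    unfolding zz_def sym_sum
  proof (intro sum.cong refl)
    fix I q w assume I: "I \<in> subsets d" and w: "w \<in> perms I"
    note I' = subsetsD[OF I]
    have "sym d (slice c) (oprod I (\<lambda>k. et (w k) k (q k))) = (\<Prod>k\<in>I. sym 1 (slice c) (et (w k) k (q k) :: 'a mat list \<Rightarrow>\<^sub>0 'a))"
      using I' by (intro sym_oprod len_le_et) auto
    also have "\<dots> = (\<Prod>k\<in>I. rst (slice c) (w k, k, q k))"
    proof (rule prod.cong[OF refl])
      fix k assume k: "k \<in> I"
      then have "w k \<in> I" using w by (simp add: permutes_in_image)
      then show "sym 1 (slice c) (et (w k) k (q k) :: 'a mat list \<Rightarrow>\<^sub>0 'a) = rst (slice c) (w k, k, q k)"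
        using k I' by (intro sym_et) auto
    qed
    finally show "sym d (slice c) (of_int (sign w) * oprod I (\<lambda>k. et (w k) k (q k)) :: 'a mat list \<Rightarrow>\<^sub>0 'a) = ?t I q w"
      by (simp only: fa_scal_of_int[symmetric] sym_scal)
  qed
  also have "\<dots> = (\<Sum>q\<in>degs I0 (r - d). \<Sum>w\<in>perms I0. ?t I0 q w)"
  proof (rule sum_eq_single[OF finite_subsets I0_subsets])
    fix I assume I: "I \<in> subsets d" "I \<noteq> I0"
    have "?t I q w = 0" if "q \<in> degs I (r - d)" "w \<in> perms I" for q w
    proof -
      have "\<exists>k\<in>I. rst (slice c) (w k, k, q k) = (0 :: 'a)"
        using unique_term[OF I(1) _ that(1), of w c] that(2) I(2) by auto
      then have "(\<Prod>k\<in>I. rst (slice c) (w k, k, q k)) = (0 :: 'a)"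
        using subsetsD[OF I(1)] by (intro prod_zero) auto
      then show ?thesis by simp
    qed
    then show "(\<Sum>q\<in>degs I (r - d). \<Sum>w\<in>perms I. ?t I q w) = 0" by (intro sum.neutral ballI)
  qed
  also have fin: "finite I0" by (simp add: I0_def)
  have "(\<Sum>q\<in>degs I0 (r - d). \<Sum>w\<in>perms I0. ?t I0 q w) = (\<Sum>w\<in>perms I0. ?t I0 q0 w)"
  proof (rule sum_eq_single[OF finite_degs[OF fin] q0_degs])
    fix q assume q: "q \<in> degs I0 (r - d)" "q \<noteq> q0"
    have "?t I0 q w = 0" if "w \<in> perms I0" for w
    proof -
      have "\<exists>k\<in>I0. rst (slice c) (w k, k, q k) = (0 :: 'a)"
        using unique_term[OF I0_subsets _ q(1), of w c] that q(2) by auto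
      then have "(\<Prod>k\<in>I0. rst (slice c) (w k, k, q k)) = (0 :: 'a)"
        using fin by (intro prod_zero) auto
      then show ?thesis by simp
    qed
    then show "(\<Sum>w\<in>perms I0. ?t I0 q w) = 0" by (intro sum.neutral ballI)
  qed
  also have "(\<Sum>w\<in>perms I0. ?t I0 q0 w) = ?t I0 q0 w0"
  proof (rule sum_eq_single[OF finite_perms[OF fin]])
    fix w assume w: "w \<in> perms I0" "w \<noteq> w0"
    have "\<exists>k\<in>I0. rst (slice c) (w k, k, q0 k) = (0 :: 'a)"
      using unique_term[OF I0_subsets _ q0_degs, of w c] w by auto
    then have "(\<Prod>k\<in>I0. rst (slice c) (w k, k, q0 k)) = (0 :: 'a)"
      using fin by (intro prod_zero) auto
    then show "?t I0 q0 w = 0" by simp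
  qed (simp add: w0_permutes)
  also have "(\<Prod>k\<in>I0. rst (slice c) (w0 k, k, q0 k)) = c r"
  proof -
    have dn: "dpos d \<in> I0" using d_bounds(1) dpos_in[of d] dpos_dpos[of d] by (simp add: I0_def)
    have "(\<Prod>k\<in>I0. rst (slice c) (w0 k, k, q0 k)) = (\<Prod>k\<in>I0. if k = dpos d then c r else 1)"
    proof (rule prod.cong[OF refl])
      fix k assume k: "k \<in> I0"
      then have "dpos k = d \<longleftrightarrow> k = dpos d" using dpos_dpos d_bounds(1) by (auto simp: I0_def)
      then show "rst (slice c) (w0 k, k, q0 k) = (if k = dpos d then c r else 1)" by (simp add: slice_w0[OF k])
    qed
    then show ?thesis using dn fin by simp
  qed
  finally show ?thesis .
qed

end

definition zsign :: "nat \<Rightarrow> 'a::comm_ring_1" where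
  "zsign r = of_int (sign (w0 (dseq lam r)))"

lemma sym_zgen: "r \<in> {1..N} \<Longrightarrow> sym (dseq lam r) (slice c) (zgen lam r) = zsign r * (c r :: 'a::comm_ring_1)"
  unfolding zsign_def using sym_zz_slice[of r "dseq lam r" c] by (simp add: zgen_zz)

lemma zsign_square: "zsign r * zsign r = (1 :: 'a::comm_ring_1)"
  unfolding zsign_def of_int_mult[symmetric] by simp

lemma len_le_zgen: "r \<in> {1..N} \<Longrightarrow> len_le (dseq lam r) (zgen lam r :: 'a::comm_ring_1 mat list \<Rightarrow>\<^sub>0 'a)"
  by (simp add: zgen_zz len_le_zz)

end

section \<open>Generation and algebraic independence\<close>

text \<open>Lists rather than multisets index the expansion, which avoids multinomial
  coefficients.\<close>

lemma sum_power_lists: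
  fixes f :: "'i \<Rightarrow> 'c::comm_ring_1"
  assumes "finite A"
  shows "(\<Sum>i\<in>A. f i) ^ d = (\<Sum>l\<in>{l. set l \<subseteq> A \<and> length l = d}. prod_list (map f l))"
proof (induction d)
  case 0
  have "{l. set l \<subseteq> A \<and> length l = 0} = {[]}" by auto
  then show ?case by simp
next
  case (Suc d)
  let ?S = "\<lambda>d. {l. set l \<subseteq> A \<and> length l = d}"
  have "(\<Sum>l\<in>?S (Suc d). prod_list (map f l)) = (\<Sum>(i, l)\<in>A \<times> ?S d. f i * prod_list (map f l))"
    by (rule sum.reindex_bij_witness[where i = "\<lambda>(i, l). i # l" and j = "\<lambda>l. (hd l, tl l)"])
      (auto simp: length_Suc_conv)
  also have "\<dots> = (\<Sum>i\<in>A. f i) * (\<Sum>l\<in>?S d. prod_list (map f l))"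
    by (simp add: sum.cartesian_product[symmetric] sum_product)
  finally show ?case using Suc by simp
qed

text \<open>Induction on the number of variables: group the terms by the exponent of the last
  variable; each group vanishes as a function of the remaining ones.\<close>

lemma polynomial_function_zero:
  fixes a :: "'k \<Rightarrow> 'a::field_char_0" and e :: "'k \<Rightarrow> nat \<Rightarrow> nat"
  assumes "finite A" "\<And>x y. x \<in> A \<Longrightarrow> y \<in> A \<Longrightarrow> (\<forall>r\<in>{1..M}. e x r = e y r) \<Longrightarrow> x = y"
    "\<And>c :: nat \<Rightarrow> 'a. (\<Sum>x\<in>A. a x * (\<Prod>r\<in>{1..M}. c r ^ e x r)) = 0" "x \<in> A"
  shows "a x = 0"
  using assms
proof (induction M arbitrary: A x)
  case 0
  then have "A = {x}" by auto
  with 0(3)[of "\<lambda>_. 0"] show ?case by simp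
next
  case (Suc M)
  let ?m = "Max ((\<lambda>x. e x (Suc M)) ` A)"
  let ?B = "\<lambda>j. {y\<in>A. e y (Suc M) = j}"
  have le: "y \<in> A \<Longrightarrow> e y (Suc M) \<le> ?m" for y using Suc.prems(1) by (intro Max_ge) auto
  have "(\<Sum>y\<in>?B (e x (Suc M)). a y * (\<Prod>r\<in>{1..M}. c r ^ e y r)) = 0" for c :: "nat \<Rightarrow> 'a"
  proof (rule poly_fun_eq_0[where m = ?m and a = "\<lambda>j. \<Sum>y\<in>?B j. a y * (\<Prod>r\<in>{1..M}. c r ^ e y r)"])
    fix t :: 'a
    let ?c = "c(Suc M := t)"
    have "(\<Prod>r\<in>{1..Suc M}. ?c r ^ e y r) = (\<Prod>r\<in>{1..M}. c r ^ e y r) * t ^ e y (Suc M)" for y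
    proof -
      have "(\<Prod>r\<in>{1..M}. ?c r ^ e y r) = (\<Prod>r\<in>{1..M}. c r ^ e y r)" by (rule prod.cong) auto
      then show ?thesis by simp
    qed
    then have "0 = (\<Sum>y\<in>A. a y * (\<Prod>r\<in>{1..M}. c r ^ e y r) * t ^ e y (Suc M))"
      using Suc.prems(3)[of ?c] by (simp add: mult.assoc)
    also have "\<dots> = (\<Sum>j\<le>?m. \<Sum>y\<in>?B j. a y * (\<Prod>r\<in>{1..M}. c r ^ e y r) * t ^ e y (Suc M))"
      by (rule sum.group[symmetric]) (use Suc.prems(1) le in auto)
    also have "\<dots> = (\<Sum>j\<le>?m. (\<Sum>y\<in>?B j. a y * (\<Prod>r\<in>{1..M}. c r ^ e y r)) * t ^ j)"
      by (simp add: sum_distrib_right)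
    finally show "(\<Sum>j\<le>?m. (\<Sum>y\<in>?B j. a y * (\<Prod>r\<in>{1..M}. c r ^ e y r)) * t ^ j) = 0" by simp
  qed (use le Suc.prems(4) in auto)
  then show ?case
  proof (rule Suc.IH[rotated 2])
    fix y z assume yz: "y \<in> ?B (e x (Suc M))" "z \<in> ?B (e x (Suc M))" "\<forall>r\<in>{1..M}. e y r = e z r"
    have "\<forall>r\<in>{1..Suc M}. e y r = e z r"
    proof
      fix r assume "r \<in> {1..Suc M}"
      then show "e y r = e z r" using yz by (cases "r = Suc M") auto
    qed
    then show "y = z" using yz Suc.prems(2) by blast
  qed (use Suc.prems in auto)
qed

section \<open>The center as a subalgebra\<close>

context diagram
begin

lemma commutes_sym: "commutes p q \<Longrightarrow> commutes q p"
  unfolding commutes_def by (rule ucong_sym)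

lemma center_mult:
  fixes u v :: "'a::field_char_0 mat list \<Rightarrow>\<^sub>0 'a"
  assumes "u \<in> uea_center N L" "v \<in> uea_center N L"
  shows "u * v \<in> uea_center N L"
proof -
  have "commutes (u * v) (fa_gen A)" if "A \<in> L" for A
    using assms that by (intro commutes_sym[OF commutes_mult]) (auto simp: uea_center_iff intro: commutes_sym)
  then show ?thesis using assms by (simp add: uea_center_iff mult_in_FA)
qed

lemma center_sum:
  fixes f :: "'i \<Rightarrow> 'a::field_char_0 mat list \<Rightarrow>\<^sub>0 'a"
  assumes "\<And>i. i \<in> S \<Longrightarrow> f i \<in> uea_center N L"
  shows "sum f S \<in> uea_center N L"
proof -
  have "commutes (sum f S) (fa_gen A)" if "A \<in> L" for A
    using assms that by (intro commutes_sym[OF commutes_sum]) (auto simp: uea_center_iff intro: commutes_sym)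
  then show ?thesis using assms by (simp add: uea_center_iff sum_in_FA)
qed

lemma center_scal: "(fa_scal c :: 'a::field_char_0 mat list \<Rightarrow>\<^sub>0 'a) \<in> uea_center N L"
  unfolding uea_center_iff by (auto intro: commutes_sym[OF commutes_scal] fa_scal_in_FA)

lemma center_1: "(1 :: 'a::field_char_0 mat list \<Rightarrow>\<^sub>0 'a) \<in> uea_center N L"
  using center_scal[of 1] by (simp only: fa_scal_1)

lemma center_power: "(u :: 'a::field_char_0 mat list \<Rightarrow>\<^sub>0 'a) \<in> uea_center N L \<Longrightarrow> u ^ k \<in> uea_center N L"
  by (induction k) (simp_all add: center_1 center_mult)

lemma center_prod_list:
  fixes ps :: "('a::field_char_0 mat list \<Rightarrow>\<^sub>0 'a) list"
  shows "(\<And>p. p \<in> set ps \<Longrightarrow> p \<in> uea_center N L) \<Longrightarrow> prod_list ps \<in> uea_center N L"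
  by (induction ps) (simp_all add: center_1 center_mult)

lemma center_diff:
  fixes u v :: "'a::field_char_0 mat list \<Rightarrow>\<^sub>0 'a"
  assumes "u \<in> uea_center N L" "v \<in> uea_center N L"
  shows "u - v \<in> uea_center N L"
proof -
  have "commutes (u - v) (fa_gen A)" if "A \<in> L" for A
    using assms that by (intro commutes_sym[OF commutes_diff]) (auto simp: uea_center_iff intro: commutes_sym)
  then show ?thesis using assms by (simp add: uea_center_iff diff_in_FA)
qed

lemma center_cong:
  fixes u v :: "'a::field_char_0 mat list \<Rightarrow>\<^sub>0 'a"
  assumes "u \<in> uea_center N L" "cg u v" "v \<in> FA L"
  shows "v \<in> uea_center N L"
proof -
  have "commutes v (fa_gen A)" if "A \<in> L" for A
    using assms that by (intro commutes_sym[OF commutes_cong[OF assms(2)]])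
      (auto simp: uea_center_iff intro: commutes_sym fa_gen_in_FA)
  then show ?thesis using assms by (simp add: uea_center_iff)
qed

end

section \<open>Monomials in the generators and their weighted degree\<close>

context sorted_diagram
begin

definition zmon :: "(nat \<Rightarrow>\<^sub>0 nat) \<Rightarrow> ('a::field_char_0 mat list \<Rightarrow>\<^sub>0 'a)" where
  "zmon m = prod_list (map (\<lambda>r. zgen lam r ^ Poly_Mapping.lookup m r) [1..<N + 1])"

definition wdeg :: "(nat \<Rightarrow>\<^sub>0 nat) \<Rightarrow> nat" where
  "wdeg m = (\<Sum>r\<in>{1..N}. Poly_Mapping.lookup m r * dseq lam r)"

definition ev :: "((nat \<Rightarrow>\<^sub>0 nat) \<Rightarrow>\<^sub>0 'a::field_char_0) \<Rightarrow> ('a mat list \<Rightarrow>\<^sub>0 'a)" where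
  "ev P = eval_poly P N (zgen lam)"

lemma ev_eq: "ev P = (\<Sum>m\<in>Poly_Mapping.keys P. fa_scal (Poly_Mapping.lookup P m) * zmon m)"
  unfolding ev_def eval_poly_def zmon_def fa_mult_eq_times fa_prod_list_eq fa_pow_eq_power ..

lemma ev_superset:
  assumes "finite S" "Poly_Mapping.keys P \<subseteq> S"
  shows "ev P = (\<Sum>m\<in>S. fa_scal (Poly_Mapping.lookup P m) * zmon m)"
  unfolding ev_eq using assms by (intro sum.mono_neutral_left) (auto simp: in_keys_iff fa_scal_0)

lemma ev_add: "ev (P + Q) = ev P + ev Q"
proof -
  let ?S = "Poly_Mapping.keys P \<union> Poly_Mapping.keys Q"
  have "ev (P + Q) = (\<Sum>m\<in>?S. fa_scal (Poly_Mapping.lookup (P + Q) m) * zmon m)"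
    by (rule ev_superset) (auto simp: Poly_Mapping.keys_add)
  also have "\<dots> = (\<Sum>m\<in>?S. fa_scal (Poly_Mapping.lookup P m) * zmon m) + (\<Sum>m\<in>?S. fa_scal (Poly_Mapping.lookup Q m) * zmon m)"
    by (simp add: lookup_add fa_scal_add distrib_right sum.distrib)
  also have "\<dots> = ev P + ev Q"
    using ev_superset[of ?S P] ev_superset[of ?S Q] by simp
  finally show ?thesis .
qed

lemma ev_0: "ev 0 = 0"
  by (simp add: ev_eq)

lemma ev_single: "ev (Poly_Mapping.single m c) = fa_scal c * zmon m"
  by (cases "c = 0") (simp_all add: ev_eq fa_scal_0)

lemma ev_sum: "ev (sum f S) = (\<Sum>i\<in>S. ev (f i))"
  by (induction S rule: infinite_finite_induct) (simp_all add: ev_0 ev_add)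

lemma zmon_center: "zmon m \<in> uea_center N L"
  unfolding zmon_def by (intro center_prod_list) (auto intro!: center_power zgen_in_center)

lemma ev_center: "ev P \<in> uea_center N L"
  unfolding ev_eq by (intro center_sum center_mult center_scal zmon_center)

lemma zmon_factors:
  "r \<in> set [1..<N + 1] \<Longrightarrow> len_le (Poly_Mapping.lookup m r * dseq lam r)
    (zgen lam r ^ Poly_Mapping.lookup m r :: 'a::field_char_0 mat list \<Rightarrow>\<^sub>0 'a)"
  by (intro len_le_power len_le_zgen) auto

lemma wdeg_list: "(\<Sum>r\<leftarrow>[1..<N + 1]. Poly_Mapping.lookup m r * dseq lam r) = wdeg m"
  unfolding wdeg_def Suc_eq_plus1[symmetric] by (rule sum_list_indices)

lemma len_le_zmon: "len_le (wdeg m) (zmon m :: 'a::field_char_0 mat list \<Rightarrow>\<^sub>0 'a)"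
  unfolding zmon_def wdeg_list[symmetric] by (rule len_le_prod_list) (rule zmon_factors)

lemma sym_zmon: "sym (wdeg m) (slice c) (zmon m) = (\<Prod>r\<in>{1..N}. (zsign r * c r) ^ Poly_Mapping.lookup m r :: 'a::field_char_0)"
proof -
  have "sym (wdeg m) (slice c) (zmon m) =
    (\<Prod>r\<leftarrow>[1..<N + 1]. sym (Poly_Mapping.lookup m r * dseq lam r) (slice c) (zgen lam r ^ Poly_Mapping.lookup m r :: 'a mat list \<Rightarrow>\<^sub>0 'a))"
    unfolding zmon_def wdeg_list[symmetric] by (rule sym_prod_list) (rule zmon_factors)
  also have "\<dots> = (\<Prod>r\<in>{1..N}. sym (Poly_Mapping.lookup m r * dseq lam r) (slice c) (zgen lam r ^ Poly_Mapping.lookup m r :: 'a mat list \<Rightarrow>\<^sub>0 'a))"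
    by (simp add: prod.distinct_set_conv_list[symmetric] atLeastLessThanSuc_atLeastAtMost del: upt_Suc)
  also have "\<dots> = (\<Prod>r\<in>{1..N}. (zsign r * c r) ^ Poly_Mapping.lookup m r)"
    by (rule prod.cong[OF refl]) (simp add: sym_power[OF len_le_zgen] sym_zgen del: atLeastAtMost_iff)
  finally show ?thesis .
qed

text \<open>The inner derivation of the torus element \<open>\<Sum>\<^sub>k dpos k * e\<^sub>k\<^sub>k\<^sub>;\<^sub>0\<close> grades the slice, so that
  only the monomials of weighted degree \<open>d\<close> occur in the restriction of a symbol of degree \<open>d\<close>.\<close>

definition wdop :: "('a::field_char_0 mat, 'a) wfun \<Rightarrow> ('a mat, 'a) wfun" where
  "wdop f = (\<Sum>k\<in>{1..n}. wcst (of_nat (dpos k)) * adiff (Emat lam k k 0) f)"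

lemma wdop_mult: "wdop (f * g) = wdop f * g + f * wdop g"
  unfolding wdop_def by (simp add: adiff_mult sum_distrib_left sum_distrib_right sum.distrib distrib_left mult_ac)

lemma wdop_1: "wdop 1 = 0"
  by (simp add: wdop_def adiff_1)

lemma Emat_diag_L: "k \<in> {1..n} \<Longrightarrow> Emat lam k k 0 \<in> L"
  by (rule Emat_in_L) auto

lemma pair_wdop:
  fixes u :: "'a::field_char_0 mat list \<Rightarrow>\<^sub>0 'a"
  assumes "u \<in> uea_center N L" "good N L f"
  shows "pair (wdop f) u = 0"
  unfolding wdop_def pair_sum pair_wcst
  by (rule sum.neutral) (simp add: pair_adiff_center[OF assms(1) Emat_diag_L assms(2)] del: atLeastAtMost_iff)

text \<open>The torus element scales the entry \<open>(i, j, q)\<close> by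
  \<open>dpos i - dpos j\<close>. The base point \<open>eta\<close> thus has weight 1, and the
  direction of \<open>r\<close> has weight 1 minus its invariant degree.\<close>

lemma wdop_hat:
  fixes \<theta> :: "nat \<times> nat \<times> nat \<Rightarrow> 'a::field_char_0"
  assumes "\<And>i j q. (i, j, q) \<in> idx \<Longrightarrow> (of_nat (dpos i) - of_nat (dpos j)) * \<theta> (i, j, q) = a * \<theta> (i, j, q)"
  shows "ord_ge 2 (wdop (hat \<theta>) - wcst a * hat \<theta>)"
proof -
  let ?E = "\<lambda>k. Emat lam k k 0 :: 'a mat"
  have s: "(\<Sum>k\<in>{1..n}. of_nat (dpos k) * act (?E k) \<theta> b) = a * \<theta> b" if b: "b \<in> idx" for b
  proof -
    obtain i j q where e: "b = (i, j, q)" by (cases b)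
    have ij: "i \<in> {1..n}" "j \<in> {1..n}" using b by (simp_all add: e idx_def)
    have "(\<Sum>k\<in>{1..n}. of_nat (dpos k) * act (?E k) \<theta> b) =
      (\<Sum>k\<in>{1..n}. (if k = i then of_nat (dpos i) * \<theta> b else 0) - (if k = j then of_nat (dpos j) * \<theta> b else 0))"
    proof (rule sum.cong[OF refl])
      fix k assume k: "k \<in> {1..n}"
      then have "(k, k, 0) \<in> idx" using part_pos[OF k] by (simp add: idx_def)
      from act_Emat[OF this b[unfolded e], of \<theta>]
      show "of_nat (dpos k) * act (?E k) \<theta> b =
        (if k = i then of_nat (dpos i) * \<theta> b else 0) - (if k = j then of_nat (dpos j) * \<theta> b else 0)"
        using b by (auto simp: e rst_def)
    qed
    also have "\<dots> = (of_nat (dpos i) - of_nat (dpos j)) * \<theta> b"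
      using ij by (simp add: sum_subtractf left_diff_distrib del: atLeastAtMost_iff)
    finally show ?thesis using assms b by (simp add: e)
  qed
  have "(\<Sum>k\<in>{1..n}. wcst (of_nat (dpos k)) * hat (act (?E k) \<theta>)) = wcst a * hat \<theta>"
  proof (rule wfun_eqI)
    fix w :: "'a mat list"
    have "(\<Sum>k\<in>{1..n}. of_nat (dpos k) * Theta (act (?E k) \<theta>) A) = a * Theta \<theta> A" for A :: "'a mat"
    proof -
      have "(\<Sum>k\<in>{1..n}. of_nat (dpos k) * Theta (act (?E k) \<theta>) A) =
        (\<Sum>b\<in>idx. (\<Sum>k\<in>{1..n}. of_nat (dpos k) * act (?E k) \<theta> b) * coord b A)"
        unfolding Theta_def sum_distrib_left sum_distrib_right by (subst sum.swap) (simp only: mult.assoc)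
      also have "\<dots> = a * Theta \<theta> A"
        unfolding Theta_def sum_distrib_left by (rule sum.cong[OF refl]) (simp only: s mult.assoc)
      finally show ?thesis .
    qed
    then show "ap (\<Sum>k\<in>{1..n}. wcst (of_nat (dpos k)) * hat (act (?E k) \<theta>)) w = ap (wcst a * hat \<theta>) w"
      by (simp add: ap_sum ap_hat)
  qed
  then have "wdop (hat \<theta>) - wcst a * hat \<theta> =
    (\<Sum>k\<in>{1..n}. wcst (of_nat (dpos k)) * (adiff (?E k) (hat \<theta>) - hat (act (?E k) \<theta>)))"
    by (simp add: wdop_def right_diff_distrib sum_subtractf)
  then show ?thesis
    by (simp add: ord_ge_sum ord_ge_wcst ord_ge_adiff_hat Emat_diag_L del: atLeastAtMost_iff)
qed

text \<open>Index 0 stands for the base point, so that a slice point is a single sum with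
  coefficient 1 at index 0; putting \<open>dd 0 = 0\<close> gives all of them the weight
  \<open>1 - dd i\<close>.\<close>

definition vh :: "nat \<Rightarrow> ('a::field_char_0 mat, 'a) wfun" where
  "vh i = (if i = 0 then hat eta else hat (vv i))"

definition dd :: "nat \<Rightarrow> nat" where
  "dd i = (if i = 0 then 0 else dseq lam i)"

lemma wdop_vh: "ord_ge 2 (wdop (vh i) - wcst (1 - of_nat (dd i)) * vh i :: ('a::field_char_0 mat, 'a) wfun)"
proof (cases "i = 0")
  case True
  have "ord_ge 2 (wdop (hat eta) - wcst (1 - of_nat 0) * hat eta :: ('a mat, 'a) wfun)"
    by (rule wdop_hat) (simp add: eta_def)
  then show ?thesis using True by (simp only: vh_def dd_def simp_thms if_True)
next
  case False
  have "ord_ge 2 (wdop (hat (vv i)) - wcst (1 - of_nat (dseq lam i)) * hat (vv i) :: ('a mat, 'a) wfun)"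
  proof (rule wdop_hat)
    fix k j q
    have "vv i (k, j, q) = (0 :: 'a) \<or> dpos k = 1 \<and> dpos j = dseq lam i"
      unfolding vv_def prod.case by (split if_split) blast
    then show "(of_nat (dpos k) - of_nat (dpos j)) * vv i (k, j, q) = (1 - of_nat (dseq lam i)) * (vv i (k, j, q) :: 'a)"
      by (metis of_nat_1 mult_zero_right)
  qed
  then show ?thesis using False by (simp only: vh_def dd_def simp_thms if_False)
qed

lemma vh_good: "good N L (vh i)"
  by (simp add: vh_def good_hat)

lemma vh_ord: "ord_ge 1 (vh i)"
  by (simp add: vh_def ord_ge_hat del: One_nat_def)

lemma vh_prod_ord: "ord_ge (length l) (prod_list (map vh l) :: ('a::field_char_0 mat, 'a) wfun)"
proof -
  have "ord_ge (length (map vh l :: ('a mat, 'a) wfun list)) (prod_list (map vh l) :: ('a mat, 'a) wfun)"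
    by (rule ord_ge_prod_list) (auto simp del: One_nat_def intro: vh_ord)
  then show ?thesis by simp
qed

lemma wdop_prod_list:
  "ord_ge (Suc (length l)) (wdop (prod_list (map vh l)) -
    wcst (\<Sum>i\<leftarrow>l. 1 - of_nat (dd i)) * prod_list (map vh l) :: ('a::field_char_0 mat, 'a) wfun)"
proof (induction l)
  case Nil
  show ?case by (simp add: wdop_1 wcst_0)
next
  case (Cons i l)
  let ?P = "prod_list (map vh l) :: ('a mat, 'a) wfun" and ?a = "1 - of_nat (dd i) :: 'a"
    and ?W = "\<Sum>i\<leftarrow>l. 1 - of_nat (dd i) :: 'a"
  have 1: "ord_ge (2 + length l) ((wdop (vh i) - wcst ?a * vh i) * ?P)"
    by (intro ord_ge_mult wdop_vh vh_prod_ord)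
  have 2: "ord_ge (1 + Suc (length l)) (vh i * (wdop ?P - wcst ?W * ?P))"
    by (intro ord_ge_mult vh_ord Cons)
  have "ord_ge (Suc (Suc (length l))) ((wdop (vh i) - wcst ?a * vh i) * ?P + vh i * (wdop ?P - wcst ?W * ?P))"
    using 1 2 by (intro ord_ge_add) simp_all
  also have "(wdop (vh i) - wcst ?a * vh i) * ?P + vh i * (wdop ?P - wcst ?W * ?P) =
    wdop (vh i * ?P) - wcst (?a + ?W) * (vh i * ?P)"
    unfolding wdop_mult wcst_add by (simp add: algebra_simps)
  finally show ?case by simp
qed

text \<open>Up to higher order the product is an eigenvector of \<open>wdop\<close>, with eigenvalue
  the length of \<open>l\<close> minus the sum of the \<open>dd i\<close>. A central element pairs
  to zero with \<open>wdop\<close> of a good functional, so a nonzero pairing forces the eigenvalue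
  to be zero.\<close>

lemma coefficient_weight:
  fixes u :: "'a::field_char_0 mat list \<Rightarrow>\<^sub>0 'a"
  assumes u: "u \<in> uea_center N L" "len_le (length l) u" and nz: "pair (prod_list (map vh l)) u \<noteq> 0"
  shows "(\<Sum>i\<leftarrow>l. dd i) = length l"
proof -
  let ?P = "prod_list (map vh l) :: ('a mat, 'a) wfun"
  have "pair (wdop ?P - wcst (\<Sum>i\<leftarrow>l. 1 - of_nat (dd i)) * ?P) u = 0"
    by (rule pair_ord_ge[OF wdop_prod_list u(2)])
  moreover have "pair (wdop ?P) u = 0"
    by (rule pair_wdop[OF u(1)]) (auto intro!: good_prod_list simp: vh_good)
  ultimately have "(\<Sum>i\<leftarrow>l. 1 - of_nat (dd i) :: 'a) = 0"
    using nz by (simp add: pair_diff pair_wcst)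
  moreover have "(\<Sum>i\<leftarrow>l. 1 - of_nat (dd i) :: 'a) = of_nat (length l) - of_nat (\<Sum>i\<leftarrow>l. dd i)"
    by (induction l) simp_all
  ultimately have "of_nat (length l) = (of_nat (\<Sum>i\<leftarrow>l. dd i) :: 'a)" by simp
  then show ?thesis by (simp only: of_nat_eq_iff)
qed

section \<open>Interpolating a symbol on the slice\<close>

definition lmon :: "nat list \<Rightarrow> nat \<Rightarrow>\<^sub>0 nat" where
  "lmon l = (\<Sum>i\<leftarrow>l. if i = 0 then 0 else Poly_Mapping.single i 1)"

lemma lmon_Cons: "lmon (i # l) = (if i = 0 then 0 else Poly_Mapping.single i 1) + lmon l"
  by (simp add: lmon_def)

lemma keys_lmon: "Poly_Mapping.keys (lmon l) \<subseteq> set l - {0}"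
proof (induction l)
  case (Cons i l)
  then show ?case
    using Poly_Mapping.keys_add[of "if i = 0 then 0 else Poly_Mapping.single i 1" "lmon l"]
    by (auto simp: lmon_Cons split: if_splits)
qed (simp add: lmon_def)

lemma wdeg_lmon: "set l \<subseteq> {0..N} \<Longrightarrow> wdeg (lmon l) = (\<Sum>i\<leftarrow>l. dd i)"
proof (induction l)
  case Nil
  show ?case by (simp add: lmon_def wdeg_def)
next
  case (Cons i l)
  have "wdeg (lmon (i # l)) = wdeg (if i = 0 then 0 else Poly_Mapping.single i 1) + wdeg (lmon l)"
    unfolding wdeg_def lmon_Cons by (simp add: lookup_add distrib_right sum.distrib)
  moreover have "wdeg (if i = 0 then 0 else Poly_Mapping.single i 1) = dd i"
  proof (cases "i = 0")
    case False
    then have "wdeg (Poly_Mapping.single i 1) = (\<Sum>r\<in>{1..N}. if r = i then dseq lam i else 0)"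
      unfolding wdeg_def by (intro sum.cong) (auto simp: lookup_single when_def)
    then show ?thesis using False Cons.prems by (simp add: dd_def)
  qed (simp add: wdeg_def dd_def)
  ultimately show ?case using Cons by simp
qed

lemma prod_lmon:
  fixes f :: "nat \<Rightarrow> 'a::field_char_0"
  shows "set l \<subseteq> {0..N} \<Longrightarrow> (\<Prod>r\<in>{1..N}. f r ^ Poly_Mapping.lookup (lmon l) r) = (\<Prod>i\<leftarrow>l. if i = 0 then 1 else f i)"
proof (induction l)
  case Nil
  show ?case by (simp add: lmon_def)
next
  case (Cons i l)
  let ?s = "if i = 0 then 0 else Poly_Mapping.single i 1 :: nat \<Rightarrow>\<^sub>0 nat"
  have "(\<Prod>r\<in>{1..N}. f r ^ Poly_Mapping.lookup (lmon (i # l)) r) =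
    (\<Prod>r\<in>{1..N}. f r ^ Poly_Mapping.lookup ?s r) * (\<Prod>r\<in>{1..N}. f r ^ Poly_Mapping.lookup (lmon l) r)"
    unfolding lmon_Cons lookup_add power_add by (rule prod.distrib)
  moreover have "(\<Prod>r\<in>{1..N}. f r ^ Poly_Mapping.lookup ?s r) = (if i = 0 then 1 else f i)"
  proof (cases "i = 0")
    case False
    then have "(\<Prod>r\<in>{1..N}. f r ^ Poly_Mapping.lookup ?s r) = (\<Prod>r\<in>{1..N}. if r = i then f i else 1)"
      by (intro prod.cong) (auto simp: lookup_single when_def)
    then show ?thesis using False Cons.prems by simp
  qed simp
  ultimately show ?case using Cons by simp
qed

lemma slice_coefficients:
  "hat (slice c) = (\<Sum>i\<in>{0..N}. wcst (if i = 0 then 1 else c i :: 'a::field_char_0) * vh i)"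
proof -
  have "hat (\<lambda>b. \<Sum>r\<in>S. c r * vv r b) = (\<Sum>r\<in>S. wcst (c r) * hat (vv r))" if "finite S" for S
    using that
  proof induction
    case empty
    show ?case by (rule wfun_eqI) (simp add: ap_hat Theta_def)
  next
    case (insert r S)
    then show ?case by (simp add: hat_add hat_scale)
  qed
  then have "hat (slice c) = hat eta + (\<Sum>r\<in>{1..N}. wcst (c r) * hat (vv r))"
    unfolding slice_def[abs_def] hat_add by simp
  also have "(\<Sum>r\<in>{1..N}. wcst (c r) * hat (vv r)) = (\<Sum>i\<in>{1..N}. wcst (if i = 0 then 1 else c i) * vh i)"
    by (rule sum.cong) (simp_all add: vh_def)
  also have "hat eta = wcst (if (0::nat) = 0 then 1 else c 0) * vh 0"
    by (simp add: vh_def wcst_1)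
  finally show ?thesis by (simp add: sum.atLeast_Suc_atMost)
qed

lemma slice_power_expand:
  "pair (hat (slice c) ^ d) u = (\<Sum>l\<in>{l. set l \<subseteq> {0..N} \<and> length l = d}.
    (\<Prod>i\<leftarrow>l. if i = 0 then 1 else c i) * pair (prod_list (map vh l)) (u :: 'a::field_char_0 mat list \<Rightarrow>\<^sub>0 'a))"
proof -
  have "prod_list (map (\<lambda>i. wcst (g i) * vh i) l) = wcst (\<Prod>i\<leftarrow>l. g i) * (prod_list (map vh l) :: ('a mat, 'a) wfun)"
    for g :: "nat \<Rightarrow> 'a" and l
    by (induction l) (simp_all add: wcst_1 wcst_mult mult_ac)
  then show ?thesis
    unfolding slice_coefficients sum_power_lists[OF finite_atLeastAtMost] by (simp add: pair_sum pair_wcst)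
qed

text \<open>The generators restrict to signed coordinates of the slice, so substituting them for the
  coordinates in the restricted symbol of \<open>u\<close> reproduces that symbol. The weight
  condition in \<open>W\<close> keeps the words of the result at length at most \<open>d\<close>;
  otherwise the correction could have higher degree than \<open>u\<close>.\<close>

lemma interpolation:
  fixes u :: "'a::field_char_0 mat list \<Rightarrow>\<^sub>0 'a"
  assumes u: "u \<in> uea_center N L" "len_le d u"
  obtains P where "poly_vars_in P {1..N}" "len_le d (ev P)"
    "\<And>c. pair (hat (slice c) ^ d) (u - ev P) = 0"
proof -
  let ?L = "{l. set l \<subseteq> {0..N} \<and> length l = d}"
  define W where "W = {l\<in>?L. (\<Sum>i\<leftarrow>l. dd i) = d}"
  define sg where "sg l = (\<Prod>i\<leftarrow>l. if i = 0 then 1 else zsign i :: 'a)" for l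
  define co where "co l = pair (prod_list (map vh l)) u" for l
  \<comment> \<open>Division by \<open>fact d\<close> undoes the factor in
    \<open>pair_hat_power\<close>; \<open>sg l\<close> is its own inverse and undoes the signs of
    the restricted generators.\<close>
  define P where "P = (\<Sum>l\<in>W. Poly_Mapping.single (lmon l) (co l * sg l / fact d))"
  have finL: "finite ?L" by (rule finite_lists_length_eq) simp
  have WL: "W \<subseteq> ?L" by (auto simp: W_def)
  have "poly_vars_in P {1..N}"
    unfolding poly_vars_in_def
  proof (intro ballI subsetI)
    fix m r assume "m \<in> Poly_Mapping.keys P" and r: "r \<in> Poly_Mapping.keys m"
    then obtain l where "l \<in> W" "m \<in> Poly_Mapping.keys (Poly_Mapping.single (lmon l) (co l * sg l / fact d))"
      using keys_sum[of "\<lambda>l. Poly_Mapping.single (lmon l) (co l * sg l / fact d)" W] unfolding P_def by blast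
    then have "l \<in> W" "m = lmon l" by (auto split: if_splits)
    then show "r \<in> {1..N}" using keys_lmon[of l] r by (fastforce simp: W_def)
  qed
  have evP: "ev P = (\<Sum>l\<in>W. fa_scal (co l * sg l / fact d) * zmon (lmon l))"
    unfolding P_def ev_sum ev_single ..
  have wd: "wdeg (lmon l) = d" if "l \<in> W" for l using that wdeg_lmon[of l] by (simp add: W_def)
  have len_term: "len_le d (fa_scal x * zmon (lmon l) :: 'a mat list \<Rightarrow>\<^sub>0 'a)" if "l \<in> W" for l x
    using len_le_mult[OF len_le_scal[of 0 x] len_le_zmon[of "lmon l"]] wd[OF that] by simp
  have len: "len_le d (ev P)" unfolding evP by (rule len_le_sum) (rule len_term)
  have sgsq: "(\<Prod>i\<leftarrow>l. if i = 0 then 1 else zsign i * c i) = sg l * (\<Prod>i\<leftarrow>l. if i = 0 then 1 else c i)" for l and c :: "nat \<Rightarrow> 'a"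
    unfolding sg_def by (induction l) simp_all
  have sg2: "sg l * sg l = 1" for l
  proof -
    have "sg (i # l) * sg (i # l) = (if i = 0 then 1 else zsign i * zsign i) * (sg l * sg l)" for i l
      by (simp add: sg_def mult_ac)
    then show ?thesis by (induction l) (simp_all add: zsign_square, simp add: sg_def)
  qed
  have "pair (hat (slice c) ^ d) (u - ev P) = 0" for c
  proof -
    let ?C = "\<lambda>l. \<Prod>i\<leftarrow>l. if i = 0 then 1 else c i"
    have "pair (hat (slice c) ^ d) (ev P) = fact d * sym d (slice c) (ev P)"
      by (rule pair_hat_power[OF len])
    also have "sym d (slice c) (ev P) = (\<Sum>l\<in>W. co l * sg l / fact d * (sg l * ?C l))"
      unfolding evP sym_sum sym_scal
    proof (rule sum.cong[OF refl])
      fix l assume l: "l \<in> W"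
      then have "set l \<subseteq> {0..N}" by (simp add: W_def)
      then show "co l * sg l / fact d * sym d (slice c) (zmon (lmon l)) = co l * sg l / fact d * (sg l * ?C l)"
        using sym_zmon[of "lmon l" c] wd[OF l] prod_lmon[of l "\<lambda>r. zsign r * c r"] sgsq[of c l] by simp
    qed
    also have "fact d * \<dots> = (\<Sum>l\<in>W. ?C l * co l)"
      unfolding sum_distrib_left
    proof (rule sum.cong[OF refl])
      fix l
      have "fact d * (co l * sg l / fact d * (sg l * ?C l)) = (sg l * sg l) * (?C l * co l)"
        by (simp add: field_simps)
      then show "fact d * (co l * sg l / fact d * (sg l * ?C l)) = ?C l * co l" by (simp add: sg2)
    qed
    also have "\<dots> = (\<Sum>l\<in>?L. ?C l * co l)"
    proof (rule sum.mono_neutral_left[OF finL WL], rule ballI)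
      fix l assume l: "l \<in> ?L - W"
      have "co l = 0"
      proof (rule ccontr)
        assume "co l \<noteq> 0"
        then have "(\<Sum>i\<leftarrow>l. dd i) = length l"
          using u l unfolding co_def by (intro coefficient_weight[of u l]) auto
        then show False using l by (auto simp: W_def)
      qed
      then show "?C l * co l = 0" by simp
    qed
    also have "\<dots> = pair (hat (slice c) ^ d) u"
      unfolding slice_power_expand co_def ..
    finally show ?thesis by (simp add: pair_diff_right)
  qed
  with \<open>poly_vars_in P {1..N}\<close> len show thesis by (rule that)
qed

text \<open>Subtracting the interpolating polynomial leaves a central element whose symbol vanishes
  on the slice. It is congruent to an element with shorter words, which is again central, and the
  induction continues until no words remain.\<close>

lemma zgen_generate:
  fixes u :: "'a::field_char_0 mat list \<Rightarrow>\<^sub>0 'a"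
  shows "u \<in> uea_center N L \<Longrightarrow> (\<forall>w\<in>Poly_Mapping.keys u. length w < d) \<Longrightarrow>
    \<exists>P. poly_vars_in P {1..N} \<and> cg u (ev P)"
proof (induction d arbitrary: u)
  case 0
  then have "u = 0" by (metis all_not_in_conv keys_eq_empty not_less0)
  then show ?case by (intro exI[of _ 0]) (simp add: poly_vars_in_def ev_0)
next
  case (Suc d)
  have len: "len_le d u" using Suc.prems(2) by (auto simp: len_le_def less_Suc_eq_le)
  obtain P where P: "poly_vars_in P {1..N}" "len_le d (ev P)" "\<And>c. pair (hat (slice c) ^ d) (u - ev P) = 0"
    using interpolation[OF Suc.prems(1) len] by blast
  have cen: "u - ev P \<in> uea_center N L" by (intro center_diff Suc.prems(1) ev_center)
  have "low d (u - ev P)"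
    by (rule low_of_vanishing_on_slice[OF cen len_le_diff[OF len P(2)] P(3)])
  then obtain v where v: "v \<in> FA L" "\<forall>w\<in>Poly_Mapping.keys v. length w < d" "cg (u - ev P) v"
    by (auto simp: low_def)
  have "v \<in> uea_center N L" by (rule center_cong[OF cen v(3,1)])
  from Suc.IH[OF this v(2)] obtain Q where Q: "poly_vars_in Q {1..N}" "cg v (ev Q)" by blast
  have "cg (u - ev P) (ev Q)" by (rule ucong_trans[OF v(3) Q(2)])
  from ucong_add[OF this ucong_refl[of _ _ "ev P"]] have "cg u (ev (P + Q))"
    by (simp add: ev_add add.commute)
  moreover have "poly_vars_in (P + Q) {1..N}"
    using P(1) Q(1) Poly_Mapping.keys_add[of P Q] unfolding poly_vars_in_def by blast
  ultimately show ?case by blast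
qed

text \<open>Symbols are multiplicative, so on the slice the part of largest weighted degree becomes
  a polynomial function with the same coefficients up to sign. Elements of the ideal pair to zero
  with powers of \<open>hat\<close>, which makes this function vanish identically.\<close>

lemma zgen_independent:
  fixes P :: "(nat \<Rightarrow>\<^sub>0 nat) \<Rightarrow>\<^sub>0 'a::field_char_0"
  assumes vars: "poly_vars_in P {1..N}" and zero: "ev P \<in> uea_ideal N L"
  shows "P = 0"
proof (rule ccontr)
  assume "P \<noteq> 0"
  let ?K = "Poly_Mapping.keys P"
  have K: "finite ?K" "?K \<noteq> {}" using \<open>P \<noteq> 0\<close> by (simp_all add: keys_eq_empty)
  define D where "D = Max (wdeg ` ?K)"
  define A where "A = {m\<in>?K. wdeg m = D}"
  have le: "m \<in> ?K \<Longrightarrow> wdeg m \<le> D" for m unfolding D_def using K by (intro Max_ge) auto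
  have "D \<in> wdeg ` ?K" unfolding D_def using K by (intro Max_in) auto
  then obtain m0 where m0: "m0 \<in> A" by (auto simp: A_def)
  have len: "len_le (wdeg m) (fa_scal x * zmon m :: 'a mat list \<Rightarrow>\<^sub>0 'a)" for m x
    using len_le_mult[OF len_le_scal[of 0 x] len_le_zmon[of m]] by simp
  have lenP: "len_le D (ev P)"
    unfolding ev_eq by (rule len_le_sum) (rule len_le_mono[OF len le])
  define a where "a m = Poly_Mapping.lookup P m * (\<Prod>r\<in>{1..N}. zsign r ^ Poly_Mapping.lookup m r)" for m
  have "(\<Sum>m\<in>A. a m * (\<Prod>r\<in>{1..N}. c r ^ Poly_Mapping.lookup m r)) = 0" for c :: "nat \<Rightarrow> 'a"
  proof -
    have "fact D * sym D (slice c) (ev P) = pair (hat (slice c) ^ D) (ev P)"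
      by (rule pair_hat_power[OF lenP, symmetric])
    also have "\<dots> = 0" by (rule good_ideal[OF good_power[OF good_hat] zero])
    finally have "sym D (slice c) (ev P) = 0" by simp
    moreover have "sym D (slice c) (ev P) = (\<Sum>m\<in>?K. sym D (slice c) (fa_scal (Poly_Mapping.lookup P m) * zmon m :: 'a mat list \<Rightarrow>\<^sub>0 'a))"
      unfolding ev_eq sym_sum ..
    moreover have "\<dots> = (\<Sum>m\<in>A. sym D (slice c) (fa_scal (Poly_Mapping.lookup P m) * zmon m :: 'a mat list \<Rightarrow>\<^sub>0 'a))"
    proof (rule sum.mono_neutral_right[OF K(1)])
      show "\<forall>m\<in>?K - A. sym D (slice c) (fa_scal (Poly_Mapping.lookup P m) * zmon m :: 'a mat list \<Rightarrow>\<^sub>0 'a) = 0"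
      proof
        fix m assume "m \<in> ?K - A"
        then have "wdeg m < D" using le[of m] by (auto simp: A_def)
        then show "sym D (slice c) (fa_scal (Poly_Mapping.lookup P m) * zmon m :: 'a mat list \<Rightarrow>\<^sub>0 'a) = 0"
          by (rule sym_large[OF len])
      qed
    qed (auto simp: A_def)
    moreover have "\<dots> = (\<Sum>m\<in>A. a m * (\<Prod>r\<in>{1..N}. c r ^ Poly_Mapping.lookup m r))"
    proof (rule sum.cong[OF refl])
      fix m assume "m \<in> A"
      then have "wdeg m = D" by (simp add: A_def)
      then show "sym D (slice c) (fa_scal (Poly_Mapping.lookup P m) * zmon m :: 'a mat list \<Rightarrow>\<^sub>0 'a) =
        a m * (\<Prod>r\<in>{1..N}. c r ^ Poly_Mapping.lookup m r)"
        using sym_zmon[of m c] by (simp add: sym_scal a_def power_mult_distrib prod.distrib mult.assoc)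
    qed
    ultimately show ?thesis by simp
  qed
  moreover have "m = m'" if "m \<in> A" "m' \<in> A" "\<forall>r\<in>{1..N}. Poly_Mapping.lookup m r = Poly_Mapping.lookup m' r" for m m'
  proof (rule poly_mapping_eqI)
    fix r
    have "Poly_Mapping.keys m \<subseteq> {1..N}" "Poly_Mapping.keys m' \<subseteq> {1..N}"
      using vars that(1,2) by (auto simp: poly_vars_in_def A_def)
    then have "r \<notin> Poly_Mapping.keys m \<and> r \<notin> Poly_Mapping.keys m'" if "r \<notin> {1..N}"
      using that by blast
    then show "Poly_Mapping.lookup m r = Poly_Mapping.lookup m' r"
      using that(3) by (metis not_in_keys_iff_lookup_eq_zero)
  qed
  moreover have "finite A" using K by (simp add: A_def)
  ultimately have "a m0 = 0"
    using m0 by (intro polynomial_function_zero[where A = A and e = Poly_Mapping.lookup and M = N and a = a]) auto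
  moreover have "zsign r \<noteq> (0 :: 'a)" for r using zsign_square[of r, where 'a = 'a] by auto
  ultimately show False using m0 by (simp add: a_def A_def in_keys_iff)
qed

end

theorem mainTheorem1:
  fixes lam :: "nat list"
  assumes F: "alg_closed TYPE('a::field_char_0)"
    and pos: "\<forall>x \<in> set lam. 0 < x"
    and mono: "sorted (rev lam) \<or> sorted lam"
  shows "(\<forall>r \<in> {1..Nsz lam}. (zgen lam r :: 'a mat list \<Rightarrow>\<^sub>0 'a) \<in> uea_center (Nsz lam) (centralizer lam))
       \<and> (\<forall>u \<in> uea_center (Nsz lam) (centralizer lam :: 'a mat set).
            \<exists>P. poly_vars_in P {1..Nsz lam}
                \<and> u - eval_poly P (Nsz lam) (zgen lam) \<in> uea_ideal (Nsz lam) (centralizer lam))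
       \<and> (\<forall>P :: (nat \<Rightarrow>\<^sub>0 nat) \<Rightarrow>\<^sub>0 'a. poly_vars_in P {1..Nsz lam}
            \<longrightarrow> eval_poly P (Nsz lam) (zgen lam) \<in> uea_ideal (Nsz lam) (centralizer lam)
            \<longrightarrow> P = 0)"
proof -
  interpret sorted_diagram lam
    using pos mono by unfold_locales
  show ?thesis
  proof (intro conjI ballI allI impI)
    fix r assume "r \<in> {1..Nsz lam}"
    then show "(zgen lam r :: 'a mat list \<Rightarrow>\<^sub>0 'a) \<in> uea_center (Nsz lam) (centralizer lam)"
      by (rule zgen_in_center)
  next
    fix u :: "'a mat list \<Rightarrow>\<^sub>0 'a"
    assume u: "u \<in> uea_center (Nsz lam) (centralizer lam)"
    obtain d where "len_le d u" using FA_len_le_ex by blast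
    then have "\<forall>w\<in>Poly_Mapping.keys u. length w < Suc d" by (simp add: len_le_def less_Suc_eq_le)
    from zgen_generate[OF u this]
    show "\<exists>P. poly_vars_in P {1..Nsz lam} \<and> u - eval_poly P (Nsz lam) (zgen lam) \<in> uea_ideal (Nsz lam) (centralizer lam)"
      by (simp only: ucong_def ev_def)
  next
    fix P :: "(nat \<Rightarrow>\<^sub>0 nat) \<Rightarrow>\<^sub>0 'a"
    assume "poly_vars_in P {1..Nsz lam}" "eval_poly P (Nsz lam) (zgen lam) \<in> uea_ideal (Nsz lam) (centralizer lam :: 'a mat set)"
    then show "P = 0" by (intro zgen_independent) (simp_all add: ev_def)
  qed
qed

end
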